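(* Consider, for $u_L\in\mathcal H_1$ and $u_R\in\mathcal H$, the admissible weak solution (described in the context) of the Riemann problem $$\partial_t w-\partial_x v=0,\quad \partial_t v-\partial_x\sigma(w)=0,\qquad u(0,x)=u_L\ (x<0),\quad u(0,x)=u_R\ (x>0).$$ Then the states and the wave speeds in the solution are locally Lipschitz continuous functions of the initial constant states $u_L$ and $u_R$. As a consequence, if $u_1(0,\cdot)$ and $u_2(0,\cdot)$ are two Riemann initial data for the system, the corresponding admissible solutions $u_1$ and $u_2$ satisfy the $L^1$ continuity property $$\int_A^B|u_2(t,x)-u_1(t,x)|\,dx\le O(1)\int_{A-c_1t}^{B+c_1t}|u_2(0,x)-u_1(0,x)|\,dx$$ for all $A<B$ and $t\ge0$, where $O(1)$ denotes a constant that is independent of $A,B,t$ and uniform for initial states in compact sets.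
   Context: Notation: $]a,b[$ is the open interval. Let $k_1>k_3>0$, $w_m>w_M>0$, $c_1=\sqrt{k_1}$, $c_3=\sqrt{k_3}$. $\sigma:]-1,\infty[\to\mathbb R$ is $\sigma(w)=k_1w$ for $-1<w\le w_M$, $\sigma(w)=k_3w$ for $w\ge w_m$, and affine on $[w_M,w_m]$ joining these values continuously. Write $u=(v,w)$, $\mathcal H_1=\{(v,w):v\in\mathbb R,-1<w\le w_M\}$, $\mathcal H_3=\{(v,w):v\in\mathbb R,w\ge w_m\}$, $\mathcal H=\mathcal H_1\cup\mathcal H_3$. Entropy dissipation function. $\phi:]-c_3,c_3]\to\mathbb R$ is given with: $\phi\in C^2(]-c_3,0[\cup]0,c_3])$ and $\phi(0\pm),\phi'(0\pm)$ exist; $\lim_{V\to c_3^-}\phi=\overline\psi(c_3)$ and $\phi'''(c_3-)$ exists; $\lim_{V\to-c_3^+}\phi=-\infty$; $\phi$ is increasing; $\underline\psi(V)\le\phi(V)\le0$ for $V\in]-c_3,0]$ and $0\le\phi(V)\le\overline\psi(V)$ for $V\in[0,c_3]$, where $\underline\psi(V)=\frac{k_1-k_3}2w_M\big(w_m-\frac{k_1-V^2}{k_3-V^2}w_M\big)$ and $\overline\psi(V)=\frac{k_1-k_3}2w_m\big(w_M-\frac{k_3-V^2}{k_1-V^2}w_m\big)$. If $\phi$ jumps at $0$, then at $V=0$ "$=\phi(0)$" is understood as membership in $[\phi(0-),\phi(0+)]$. The Rankine–Hugoniot relations for a discontinuity of speed $s$ between $u_a$ (left) and $u_b$ (right) are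 $s(w_b-w_a)+v_b-v_a=0$, $s(v_b-v_a)+\sigma(w_b)-\sigma(w_a)=0$. For a subsonic phase boundary (states in different phases, $|s|\le c_3$) the kinetic relation reads $\frac{k_1-k_3}2(w_Mw_m-w_aw_b)=\phi(s)$ if $u_a\in\mathcal H_1,u_b\in\mathcal H_3$, and $=\phi(-s)$ if $u_a\in\mathcal H_3,u_b\in\mathcal H_1$. Riemann solution (self-similar, constant states separated by discontinuities all satisfying the Rankine–Hugoniot relations). Case a ($u_L\in\mathcal H_1$, $u_R\in\mathcal H_3$): let $h_{LR}=\frac{1}{c_1+c_3}(c_1w_L+c_3w_R+v_R-v_L)$. a1: if $h_{LR}>0$, the states are $u_L$, $u_-\in\mathcal H_1$, $u_+\in\mathcal H_3$, $u_R$ separated by discontinuities of speeds $-c_1<V<c_3$ with $|V|<c_3$, $V$ satisfying the kinetic relation (equivalently $w_-=\frac{c_3+V}{c_1+V}h_{LR}$, $v_-=v_L+c_1(w_--w_L)$, $w_+=\frac{c_1-V}{c_3-V}h_{LR}$, $v_+=v_R+c_3(w_R-w_+)$, and $\frac{k_1-k_3}2(w_Mw_m-w_-w_+)=\phi(V)$). a2: if $h_\infty<h_{LR}\le0$, with $h_\infty=\frac1{c_1+c_3}\{c_3w_R-c_1-(c_3^2w_R^2+(c_1^2+c_3^2)w_R+c_1^2)^{1/2}\}$, the states are $u_L$, $u_-\in\mathcal H_1$, $u_R$ separated by a contact of speed $-c_1$ and a phase boundary of speed $V\in[c_3,c_1[$. (For $h_{LR}\le h_\infty$ there is no solution; such data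 are excluded.) Case b ($u_L,u_R\in\mathcal H_1$): let $h_{LR}=\frac{w_L+w_R}2+\frac{v_R-v_L}{2c_1}$. b1: if $-1<h_{LR}\le w_M$, the states are $u_L$, $u_*=(v_L+c_1(h_{LR}-w_L),h_{LR})\in\mathcal H_1$, $u_R$ separated by contacts of speeds $-c_1,c_1$. b2: if $h_{LR}>w_M$, the states are $u_L$, $u_1\in\mathcal H_1$, $u_2\in\mathcal H_3$, $u_3\in\mathcal H_1$, $u_R$ separated by discontinuities of speeds $-c_1<V'<V<c_1$, with $-c_3<V'<0<V<c_3$ and the kinetic relation satisfied at both phase boundaries. (Data with $h_{LR}\le-1$ are excluded.) In comparing b1 and b2 one sets $u_1=u_3=u_*$ in case b1.
   Formalization: The claim fails at the threshold $h_{LR}=w_M$ between b1 and b2 if $\phi(0-)>\underline\psi(0)$ (solution jumps), so it is proved for sets of data in compacts where $\phi(0-)=\underline\psi(0)$ or the closures of the b1 data and of the b2 data are disjoint. *)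

theory Defs
  imports "HOL-Analysis.Analysis"
begin

section \<open>The material and its stress-strain function\<close>

text \<open>A state is a pair \<open>u = (v, w)\<close>: velocity \<open>v\<close> first, strain \<open>w\<close> second.\<close>

type_synonym state = "real \<times> real"

record material =
  k1 :: real
  k3 :: real
  wM :: real
  wm :: real
  phi :: "real \<Rightarrow> real"

definition c1 :: "material \<Rightarrow> real" where
  "c1 P = sqrt (k1 P)"

definition c3 :: "material \<Rightarrow> real" where
  "c3 P = sqrt (k3 P)"

definition sigma :: "material \<Rightarrow> real \<Rightarrow> real" where
  "sigma P w =
     (if w \<le> wM P then k1 P * w
      else if wm P \<le> w then k3 P * w
      else k1 P * wM P + (k3 P * wm P - k1 P * wM P) / (wm P - wM P) * (w - wM P))"

definition H1 :: "material \<Rightarrow> state set" where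
  "H1 P = {(v, w). -1 < w \<and> w \<le> wM P}"

definition H3 :: "material \<Rightarrow> state set" where
  "H3 P = {(v, w). wm P \<le> w}"


section \<open>The entropy dissipation function\<close>

definition psi_low :: "material \<Rightarrow> real \<Rightarrow> real" where
  "psi_low P V =
     (k1 P - k3 P) / 2 * wM P * (wm P - (k1 P - V\<^sup>2) / (k3 P - V\<^sup>2) * wM P)"

definition psi_up :: "material \<Rightarrow> real \<Rightarrow> real" where
  "psi_up P V =
     (k1 P - k3 P) / 2 * wm P * (wM P - (k3 P - V\<^sup>2) / (k1 P - V\<^sup>2) * wm P)"

text \<open>
  Only the restriction of \<open>phi P\<close> to \<open>]-c3, c3]\<close> matters.  The derivatives \<open>f1\<close>, \<open>f2\<close> are taken
  within \<open>]-c3, 0[ \<union> ]0, c3]\<close>, so they are left derivatives at \<open>c3\<close>.  The existence of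
  \<open>phi'''(c3-)\<close> is required in the form of a left derivative of \<open>phi''\<close> at \<open>c3\<close>, which also
  exists whenever \<open>phi'''\<close> has a left limit at \<open>c3\<close>.  Increasing is meant in the wide sense.
\<close>

definition kinetic_function :: "material \<Rightarrow> bool" where
  "kinetic_function P \<longleftrightarrow>
     (\<exists>f1 f2. let S = {- c3 P<..<0} \<union> {0<..c3 P} in
        (\<forall>V\<in>S. (phi P has_real_derivative f1 V) (at V within S)) \<and>
        (\<forall>V\<in>S. (f1 has_real_derivative f2 V) (at V within S)) \<and>
        continuous_on S f2 \<and>
        (\<exists>l. (f1 \<longlongrightarrow> l) (at_left 0)) \<and> (\<exists>l. (f1 \<longlongrightarrow> l) (at_right 0)) \<and>
        (\<exists>D. (f2 has_real_derivative D) (at (c3 P) within S))) \<and>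
     (\<exists>l. (phi P \<longlongrightarrow> l) (at_left 0)) \<and> (\<exists>l. (phi P \<longlongrightarrow> l) (at_right 0)) \<and>
     (phi P \<longlongrightarrow> psi_up P (c3 P)) (at_left (c3 P)) \<and>
     filterlim (phi P) at_bot (at_right (- c3 P)) \<and>
     mono_on {- c3 P<..c3 P} (phi P) \<and>
     (\<forall>V\<in>{- c3 P<..0}. psi_low P V \<le> phi P V \<and> phi P V \<le> 0) \<and>
     (\<forall>V\<in>{0..c3 P}. 0 \<le> phi P V \<and> phi P V \<le> psi_up P V)"

definition phi_0_minus :: "material \<Rightarrow> real" where
  "phi_0_minus P = Lim (at_left 0) (phi P)"

definition phi_0_plus :: "material \<Rightarrow> real" where
  "phi_0_plus P = Lim (at_right 0) (phi P)"

text \<open>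
  ``\<open>y = phi(V)\<close>'', read as \<open>y \<in> [phi(0-), phi(0+)]\<close> at \<open>V = 0\<close>.  When \<open>phi\<close> has no jump at \<open>0\<close>,
  this interval is \<open>{phi(0)}\<close>, because \<open>phi\<close> is increasing.
\<close>

definition eq_phi :: "material \<Rightarrow> real \<Rightarrow> real \<Rightarrow> bool" where
  "eq_phi P y V \<longleftrightarrow> (if V = 0 then y \<in> {phi_0_minus P..phi_0_plus P} else y = phi P V)"


section \<open>Discontinuities\<close>

definition rankine_hugoniot :: "material \<Rightarrow> real \<Rightarrow> state \<Rightarrow> state \<Rightarrow> bool" where
  "rankine_hugoniot P s ua ub \<longleftrightarrow>
     s * (snd ub - snd ua) + (fst ub - fst ua) = 0 \<and>
     s * (fst ub - fst ua) + (sigma P (snd ub) - sigma P (snd ua)) = 0"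

definition kinetic_relation :: "material \<Rightarrow> real \<Rightarrow> state \<Rightarrow> state \<Rightarrow> bool" where
  "kinetic_relation P s ua ub \<longleftrightarrow>
     (let y = (k1 P - k3 P) / 2 * (wM P * wm P - snd ua * snd ub) in
        (ua \<in> H1 P \<and> ub \<in> H3 P \<longrightarrow> eq_phi P y s) \<and>
        (ua \<in> H3 P \<and> ub \<in> H1 P \<longrightarrow> eq_phi P y (- s)))"

definition phase_boundary :: "material \<Rightarrow> real \<Rightarrow> state \<Rightarrow> state \<Rightarrow> bool" where
  "phase_boundary P s ua ub \<longleftrightarrow>
     (ua \<in> H1 P \<and> ub \<in> H3 P \<or> ua \<in> H3 P \<and> ub \<in> H1 P) \<and>
     rankine_hugoniot P s ua ub \<and>
     (\<bar>s\<bar> \<le> c3 P \<longrightarrow> kinetic_relation P s ua ub)"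


section \<open>The Riemann data, by cases\<close>

type_synonym riemann_data = "state \<times> state"

definition h_a :: "material \<Rightarrow> riemann_data \<Rightarrow> real" where
  "h_a P = (\<lambda>((vL, wL), (vR, wR)).
     1 / (c1 P + c3 P) * (c1 P * wL + c3 P * wR + vR - vL))"

definition h_infinity :: "material \<Rightarrow> riemann_data \<Rightarrow> real" where
  "h_infinity P = (\<lambda>((vL, wL), (vR, wR)).
     1 / (c1 P + c3 P) *
       (c3 P * wR - c1 P - sqrt ((c3 P)\<^sup>2 * wR\<^sup>2 + ((c1 P)\<^sup>2 + (c3 P)\<^sup>2) * wR + (c1 P)\<^sup>2)))"

definition h_b :: "material \<Rightarrow> riemann_data \<Rightarrow> real" where
  "h_b P = (\<lambda>((vL, wL), (vR, wR)). (wL + wR) / 2 + (vR - vL) / (2 * c1 P))"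

definition data_a1 :: "material \<Rightarrow> riemann_data set" where
  "data_a1 P = {d \<in> H1 P \<times> H3 P. 0 < h_a P d}"

definition data_a2 :: "material \<Rightarrow> riemann_data set" where
  "data_a2 P = {d \<in> H1 P \<times> H3 P. h_infinity P d < h_a P d \<and> h_a P d \<le> 0}"

definition data_b1 :: "material \<Rightarrow> riemann_data set" where
  "data_b1 P = {d \<in> H1 P \<times> H1 P. -1 < h_b P d \<and> h_b P d \<le> wM P}"

definition data_b2 :: "material \<Rightarrow> riemann_data set" where
  "data_b2 P = {d \<in> H1 P \<times> H1 P. wM P < h_b P d}"

definition data_a :: "material \<Rightarrow> riemann_data set" where
  "data_a P = data_a1 P \<union> data_a2 P"

definition data_b :: "material \<Rightarrow> riemann_data set" where
  "data_b P = data_b1 P \<union> data_b2 P"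


section \<open>The Riemann solution\<close>

text \<open>
  The intermediate states and the speeds that depend on the data; the contacts have the fixed
  speeds \<open>-c1\<close>, \<open>c1\<close> in phase 1 and \<open>c3\<close> in phase 3.  The arguments are
  \<open>Fan_a1 u_- u_+ V\<close>, \<open>Fan_a2 u_- V\<close>, \<open>Fan_b1 u_*\<close> and \<open>Fan_b2 u_1 u_2 u_3 V' V\<close>.
\<close>

datatype fan =
    Fan_a1 state state real
  | Fan_a2 state real
  | Fan_b1 state
  | Fan_b2 state state state real real

fun is_riemann_fan :: "material \<Rightarrow> riemann_data \<Rightarrow> fan \<Rightarrow> bool" where
  "is_riemann_fan P (uL, uR) (Fan_a1 um up V) \<longleftrightarrow>
     (uL, uR) \<in> data_a1 P \<and> um \<in> H1 P \<and> up \<in> H3 P \<and> \<bar>V\<bar> < c3 P \<and>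
     rankine_hugoniot P (- c1 P) uL um \<and> phase_boundary P V um up \<and>
     rankine_hugoniot P (c3 P) up uR"
| "is_riemann_fan P (uL, uR) (Fan_a2 um V) \<longleftrightarrow>
     (uL, uR) \<in> data_a2 P \<and> um \<in> H1 P \<and> c3 P \<le> V \<and> V < c1 P \<and>
     rankine_hugoniot P (- c1 P) uL um \<and> phase_boundary P V um uR"
| "is_riemann_fan P (uL, uR) (Fan_b1 us) \<longleftrightarrow>
     (uL, uR) \<in> data_b1 P \<and> us \<in> H1 P \<and>
     rankine_hugoniot P (- c1 P) uL us \<and> rankine_hugoniot P (c1 P) us uR"
| "is_riemann_fan P (uL, uR) (Fan_b2 u1 u2 u3 V' V) \<longleftrightarrow>
     (uL, uR) \<in> data_b2 P \<and> u1 \<in> H1 P \<and> u2 \<in> H3 P \<and> u3 \<in> H1 P \<and>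
     - c3 P < V' \<and> V' < 0 \<and> 0 < V \<and> V < c3 P \<and>
     rankine_hugoniot P (- c1 P) uL u1 \<and> phase_boundary P V' u1 u2 \<and>
     phase_boundary P V u2 u3 \<and> rankine_hugoniot P (c1 P) u3 uR"

definition riemann_fan :: "material \<Rightarrow> riemann_data \<Rightarrow> fan" where
  "riemann_fan P d = (THE F. is_riemann_fan P d F)"

text \<open>
  The components of a fan, left unspecified in the cases where they do not occur.  In case b1 the
  states \<open>u_1\<close> and \<open>u_3\<close> are both \<open>u_*\<close>.
\<close>

fun u_minus :: "fan \<Rightarrow> state" where
  "u_minus (Fan_a1 um up V) = um"
| "u_minus (Fan_a2 um V) = um"

fun u_plus :: "fan \<Rightarrow> state" where
  "u_plus (Fan_a1 um up V) = up"

fun u_1 :: "fan \<Rightarrow> state" where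
  "u_1 (Fan_b1 us) = us"
| "u_1 (Fan_b2 u1 u2 u3 V' V) = u1"

fun u_2 :: "fan \<Rightarrow> state" where
  "u_2 (Fan_b2 u1 u2 u3 V' V) = u2"

fun u_3 :: "fan \<Rightarrow> state" where
  "u_3 (Fan_b1 us) = us"
| "u_3 (Fan_b2 u1 u2 u3 V' V) = u3"

fun speed_V :: "fan \<Rightarrow> real" where
  "speed_V (Fan_a1 um up V) = V"
| "speed_V (Fan_a2 um V) = V"
| "speed_V (Fan_b2 u1 u2 u3 V' V) = V"

fun speed_V' :: "fan \<Rightarrow> real" where
  "speed_V' (Fan_b2 u1 u2 u3 V' V) = V'"

text \<open>
  A wave is its speed together with the state on its right; \<open>step_profile uL ws \<xi>\<close> is the value on
  the ray \<open>x = \<xi> t\<close> of the fan that starts from \<open>uL\<close> and crosses the waves \<open>ws\<close>, listed by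
  increasing speed.  On the finitely many rays that carry a wave the right state is taken.
\<close>

fun step_profile :: "state \<Rightarrow> (real \<times> state) list \<Rightarrow> real \<Rightarrow> state" where
  "step_profile u [] \<xi> = u"
| "step_profile u ((s, u') # ws) \<xi> = (if \<xi> < s then u else step_profile u' ws \<xi>)"

fun waves :: "material \<Rightarrow> state \<Rightarrow> fan \<Rightarrow> (real \<times> state) list" where
  "waves P uR (Fan_a1 um up V) = [(- c1 P, um), (V, up), (c3 P, uR)]"
| "waves P uR (Fan_a2 um V) = [(- c1 P, um), (V, uR)]"
| "waves P uR (Fan_b1 us) = [(- c1 P, us), (c1 P, uR)]"
| "waves P uR (Fan_b2 u1 u2 u3 V' V) = [(- c1 P, u1), (V', u2), (V, u3), (c1 P, uR)]"

fun riemann_sol :: "material \<Rightarrow> riemann_data \<Rightarrow> real \<Rightarrow> real \<Rightarrow> state" where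
  "riemann_sol P (uL, uR) t x =
     (if t = 0 then (if x < 0 then uL else uR)
      else step_profile uL (waves P uR (riemann_fan P (uL, uR))) (x / t))"


section \<open>The initiation threshold\<close>

text \<open>
  When the datum decreases to the threshold \<open>h_b = wM\<close> between the cases b1 and b2, the solution of
  case b2 tends to that of case b1 if and only if \<open>phi(0-) = psi_low(0)\<close>.  If
  \<open>phi(0-) > psi_low(0)\<close>, then \<open>V'\<close> and \<open>V\<close> have non-zero limits there, so the new phase has
  non-zero width and the solution jumps.  A set of data is compatible with the initiation of
  phase 3 if there is no such jump, or if its data of case b1 stay away from those of case b2.
\<close>

definition initiation_compatible :: "material \<Rightarrow> riemann_data set \<Rightarrow> bool" where
  "initiation_compatible P S \<longleftrightarrow>
     phi_0_minus P = psi_low P 0 \<or> closure (S \<inter> data_b1 P) \<inter> closure (S \<inter> data_b2 P) = {}"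

end

theory Submission
  imports Defs
begin

text \<open>
  In each case the Riemann problem reduces to one scalar equation for the speed \<open>V\<close> of the phase
  boundary, driven by the single datum \<open>h_LR\<close>.  In case a1 it reads
  \<open>h\<^sup>2 = y (c\<^sub>3 - V) (c\<^sub>1 + V) / ((c\<^sub>3 + V) (c\<^sub>1 - V))\<close>, where \<open>y = w\<^sub>- w\<^sub>+\<close> is fixed by the kinetic relation and
  is antitone in \<open>V\<close>.  The right-hand side is therefore strictly monotone, at a rate that
  monotonicity of \<open>\<phi>\<close> alone makes uniform; the jump of \<open>\<phi>\<close> at \<open>0\<close> is harmless, and \<open>V\<close> is a
  Lipschitz function of \<open>h\<close>.  Case b2 is the same with the symmetric fan \<open>V' = - V\<close>, and case a2 is
  explicit.  Smoothness of \<open>\<phi>\<close> is needed only for \<open>w\<^sub>+\<close> as \<open>V\<close> tends to \<open>c\<^sub>3\<close> and \<open>h\<close> to \<open>0\<close>, where it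
  controls the quotient \<open>y / (c\<^sub>3 - V)\<close>.

  For the \<open>L\<^sup>1\<close> estimate, two solutions differ by a multiple of the distance of the data except between
  the two positions of a moving phase boundary, whose speed stays uniformly below \<open>c\<^sub>1\<close>.
\<close>

section \<open>Locally uniform Lipschitz continuity\<close>

text \<open>Eliminating the velocities leaves two relations that are linear in the strains; solving
  them for the strains turns the kinetic relation into the scalar equation. Two difficulties shape
  the estimates. When \<open>h\<close> tends to \<open>0\<close> in case a1, the equation controls
  only differences of \<open>h\<^sup>2\<close>. The loss is repaired by a bound
  \<open>c\<^sub>3 - V \<le> K * h\<close>, which rests on the entropy bound \<open>psi_up\<close>.
  There \<open>w_plus\<close> is also a quotient of two vanishing quantities, so its square is
  studied, and \<open>wm P \<le> w_plus h V\<close> permits taking the root. The other difficulty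
  lies at the interfaces between cases. The data form an arbitrary subset of a compact set, so two
  data from different cases cannot be joined by a segment inside the set. At \<open>h = 0\<close> in
  case a, and at the initiation threshold when \<open>phi_0_minus P = psi_low P 0\<close>, both
  sides are compared with a common limit value at a rate linear in \<open>h\<close>. Where no such
  limit exists, a positive distance between the pieces takes its place.\<close>

definition lips :: "'a::metric_space set \<Rightarrow> ('a \<Rightarrow> 'b::metric_space) \<Rightarrow> bool" where
  "lips X f \<longleftrightarrow> (\<exists>L. L-lipschitz_on X f)"

lemma lipsI:
  assumes "\<And>x y. x \<in> X \<Longrightarrow> y \<in> X \<Longrightarrow> dist (f x) (f y) \<le> C * dist x y"
  shows "lips X f"
  unfolding lips_def
proof (intro exI lipschitz_onI)
  fix x y assume "x \<in> X" "y \<in> X"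
  then have "dist (f x) (f y) \<le> C * dist x y" using assms by blast
  \<comment> \<open>\<open>lipschitz_on\<close> demands a nonnegative constant, while
    \<open>C\<close> may be negative.\<close>
  also have "\<dots> \<le> max C 0 * dist x y" by (intro mult_right_mono) auto
  finally show "dist (f x) (f y) \<le> max C 0 * dist x y" .
qed simp

lemma lipsE:
  assumes "lips X f"
  obtains L where "0 \<le> L" "\<And>x y. x \<in> X \<Longrightarrow> y \<in> X \<Longrightarrow> dist (f x) (f y) \<le> L * dist x y"
  using assms unfolding lips_def by (meson lipschitz_on_def)

lemma lips_subset: "lips Y f \<Longrightarrow> X \<subseteq> Y \<Longrightarrow> lips X f"
  unfolding lips_def using lipschitz_on_subset by blast

lemma lips_cong: "lips X g \<Longrightarrow> (\<And>x. x \<in> X \<Longrightarrow> f x = g x) \<Longrightarrow> lips X f"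
  unfolding lips_def lipschitz_on_def by (metis (no_types, lifting))

lemma lips_const: "lips X (\<lambda>x. c)"
  by (rule lipsI[of _ _ 0]) simp

lemma lips_ident: "lips X (\<lambda>x. x)"
  by (rule lipsI[of _ _ 1]) simp

lemma lips_bounded:
  assumes "lips X f" "bounded X"
  shows "bounded (f ` X)"
proof -
  obtain L where L: "0 \<le> L" "\<And>x y. x \<in> X \<Longrightarrow> y \<in> X \<Longrightarrow> dist (f x) (f y) \<le> L * dist x y"
    using lipsE[OF assms(1)] by blast
  obtain e where e: "\<And>x y. x \<in> X \<Longrightarrow> y \<in> X \<Longrightarrow> dist x y \<le> e"
    using assms(2) bounded_two_points[of X] by auto
  have "dist (f x) (f y) \<le> L * e" if "x \<in> X" "y \<in> X" for x y
    using L(2)[OF that] mult_left_mono[OF e[OF that] L(1)] by linarith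
  then show ?thesis
    unfolding bounded_two_points by (intro exI[of _ "L * e"]) blast
qed

lemma lips_bounded_norm:
  fixes f :: "'a::metric_space \<Rightarrow> 'b::real_normed_vector"
  assumes "lips X f" "bounded X"
  obtains B where "0 < B" "\<And>x. x \<in> X \<Longrightarrow> norm (f x) \<le> B"
  using lips_bounded[OF assms] unfolding bounded_pos by blast

lemma lips_compose:
  assumes "lips Y f" "lips X g" "g ` X \<subseteq> Y"
  shows "lips X (\<lambda>x. f (g x))"
proof -
  obtain L where L: "0 \<le> L" "\<And>x y. x \<in> Y \<Longrightarrow> y \<in> Y \<Longrightarrow> dist (f x) (f y) \<le> L * dist x y"
    using lipsE[OF assms(1)] by blast
  obtain M where M: "0 \<le> M" "\<And>x y. x \<in> X \<Longrightarrow> y \<in> X \<Longrightarrow> dist (g x) (g y) \<le> M * dist x y"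
    using lipsE[OF assms(2)] by blast
  show ?thesis
  proof (rule lipsI[of _ _ "L * M"])
    fix x y assume xy: "x \<in> X" "y \<in> X"
    then have "dist (f (g x)) (f (g y)) \<le> L * dist (g x) (g y)"
      using L(2) assms(3) by blast
    also have "\<dots> \<le> L * (M * dist x y)"
      using M(2)[OF xy] L(1) by (rule mult_left_mono)
    finally show "dist (f (g x)) (f (g y)) \<le> L * M * dist x y"
      by (simp add: mult.assoc)
  qed
qed

lemma lips_via:
  assumes "lips X h" "\<And>x y. x \<in> X \<Longrightarrow> y \<in> X \<Longrightarrow> dist (f x) (f y) \<le> K * dist (h x) (h y)" "0 \<le> K"
  shows "lips X f"
proof -
  obtain M where M: "0 \<le> M" "\<And>x y. x \<in> X \<Longrightarrow> y \<in> X \<Longrightarrow> dist (h x) (h y) \<le> M * dist x y"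
    using lipsE[OF assms(1)] by blast
  show ?thesis
  proof (rule lipsI[of _ _ "K * M"])
    fix x y assume xy: "x \<in> X" "y \<in> X"
    have "dist (f x) (f y) \<le> K * dist (h x) (h y)"
      using assms(2)[OF xy] .
    also have "\<dots> \<le> K * (M * dist x y)"
      using M(2)[OF xy] assms(3) by (rule mult_left_mono)
    finally show "dist (f x) (f y) \<le> K * M * dist x y"
      by (simp add: mult.assoc)
  qed
qed

lemma lips_fst: "lips X f \<Longrightarrow> lips X (\<lambda>x. fst (f x))"
  by (rule lips_via[of X f _ 1]) (auto simp: dist_fst_le)

lemma lips_snd: "lips X f \<Longrightarrow> lips X (\<lambda>x. snd (f x))"
  by (rule lips_via[of X f _ 1]) (auto simp: dist_snd_le)

lemma dist_Pair_le_add: "dist (a, b) (a', b') \<le> dist a a' + dist b b'"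
  unfolding dist_Pair_Pair by (rule sqrt_sum_squares_le_sum) auto

lemma lips_Pair:
  assumes "lips X f" "lips X g"
  shows "lips X (\<lambda>x. (f x, g x))"
proof -
  obtain L where L: "0 \<le> L" "\<And>x y. x \<in> X \<Longrightarrow> y \<in> X \<Longrightarrow> dist (f x) (f y) \<le> L * dist x y"
    using lipsE[OF assms(1)] by blast
  obtain M where M: "0 \<le> M" "\<And>x y. x \<in> X \<Longrightarrow> y \<in> X \<Longrightarrow> dist (g x) (g y) \<le> M * dist x y"
    using lipsE[OF assms(2)] by blast
  show ?thesis
  proof (rule lipsI[of _ _ "L + M"])
    fix x y assume "x \<in> X" "y \<in> X"
    then show "dist (f x, g x) (f y, g y) \<le> (L + M) * dist x y"
      using L(2)[of x y] M(2)[of x y] dist_Pair_le_add[of "f x" "g x" "f y" "g y"]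
      unfolding distrib_right by linarith
  qed
qed

lemma lips_add:
  fixes f g :: "'a::metric_space \<Rightarrow> 'b::real_normed_vector"
  assumes "lips X f" "lips X g"
  shows "lips X (\<lambda>x. f x + g x)"
proof -
  obtain L where L: "0 \<le> L" "\<And>x y. x \<in> X \<Longrightarrow> y \<in> X \<Longrightarrow> dist (f x) (f y) \<le> L * dist x y"
    using lipsE[OF assms(1)] by blast
  obtain M where M: "0 \<le> M" "\<And>x y. x \<in> X \<Longrightarrow> y \<in> X \<Longrightarrow> dist (g x) (g y) \<le> M * dist x y"
    using lipsE[OF assms(2)] by blast
  show ?thesis
  proof (rule lipsI[of _ _ "L + M"])
    fix x y assume "x \<in> X" "y \<in> X"
    then show "dist (f x + g x) (f y + g y) \<le> (L + M) * dist x y"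
      using L(2)[of x y] M(2)[of x y] dist_triangle_add[of "f x" "g x" "f y" "g y"]
      unfolding distrib_right by linarith
  qed
qed

lemma lips_uminus:
  fixes f :: "'a::metric_space \<Rightarrow> 'b::real_normed_vector"
  shows "lips X f \<Longrightarrow> lips X (\<lambda>x. - f x)"
  by (rule lips_via[of X f _ 1]) (auto simp: dist_minus)

lemma lips_diff:
  fixes f g :: "'a::metric_space \<Rightarrow> 'b::real_normed_vector"
  assumes "lips X f" "lips X g"
  shows "lips X (\<lambda>x. f x - g x)"
  using lips_add[OF assms(1) lips_uminus[OF assms(2)]] by simp

lemma lips_mult:
  fixes f g :: "'a::metric_space \<Rightarrow> real"
  assumes "bounded X" "lips X f" "lips X g"
  shows "lips X (\<lambda>x. f x * g x)"
proof -
  obtain L where L: "0 \<le> L" "\<And>x y. x \<in> X \<Longrightarrow> y \<in> X \<Longrightarrow> dist (f x) (f y) \<le> L * dist x y"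
    using lipsE[OF assms(2)] by blast
  obtain M where M: "0 \<le> M" "\<And>x y. x \<in> X \<Longrightarrow> y \<in> X \<Longrightarrow> dist (g x) (g y) \<le> M * dist x y"
    using lipsE[OF assms(3)] by blast
  obtain B where B: "0 < B" "\<And>x. x \<in> X \<Longrightarrow> norm (f x) \<le> B"
    using lips_bounded_norm[OF assms(2,1)] by blast
  obtain C where C: "0 < C" "\<And>x. x \<in> X \<Longrightarrow> norm (g x) \<le> C"
    using lips_bounded_norm[OF assms(3,1)] by blast
  show ?thesis
  proof (rule lipsI[of _ _ "L * C + B * M"])
    fix x y assume xy: "x \<in> X" "y \<in> X"
    have "f x * g x - f y * g y = (f x - f y) * g x + f y * (g x - g y)" by algebra
    then have "dist (f x * g x) (f y * g y) \<le> \<bar>f x - f y\<bar> * \<bar>g x\<bar> + \<bar>f y\<bar> * \<bar>g x - g y\<bar>"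
      unfolding dist_real_def abs_mult[symmetric] by linarith
    also have "\<dots> \<le> (L * dist x y) * C + B * (M * dist x y)"
      using L(2)[OF xy] M(2)[OF xy] B(2)[OF xy(2)] C(2)[OF xy(1)] L(1) M(1) B(1) C(1)
      by (intro add_mono mult_mono) (auto simp: dist_real_def)
    finally show "dist (f x * g x) (f y * g y) \<le> (L * C + B * M) * dist x y"
      by (simp add: algebra_simps)
  qed
qed

lemma lips_inverse:
  fixes f :: "'a::metric_space \<Rightarrow> real"
  assumes "lips X f" "0 < \<delta>" "\<And>x. x \<in> X \<Longrightarrow> \<delta> \<le> f x"
  shows "lips X (\<lambda>x. inverse (f x))"
proof (rule lips_via[OF assms(1), of _ "inverse \<delta> * inverse \<delta>"])
  fix x y assume xy: "x \<in> X" "y \<in> X"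
  have p: "0 < f x" "0 < f y" using assms(2) assms(3)[OF xy(1)] assms(3)[OF xy(2)] by linarith+
  then have "dist (inverse (f x)) (inverse (f y)) = inverse (f x) * inverse (f y) * dist (f x) (f y)"
    by (simp add: dist_real_def inverse_diff_inverse abs_mult abs_minus_commute)
  also have "\<dots> \<le> inverse \<delta> * inverse \<delta> * dist (f x) (f y)"
    using p assms xy by (intro mult_right_mono mult_mono le_imp_inverse_le) auto
  finally show "dist (inverse (f x)) (inverse (f y)) \<le> inverse \<delta> * inverse \<delta> * dist (f x) (f y)" .
qed (use assms in auto)

lemma lips_divide:
  fixes f g :: "'a::metric_space \<Rightarrow> real"
  assumes "bounded X" "lips X f" "lips X g" "0 < \<delta>" "\<And>x. x \<in> X \<Longrightarrow> \<delta> \<le> g x"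
  shows "lips X (\<lambda>x. f x / g x)"
  using lips_mult[OF assms(1,2) lips_inverse[OF assms(3-5)]] by (simp add: divide_inverse)

lemma lips_power2:
  fixes f :: "'a::metric_space \<Rightarrow> real"
  assumes "bounded X" "lips X f"
  shows "lips X (\<lambda>x. (f x)\<^sup>2)"
  using lips_mult[OF assms assms(2)] by (simp add: power2_eq_square)

text \<open>The difference of the squares is the difference times a sum that is at least
  \<open>2 * \<delta>\<close>. It serves for quantities accessible only through their square, such
  as \<open>w_plus\<close> for speeds near \<open>c\<^sub>3\<close>.\<close>

lemma lips_of_square:
  fixes f :: "'a::metric_space \<Rightarrow> real"
  assumes "lips X (\<lambda>x. (f x)\<^sup>2)" "0 < \<delta>" "\<And>x. x \<in> X \<Longrightarrow> \<delta> \<le> f x"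
  shows "lips X f"
proof (rule lips_via[OF assms(1), of _ "1 / (2 * \<delta>)"])
  fix x y assume xy: "x \<in> X" "y \<in> X"
  have "2 * \<delta> \<le> f x + f y" using assms(3)[OF xy(1)] assms(3)[OF xy(2)] by linarith
  then have "2 * \<delta> * \<bar>f x - f y\<bar> \<le> (f x + f y) * \<bar>f x - f y\<bar>" by (intro mult_right_mono) auto
  also have "\<dots> = \<bar>(f x + f y) * (f x - f y)\<bar>"
    using \<open>2 * \<delta> \<le> f x + f y\<close> assms(2) by (simp add: abs_mult)
  also have "(f x + f y) * (f x - f y) = (f x)\<^sup>2 - (f y)\<^sup>2" by algebra
  finally show "dist (f x) (f y) \<le> 1 / (2 * \<delta>) * dist ((f x)\<^sup>2) ((f y)\<^sup>2)"
    using assms(2) by (simp add: dist_real_def field_simps)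
qed (use assms in auto)

text \<open>Pairs within a common piece are covered by its own constant; \<open>cross\<close>
  concerns only pairs on opposite sides of the interface, where the two formulas have to be
  matched.\<close>

lemma lips_Un:
  assumes A: "lips A f" and B: "lips B f"
    and cross: "\<And>x y. x \<in> A \<Longrightarrow> y \<in> B \<Longrightarrow> x \<notin> B \<Longrightarrow> y \<notin> A \<Longrightarrow> dist (f x) (f y) \<le> C * dist x y"
  shows "lips (A \<union> B) f"
proof -
  obtain L where L: "0 \<le> L" "\<And>x y. x \<in> A \<Longrightarrow> y \<in> A \<Longrightarrow> dist (f x) (f y) \<le> L * dist x y"
    using lipsE[OF A] by blast
  obtain M where M: "0 \<le> M" "\<And>x y. x \<in> B \<Longrightarrow> y \<in> B \<Longrightarrow> dist (f x) (f y) \<le> M * dist x y"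
    using lipsE[OF B] by blast
  define K where "K = max L (max M C)"
  have K: "L * dist x y \<le> K * dist x y" "M * dist x y \<le> K * dist x y" "C * dist x y \<le> K * dist x y"
    for x y :: 'a by (auto simp: K_def intro!: mult_right_mono)
  show ?thesis
  proof (rule lipsI[of _ _ K])
    fix x y assume "x \<in> A \<union> B" "y \<in> A \<union> B"
    then consider "x \<in> A" "y \<in> A" | "x \<in> B" "y \<in> B" | "x \<in> A" "y \<in> B" "x \<notin> B" "y \<notin> A"
      | "y \<in> A" "x \<in> B" "y \<notin> B" "x \<notin> A" by blast
    then show "dist (f x) (f y) \<le> K * dist x y"
    proof cases
      case 1 then show ?thesis using L(2)[of x y] K(1)[of x y] by linarith
    next
      case 2 then show ?thesis using M(2)[of x y] K(2)[of x y] by linarith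
    next
      case 3 then show ?thesis using cross[of x y] K(3)[of x y] by linarith
    next
      case 4 then show ?thesis using cross[of y x] K(3)[of y x] by (simp add: dist_commute)
    qed
  qed
qed

text \<open>Two values differ by at most some \<open>e\<close>, and a gap \<open>\<delta>\<close> in
  the domain converts this into the Lipschitz constant \<open>e / \<delta>\<close>.\<close>

lemma lips_Un_separated:
  assumes A: "lips A f" and B: "lips B f" and bd: "bounded A" "bounded B" and "0 < \<delta>"
    and sep: "\<And>x y. x \<in> A \<Longrightarrow> y \<in> B \<Longrightarrow> x \<notin> B \<Longrightarrow> y \<notin> A \<Longrightarrow> \<delta> \<le> dist x y"
  shows "lips (A \<union> B) f"
proof -
  have "bounded (f ` A \<union> f ` B)"
    using lips_bounded[OF A bd(1)] lips_bounded[OF B bd(2)] by simp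
  then obtain e where e: "\<And>u v. u \<in> f ` A \<union> f ` B \<Longrightarrow> v \<in> f ` A \<union> f ` B \<Longrightarrow> dist u v \<le> e"
    unfolding bounded_two_points by blast
  show ?thesis
  proof (rule lips_Un[OF A B, of "e / \<delta>"])
    fix x y assume xy: "x \<in> A" "y \<in> B" "x \<notin> B" "y \<notin> A"
    have le: "dist (f x) (f y) \<le> e" using e xy by blast
    then have "0 \<le> e" using zero_le_dist[of "f x" "f y"] by linarith
    have "e = e / \<delta> * \<delta>" using assms(5) by simp
    also have "\<dots> \<le> e / \<delta> * dist x y"
      using sep[OF xy] \<open>0 \<le> e\<close> assms(5) by (intro mult_left_mono) auto
    finally show "dist (f x) (f y) \<le> e / \<delta> * dist x y" using le by linarith
  qed
qed

text \<open>Being Lipschitz for all large constants is stable under finite conjunction, which gives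
  the eight functions of the theorem a common constant.\<close>

lemma lips_eventually:
  assumes "lips X f"
  shows "eventually (\<lambda>L. L-lipschitz_on X f) at_top"
proof -
  obtain L0 where L0: "L0-lipschitz_on X f"
    using assms unfolding lips_def by blast
  show ?thesis
    using eventually_ge_at_top[of L0] by eventually_elim (rule lipschitz_on_le[OF L0])
qed

section \<open>From profiles to the integral estimate\<close>

definition interval_overlap :: "real \<Rightarrow> real \<Rightarrow> real \<Rightarrow> real \<Rightarrow> real" where
  "interval_overlap A B p q = max 0 (min B q - max A p)"

lemma has_integral_interval_indicator:
  fixes A B p q k :: real
  shows "((\<lambda>x. if x \<in> {p..q} then k else 0) has_integral k * interval_overlap A B p q) {A..B}"
proof -
  have "((\<lambda>x. k) has_integral k * interval_overlap A B p q) {max A p..min B q}"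
    using has_integral_const_real[of k "max A p" "min B q"]
    by (simp add: interval_overlap_def max_def mult.commute)
  moreover have "{max A p..min B q} = {p..q} \<inter> {A..B}" by auto
  ultimately show ?thesis
    by (simp only: has_integral_restrict_Int)
qed

text \<open>The breakpoint is the origin clamped to the window, so one formula covers all positions
  of the window relative to the origin.\<close>

lemma has_integral_two_values:
  fixes l u a b :: real
  assumes "l \<le> u"
  shows "((\<lambda>x. if x < 0 then a else b) has_integral
    a * (max l (min u 0) - l) + b * (u - max l (min u 0))) {l..u}"
proof (rule has_integral_combine[of l "max l (min u 0)" u])
  let ?m = "max l (min u 0)"
  show "((\<lambda>x. if x < 0 then a else b) has_integral a * (?m - l)) {l..?m}"
  proof (rule has_integral_spike_finite[of "{?m}" _ _ "\<lambda>x. a"])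
    show "((\<lambda>x. a) has_integral a * (?m - l)) {l..?m}"
      using has_integral_const_real[of a l ?m] by (simp add: mult.commute)
  qed auto
  show "((\<lambda>x. if x < 0 then a else b) has_integral b * (u - ?m)) {?m..u}"
  proof (rule has_integral_spike_finite[of "{?m}" _ _ "\<lambda>x. b"])
    show "((\<lambda>x. b) has_integral b * (u - ?m)) {?m..u}"
      using has_integral_const_real[of b ?m u] assms by (simp add: mult.commute)
  qed (use assms in auto)
qed (use assms in auto)

text \<open>
  Two self-similar profiles that agree up to \<open>C e\<close> except where waves have moved: on at most two
  intervals, of length at most \<open>C e\<close>.  As these stay away from the fastest speeds \<open>\<plusminus> c\<close>, a window
  that meets one of them has a domain of dependence reaching far to both sides of the origin.
\<close>

definition profile_close ::
  "real \<Rightarrow> real \<Rightarrow> real \<Rightarrow> real \<Rightarrow> (real \<Rightarrow> 'a::real_normed_vector) \<Rightarrow> (real \<Rightarrow> 'a) \<Rightarrow> bool" where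
  "profile_close c b C e f g \<longleftrightarrow> (\<exists>p q p' q'.
     {p, q, p', q'} \<subseteq> {- b..b} \<and> q - p \<le> C * e \<and> q' - p' \<le> C * e \<and>
     (\<forall>\<xi>. - c \<le> \<xi> \<and> \<xi> < c \<longrightarrow> norm (g \<xi> - f \<xi>) \<le>
        C * e + (if \<xi> \<in> {p..q} then C else 0) + (if \<xi> \<in> {p'..q'} then C else 0)))"

lemma profile_close_mono:
  assumes "profile_close c b C e f g" "C \<le> C'" "0 \<le> e"
  shows "profile_close c b C' e f g"
proof -
  obtain p q p' q' where *: "{p, q, p', q'} \<subseteq> {- b..b}" "q - p \<le> C * e" "q' - p' \<le> C * e"
    "\<And>\<xi>. - c \<le> \<xi> \<Longrightarrow> \<xi> < c \<Longrightarrow> norm (g \<xi> - f \<xi>) \<le>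
        C * e + (if \<xi> \<in> {p..q} then C else 0) + (if \<xi> \<in> {p'..q'} then C else 0)"
    using assms(1) unfolding profile_close_def by blast
  have Ce: "C * e \<le> C' * e" using assms by (intro mult_right_mono)
  show ?thesis
    unfolding profile_close_def
  proof (intro exI conjI allI impI)
    show "q - p \<le> C' * e" "q' - p' \<le> C' * e" using * Ce by linarith+
    fix \<xi> assume "- c \<le> \<xi> \<and> \<xi> < c"
    moreover have "(if b then C else 0) \<le> (if b then C' else 0)" for b using assms by auto
    ultimately show "norm (g \<xi> - f \<xi>) \<le>
        C' * e + (if \<xi> \<in> {p..q} then C' else 0) + (if \<xi> \<in> {p'..q'} then C' else 0)"
      by (intro order_trans[OF *(4)] add_mono Ce) auto
  qed (rule *)
qed


text \<open>The three terms of the constant come from the regions outside both fans, from the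
  uniform difference inside them, and from the two windows swept by displaced waves. The last term
  needs the gap \<open>c - b\<close>.\<close>

lemma profile_close_L1:
  fixes f g :: "real \<Rightarrow> 'a::real_normed_vector" and c b C \<alpha> \<beta> t A B :: real
  assumes c: "0 \<le> b" "b < c" and C: "0 \<le> C" and e: "0 \<le> \<alpha>" "0 \<le> \<beta>"
    and close: "profile_close c b C (\<alpha> + \<beta>) f g"
    and outer: "\<And>\<xi>. \<xi> < - c \<Longrightarrow> norm (g \<xi> - f \<xi>) = \<alpha>" "\<And>\<xi>. c \<le> \<xi> \<Longrightarrow> norm (g \<xi> - f \<xi>) = \<beta>"
    and t: "0 < t" and AB: "A < B"
  shows "integral {A..B} (\<lambda>x. norm (g (x / t) - f (x / t)))
    \<le> (1 + C + 2 * C\<^sup>2 / (c - b)) * integral {A - c * t..B + c * t} (\<lambda>x. if x < 0 then \<alpha> else \<beta>)"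
proof -
  let ?D = "\<lambda>x. norm (g (x / t) - f (x / t))"
  obtain p q p' q' where J: "{p, q, p', q'} \<subseteq> {- b..b}" "q - p \<le> C * (\<alpha> + \<beta>)" "q' - p' \<le> C * (\<alpha> + \<beta>)"
    and mid: "\<And>\<xi>. - c \<le> \<xi> \<Longrightarrow> \<xi> < c \<Longrightarrow> norm (g \<xi> - f \<xi>) \<le>
        C * (\<alpha> + \<beta>) + (if \<xi> \<in> {p..q} then C else 0) + (if \<xi> \<in> {p'..q'} then C else 0)"
    using close unfolding profile_close_def by blast
  \<comment> \<open>\<open>m\<close> is the origin clamped to the domain of dependence;
    \<open>N\<close> and \<open>M\<close> are the lengths of that domain on its two sides. The
    initial difference is \<open>\<alpha>\<close> on the first and \<open>\<beta>\<close> on the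
    second, so its integral is \<open>R\<close>.\<close>
  define m where "m = max (A - c * t) (min (B + c * t) 0)"
  define N where "N = m - (A - c * t)"
  define M where "M = B + c * t - m"
  define R where "R = \<alpha> * N + \<beta> * M"
  have ct: "0 < c * t" using c t by simp
  have R: "integral {A - c * t..B + c * t} (\<lambda>x. if x < 0 then \<alpha> else \<beta>) = R"
    unfolding R_def N_def M_def m_def
    by (rule integral_unique[OF has_integral_two_values]) (use AB ct in linarith)
  have NM: "0 \<le> N" "0 \<le> M" using AB ct by (auto simp: N_def M_def m_def)
  have R0: "0 \<le> R" unfolding R_def using NM e by simp
  have K0: "0 \<le> (1 + C + 2 * C\<^sup>2 / (c - b)) * R" using R0 C c by simp
  have far: "(\<alpha> + \<beta>) * z \<le> R" if "z \<le> N" "z \<le> M" for z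
    unfolding R_def distrib_right using that e by (intro add_mono mult_left_mono) auto
  \<comment> \<open>A window that contributes meets \<open>{A..B}\<close>, so
    \<open>A < t * b\<close> and \<open>- (t * b) < B\<close>. The domain of dependence then reaches
    at least \<open>(c - b) * t\<close> to both sides of the origin, and \<open>far\<close> bounds
    \<open>(\<alpha> + \<beta>) * t\<close> by \<open>R / (c - b)\<close>. The window has height
    \<open>C\<close> and length at most \<open>t * (C * (\<alpha> + \<beta>))\<close>.\<close>
  have window: "C * interval_overlap A B (t * x) (t * y) \<le> C\<^sup>2 / (c - b) * R"
    if xy: "{x, y} \<subseteq> {- b..b}" "y - x \<le> C * (\<alpha> + \<beta>)" for x y
  proof (cases "interval_overlap A B (t * x) (t * y) = 0")
    case True
    then show ?thesis using R0 c by simp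
  next
    case False
    have "t * y \<le> t * b" "- (t * b) \<le> t * x"
      using xy t mult_left_mono[of y b t] mult_left_mono[of "- b" x t] by auto
    moreover have "0 < min B (t * y) - max A (t * x)"
      using False by (auto simp: interval_overlap_def)
    then have "A < t * y" "t * x < B" and le: "interval_overlap A B (t * x) (t * y) \<le> t * y - t * x"
      unfolding interval_overlap_def by linarith+
    moreover have "t * b < t * c" "0 \<le> t * b" using c t by auto
    ultimately have "(c - b) * t \<le> N" "(c - b) * t \<le> M"
      using AB ct by (auto simp: N_def M_def m_def algebra_simps)
    then have "(\<alpha> + \<beta>) * ((c - b) * t) \<le> R" by (rule far)
    then have "t * (\<alpha> + \<beta>) \<le> R / (c - b)" using c by (simp add: pos_le_divide_eq mult_ac)
    then have "C * (t * (\<alpha> + \<beta>)) \<le> C * (R / (c - b))" using C by (rule mult_left_mono)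
    moreover have "t * y - t * x \<le> t * (C * (\<alpha> + \<beta>))"
      using mult_left_mono[OF xy(2), of t] t by (simp add: algebra_simps)
    ultimately have "interval_overlap A B (t * x) (t * y) \<le> C * (R / (c - b))"
      using le by (simp add: mult_ac)
    then have "C * interval_overlap A B (t * x) (t * y) \<le> C * (C * (R / (c - b)))" using C by (rule mult_left_mono)
    then show ?thesis by (simp add: power2_eq_square)
  qed
  show ?thesis
  proof (cases "?D integrable_on {A..B}")
    \<comment> \<open>\<open>integral\<close> has the value \<open>0\<close> for a function that is
      not integrable.\<close>
    case False
    then show ?thesis using K0 by (simp add: not_integrable_integral R)
  next
    case True
    \<comment> \<open>A pointwise majorant whose integral is explicit. Where its intervals overlap
      several terms add up, which is harmless because all are nonnegative.\<close>
    define G where "G = (\<lambda>x. (if x \<in> {A..- (c * t)} then \<alpha> else 0) + (if x \<in> {c * t..B} then \<beta> else 0)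
      + (if x \<in> {- (c * t)..c * t} then C * (\<alpha> + \<beta>) else 0)
      + (if x \<in> {t * p..t * q} then C else 0) + (if x \<in> {t * p'..t * q'} then C else 0))"
    have G: "(G has_integral \<alpha> * interval_overlap A B A (- (c * t)) + \<beta> * interval_overlap A B (c * t) B
      + C * (\<alpha> + \<beta>) * interval_overlap A B (- (c * t)) (c * t)
      + C * interval_overlap A B (t * p) (t * q) + C * interval_overlap A B (t * p') (t * q')) {A..B}"
      unfolding G_def by (intro has_integral_add has_integral_interval_indicator)
    have nonneg: "0 \<le> (if P then k else 0)" if "0 \<le> k" for P and k :: real using that by simp
    have C\<alpha>: "0 \<le> C * (\<alpha> + \<beta>)" using C e by simp
    have "?D x \<le> G x" if x: "x \<in> {A..B}" for x
    proof -
      note nn = nonneg[OF e(1), of "x \<in> {A..- (c * t)}"] nonneg[OF e(2), of "x \<in> {c * t..B}"]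
        nonneg[OF C\<alpha>, of "x \<in> {- (c * t)..c * t}"]
        nonneg[OF C, of "x \<in> {t * p..t * q}"] nonneg[OF C, of "x \<in> {t * p'..t * q'}"]
      consider "x < - (c * t)" | "c * t \<le> x" | "- (c * t) \<le> x" "x < c * t" by linarith
      then show ?thesis
      proof cases
        case 1
        then have "?D x = \<alpha>" using t by (intro outer(1)) (simp add: divide_less_eq)
        moreover have "x \<in> {A..- (c * t)}" using 1 x by simp
        ultimately show ?thesis unfolding G_def using nn by simp
      next
        case 2
        then have "?D x = \<beta>" using t by (intro outer(2)) (simp add: le_divide_eq)
        moreover have "x \<in> {c * t..B}" using 2 x by simp
        ultimately show ?thesis unfolding G_def using nn by simp
      next
        case 3
        have iff: "x / t \<in> {y..z} \<longleftrightarrow> x \<in> {t * y..t * z}" for y z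
          using t by (auto simp: le_divide_eq divide_le_eq mult.commute)
        have "?D x \<le> C * (\<alpha> + \<beta>) + (if x / t \<in> {p..q} then C else 0) + (if x / t \<in> {p'..q'} then C else 0)"
          using 3 t by (intro mid) (simp_all add: le_divide_eq divide_less_eq)
        moreover have "x \<in> {- (c * t)..c * t}" using 3 by simp
        ultimately show ?thesis unfolding G_def iff using nn by (simp only: if_True)
      qed
    qed
    then have "integral {A..B} ?D \<le> integral {A..B} G"
      using True G by (intro integral_le) auto
    also have "\<dots> = \<alpha> * interval_overlap A B A (- (c * t)) + \<beta> * interval_overlap A B (c * t) B
      + C * ((\<alpha> + \<beta>) * interval_overlap A B (- (c * t)) (c * t))
      + C * interval_overlap A B (t * p) (t * q) + C * interval_overlap A B (t * p') (t * q')"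
      using integral_unique[OF G] by simp
    also have "\<dots> \<le> \<alpha> * N + \<beta> * M + C * R + C\<^sup>2 / (c - b) * R + C\<^sup>2 / (c - b) * R"
    proof (intro add_mono mult_left_mono far window e C)
      show "interval_overlap A B A (- (c * t)) \<le> N" "interval_overlap A B (c * t) B \<le> M"
        "interval_overlap A B (- (c * t)) (c * t) \<le> N" "interval_overlap A B (- (c * t)) (c * t) \<le> M"
        using AB ct by (auto simp: N_def M_def m_def interval_overlap_def)
    qed (use J in auto)
    also have "\<dots> = (1 + C + 2 * C\<^sup>2 / (c - b)) * R"
      by (simp add: R_def[symmetric] distrib_right)
    finally show ?thesis unfolding R .
  qed
qed

section \<open>The kinetic relation\<close>

lemma b2_factor_eq:
  fixes c k3 V1 V2 :: real assumes "0 \<le> V1" "V1 \<le> V2" "V2 < c" "0 < c" "k3 < c\<^sup>2"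
  shows "(k3 + c * V2) / (c * (c + V2)) - (k3 + c * V1) / (c * (c + V1)) =
    (c\<^sup>2 - k3) * (V2 - V1) / (c * (c + V1) * (c + V2))"
  proof -
    have n: "(k3 + c * V) / (c * (c + V)) = 1 - (c\<^sup>2 - k3) / (c * (c + V))" if "0 \<le> V" for V
    proof -
      have *: "k3 + c * V = c * (c + V) - (c\<^sup>2 - k3)"
        by (simp add: power2_eq_square algebra_simps)
      have "c * (c + V) \<noteq> 0" using that assms by simp
      then show ?thesis unfolding * diff_divide_distrib[of "c * (c + V)"] by simp
    qed
    have "D / (c * a) - D / (c * b) = D * (b - a) / (c * a * b)" if "0 < a" "0 < b" "0 < c" for a b c D :: real
      using that by (simp add: field_simps)
    from this[of "c + V1" "c + V2" "c" "c\<^sup>2 - k3"]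
    have "(c\<^sup>2 - k3) / (c * (c + V1)) - (c\<^sup>2 - k3) / (c * (c + V2)) =
        (c\<^sup>2 - k3) * (V2 - V1) / (c * (c + V1) * (c + V2))"
      using assms by simp
    moreover have "0 \<le> V2" using assms by linarith
    ultimately show ?thesis
      unfolding n[OF assms(1)] n[OF \<open>0 \<le> V2\<close>] by linarith
qed

text \<open>For \<open>c = c\<^sub>1\<close> the fraction is the ratio of \<open>h\<close> to the
  middle strain \<open>b2_w2 h V\<close> of case b2. Written as
  \<open>1 - (c\<^sup>2 - k3) / (c * (c + V))\<close> it visibly increases with \<open>V\<close>,
  and \<open>c + V < 2 * c\<close> bounds the rate from below.\<close>

lemma b2_factor_diff:
  fixes c k3 V1 V2 :: real
  assumes "0 \<le> V1" "V1 \<le> V2" "V2 < c" "0 < c" "k3 < c\<^sup>2"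
  shows "(c\<^sup>2 - k3) / (4 * c ^ 3) * (V2 - V1) \<le>
    (k3 + c * V2) / (c * (c + V2)) - (k3 + c * V1) / (c * (c + V1))"
proof -
  have "(c\<^sup>2 - k3) * (V2 - V1) / (4 * c ^ 3)
    \<le> (c\<^sup>2 - k3) * (V2 - V1) / (c * (c + V1) * (c + V2))"
  proof (rule divide_left_mono)
    have "c * (c + V1) * (c + V2) \<le> c * (2 * c) * (2 * c)"
      using assms by (intro mult_mono) auto
    then show "c * (c + V1) * (c + V2) \<le> 4 * c ^ 3"
      by (simp add: power3_eq_cube)
  qed (use assms in auto)
  then show ?thesis unfolding b2_factor_eq[OF assms] by simp
qed

text \<open>In the applications \<open>b - a\<close> is, up to sign, the constant
  \<open>k1 P - k3 P\<close>. The speed then occurs only in the denominator, which makes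
  monotonicity in the speed visible.\<close>

lemma square_ratio:
  fixes s y a b :: real
  assumes "s * a = y * b" "0 < a"
  shows "s = y * (1 + (b - a) / a)"
  using assms by (simp add: field_simps)

text \<open>\<open>B\<close> and \<open>A\<close> are the moduli of the left and the right phase.
  Inserting the first relation into the second eliminates the velocities and leaves a relation
  between the strains alone.\<close>

lemma jump_conditions_iff:
  fixes s va vb wa wb A B :: real
  shows "s * (wb - wa) + (vb - va) = 0 \<and> s * (vb - va) + (A * wb - B * wa) = 0
    \<longleftrightarrow> vb = va - s * (wb - wa) \<and> wb * (A - s\<^sup>2) = wa * (B - s\<^sup>2)"
proof -
  have e: "s * (vb - va) + (A * wb - B * wa) = wb * (A - s\<^sup>2) - wa * (B - s\<^sup>2)"
    if "vb - va = - s * (wb - wa)"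
    unfolding that by (simp add: power2_eq_square algebra_simps)
  show ?thesis
  proof (cases "vb - va = - s * (wb - wa)")
    case True
    then have "s * (wb - wa) + (vb - va) = 0" "vb = va - s * (wb - wa)" by simp_all
    then show ?thesis unfolding e[OF True] by auto
  next
    case False
    then have "s * (wb - wa) + (vb - va) \<noteq> 0" "vb \<noteq> va - s * (wb - wa)" by auto
    then show ?thesis by blast
  qed
qed

text \<open>Initially two solutions differ by the first norm on the left half-line and by the second
  on the right one. This sum is therefore the \<open>\<alpha> + \<beta>\<close> of
  \<open>profile_close_L1\<close>.\<close>

definition data_dist :: "riemann_data \<Rightarrow> riemann_data \<Rightarrow> real" where
  "data_dist d1 d2 = norm (fst d2 - fst d1) + norm (snd d2 - snd d1)"

lemma data_dist_nonneg: "0 \<le> data_dist d1 d2"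
  by (simp add: data_dist_def)

lemma dist_le_data_dist: "dist d1 d2 \<le> data_dist d1 d2"
  using dist_Pair_le_add[of "fst d1" "snd d1" "fst d2" "snd d2"]
  by (simp add: data_dist_def dist_norm norm_minus_commute)

lemma lips_data_dist:
  fixes f :: "riemann_data \<Rightarrow> 'b::real_normed_vector"
  assumes "lips X f"
  obtains L where "0 \<le> L" "\<And>x y. x \<in> X \<Longrightarrow> y \<in> X \<Longrightarrow> norm (f y - f x) \<le> L * data_dist x y"
proof -
  obtain L where L: "0 \<le> L" "\<And>x y. x \<in> X \<Longrightarrow> y \<in> X \<Longrightarrow> dist (f x) (f y) \<le> L * dist x y"
    using lipsE[OF assms] by blast
  show ?thesis
  proof
    fix x y assume "x \<in> X" "y \<in> X"
    then have "norm (f y - f x) \<le> L * dist x y"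
      using L(2)[of x y] by (simp add: dist_norm norm_minus_commute)
    also have "\<dots> \<le> L * data_dist x y" using L(1) by (intro mult_left_mono dist_le_data_dist)
    finally show "norm (f y - f x) \<le> L * data_dist x y" .
  qed (rule L)
qed

section \<open>Standing assumptions and consequences of the bounds on \<open>phi\<close>\<close>

locale phase_material =
  fixes P :: material
  assumes k3_pos: "0 < k3 P" and k3_less_k1: "k3 P < k1 P"
    and wM_pos: "0 < wM P" and wM_less_wm: "wM P < wm P"
    and kinetic: "kinetic_function P"
begin

abbreviation c\<^sub>1 :: real where "c\<^sub>1 \<equiv> c1 P"
abbreviation c\<^sub>3 :: real where "c\<^sub>3 \<equiv> c3 P"

lemma c3_pos: "0 < c\<^sub>3" and c3_less_c1: "c\<^sub>3 < c\<^sub>1" and c1_pos: "0 < c\<^sub>1"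
  using k3_pos k3_less_k1 by (auto simp: c1_def c3_def)

lemma wm_pos: "0 < wm P"
  using wM_pos wM_less_wm by linarith

lemma k1_eq: "k1 P = c\<^sub>1\<^sup>2" and k3_eq: "k3 P = c\<^sub>3\<^sup>2"
  using k3_pos k3_less_k1 by (auto simp: c1_def c3_def)

lemma k3_minus_pos: "0 < k3 P - V\<^sup>2" if "\<bar>V\<bar> < c\<^sub>3"
  using that c3_pos abs_le_square_iff[of c\<^sub>3 V] by (auto simp: k3_eq not_le)

lemma k1_minus_pos: "0 < k1 P - V\<^sup>2" if "\<bar>V\<bar> \<le> c\<^sub>3"
  using that c3_pos c3_less_c1 abs_le_square_iff[of c\<^sub>1 V] by (auto simp: k1_eq not_le)

lemma phi_mono: "phi P x \<le> phi P y" if "- c\<^sub>3 < x" "x \<le> y" "y \<le> c\<^sub>3"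
  using kinetic that unfolding kinetic_function_def mono_on_def by auto

lemma psi_low_le_phi: "psi_low P V \<le> phi P V" and phi_nonpos: "phi P V \<le> 0"
  if "- c\<^sub>3 < V" "V \<le> 0"
  using kinetic that unfolding kinetic_function_def by auto

lemma phi_le_psi_up: "phi P V \<le> psi_up P V" and phi_nonneg: "0 \<le> phi P V"
  if "0 \<le> V" "V \<le> c\<^sub>3"
  using kinetic that unfolding kinetic_function_def by auto

lemma phi_tendsto_0_minus: "(phi P \<longlongrightarrow> phi_0_minus P) (at_left 0)"
proof -
  obtain l where "(phi P \<longlongrightarrow> l) (at_left 0)"
    using kinetic unfolding kinetic_function_def by auto
  then show ?thesis
    unfolding phi_0_minus_def using tendsto_Lim trivial_limit_at_left_real by metis
qed

lemma phi_tendsto_0_plus: "(phi P \<longlongrightarrow> phi_0_plus P) (at_right 0)"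
proof -
  obtain l where "(phi P \<longlongrightarrow> l) (at_right 0)"
    using kinetic unfolding kinetic_function_def by auto
  then show ?thesis
    unfolding phi_0_plus_def using tendsto_Lim trivial_limit_at_right_real by metis
qed

lemma eventually_at_left_0: "eventually (\<lambda>x. x \<in> {y<..<0}) (at_left 0)" if "y < (0::real)"
  using that eventually_at_left_real by blast

lemma eventually_at_right_0: "eventually (\<lambda>x. x \<in> {0<..<y}) (at_right 0)" if "0 < (y::real)"
  using that eventually_at_right_real by blast

lemma phi_le_phi_0_minus: "phi P V \<le> phi_0_minus P" if "- c\<^sub>3 < V" "V < 0"
  by (rule tendsto_lowerbound[OF phi_tendsto_0_minus _ trivial_limit_at_left_real],
      rule eventually_mono[OF eventually_at_left_0[OF that(2)]])
     (use that c3_pos in \<open>auto intro!: phi_mono\<close>)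

lemma phi_0_plus_le_phi: "phi_0_plus P \<le> phi P V" if "0 < V" "V \<le> c\<^sub>3"
  by (rule tendsto_upperbound[OF phi_tendsto_0_plus _ trivial_limit_at_right_real],
      rule eventually_mono[OF eventually_at_right_0[OF that(1)]])
     (use that c3_pos in \<open>auto intro!: phi_mono\<close>)

lemma psi_low_le_phi_0_minus: "psi_low P 0 \<le> phi_0_minus P"
proof (rule tendsto_le[OF trivial_limit_at_left_real phi_tendsto_0_minus])
  have "isCont (psi_low P) 0"
    unfolding psi_low_def using k3_pos by (intro continuous_intros) auto
  then show "(psi_low P \<longlongrightarrow> psi_low P 0) (at_left 0)"
    unfolding isCont_def by (rule tendsto_within_subset[of _ _ _ UNIV]) auto
  show "\<forall>\<^sub>F x in at_left 0. psi_low P x \<le> phi P x"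
    by (rule eventually_mono[OF eventually_at_left_0[of "- c\<^sub>3"]])
       (use c3_pos in \<open>auto intro!: psi_low_le_phi\<close>)
qed

lemma phi_0_plus_le_psi_up: "phi_0_plus P \<le> psi_up P 0"
proof (rule tendsto_le[OF trivial_limit_at_right_real _ phi_tendsto_0_plus])
  have "isCont (psi_up P) 0"
    unfolding psi_up_def using k3_pos k3_less_k1 by (intro continuous_intros) auto
  then show "(psi_up P \<longlongrightarrow> psi_up P 0) (at_right 0)"
    unfolding isCont_def by (rule tendsto_within_subset[of _ _ _ UNIV]) auto
  show "\<forall>\<^sub>F x in at_right 0. phi P x \<le> psi_up P x"
    by (rule eventually_mono[OF eventually_at_right_0[of "c\<^sub>3"]])
       (use c3_pos in \<open>auto intro!: phi_le_psi_up\<close>)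
qed

lemma phi_derivatives:
  obtains f1 f2 where
    "\<And>V. V \<in> {- c\<^sub>3<..<0} \<union> {0<..c\<^sub>3} \<Longrightarrow>
       (phi P has_real_derivative f1 V) (at V within {- c\<^sub>3<..<0} \<union> {0<..c\<^sub>3})"
    "\<And>V. V \<in> {- c\<^sub>3<..<0} \<union> {0<..c\<^sub>3} \<Longrightarrow>
       (f1 has_real_derivative f2 V) (at V within {- c\<^sub>3<..<0} \<union> {0<..c\<^sub>3})"
    "continuous_on ({- c\<^sub>3<..<0} \<union> {0<..c\<^sub>3}) f2"
  using kinetic unfolding kinetic_function_def Let_def by blast

lemma continuous_on_phi: "continuous_on ({- c\<^sub>3<..<0} \<union> {0<..c\<^sub>3}) (phi P)"
  by (rule phi_derivatives) (metis DERIV_continuous_on)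

text \<open>The limit condition fixes only \<open>phi\<close> to the left of
  \<open>c\<^sub>3\<close>. The value agrees with it because \<open>phi\<close> is differentiable,
  hence continuous, at the endpoint within its domain. It follows that the strain product vanishes
  at \<open>c\<^sub>3\<close>.\<close>

lemma phi_c3: "phi P c\<^sub>3 = psi_up P c\<^sub>3"
proof -
  have "(phi P \<longlongrightarrow> phi P c\<^sub>3) (at c\<^sub>3 within {- c\<^sub>3<..<0} \<union> {0<..c\<^sub>3})"
    using continuous_on_phi c3_pos by (auto simp: continuous_on_def)
  then have "(phi P \<longlongrightarrow> phi P c\<^sub>3) (at c\<^sub>3 within {c\<^sub>3 / 2..c\<^sub>3})"
    by (rule tendsto_within_subset) (use c3_pos in auto)
  then have "(phi P \<longlongrightarrow> phi P c\<^sub>3) (at_left c\<^sub>3)"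
    using at_within_Icc_at_left[of "c\<^sub>3 / 2" c\<^sub>3] c3_pos by simp
  moreover have "(phi P \<longlongrightarrow> psi_up P c\<^sub>3) (at_left c\<^sub>3)"
    using kinetic unfolding kinetic_function_def by auto
  ultimately show ?thesis
    using tendsto_unique trivial_limit_at_left_real by blast
qed

lemma psi_up_c3: "psi_up P c\<^sub>3 = (k1 P - k3 P) / 2 * (wM P * wm P)"
  by (simp add: psi_up_def k3_eq)

text \<open>
  The kinetic relation, solved for the product \<open>y\<close> of the two strains at the phase boundary:
  \<open>y = strain_product V\<close> for \<open>V \<noteq> 0\<close>, and the relation \<open>adm V y\<close> in general.
\<close>

definition strain_product :: "real \<Rightarrow> real" where
  "strain_product V = wM P * wm P - 2 * phi P V / (k1 P - k3 P)"

definition dissipation :: "real \<Rightarrow> real" where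
  "dissipation y = (k1 P - k3 P) / 2 * (wM P * wm P - y)"

definition adm :: "real \<Rightarrow> real \<Rightarrow> bool" where
  "adm V y \<longleftrightarrow> eq_phi P (dissipation y) V"

lemma dissipation_eq_iff: "dissipation y = z \<longleftrightarrow> y = wM P * wm P - 2 * z / (k1 P - k3 P)"
  using k3_less_k1 by (auto simp: dissipation_def field_simps)

lemma dissipation_le_iff: "dissipation y \<le> z \<longleftrightarrow> wM P * wm P - 2 * z / (k1 P - k3 P) \<le> y"
  using k3_less_k1 by (auto simp: dissipation_def field_simps)

lemma le_dissipation_iff: "z \<le> dissipation y \<longleftrightarrow> y \<le> wM P * wm P - 2 * z / (k1 P - k3 P)"
  using k3_less_k1 by (auto simp: dissipation_def field_simps)

lemma dissipation_antimono: "dissipation y \<le> dissipation y' \<longleftrightarrow> y' \<le> y"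
  using k3_less_k1 by (auto simp: dissipation_def mult_le_cancel_left)

lemma adm_nonzero: "adm V y \<longleftrightarrow> y = strain_product V" if "V \<noteq> 0"
  using that by (simp add: adm_def eq_phi_def strain_product_def dissipation_eq_iff)

lemma adm_zero: "adm 0 y \<longleftrightarrow> phi_0_minus P \<le> dissipation y \<and> dissipation y \<le> phi_0_plus P"
  by (simp add: adm_def eq_phi_def)

lemma psi_low_le_dissipation:
  assumes "\<bar>V\<bar> < c\<^sub>3"
  shows "psi_low P V \<le> dissipation y \<longleftrightarrow> y * (k3 P - V\<^sup>2) \<le> (wM P)\<^sup>2 * (k1 P - V\<^sup>2)"
proof -
  have "C * a * (b - A * a) = C * (a * b - a\<^sup>2 * A)" for C a b A :: real
    by algebra
  then have "psi_low P V = dissipation ((wM P)\<^sup>2 * ((k1 P - V\<^sup>2) / (k3 P - V\<^sup>2)))"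
    unfolding psi_low_def dissipation_def by blast
  then show ?thesis
    using k3_minus_pos[OF assms] by (simp add: dissipation_antimono pos_le_divide_eq)
qed

lemma dissipation_le_psi_up:
  assumes "\<bar>V\<bar> < c\<^sub>3"
  shows "dissipation y \<le> psi_up P V \<longleftrightarrow> (wm P)\<^sup>2 * (k3 P - V\<^sup>2) \<le> y * (k1 P - V\<^sup>2)"
proof -
  have "C * a * (b - A * a) = C * (b * a - a\<^sup>2 * A)" for C a b A :: real
    by algebra
  then have "psi_up P V = dissipation ((wm P)\<^sup>2 * ((k3 P - V\<^sup>2) / (k1 P - V\<^sup>2)))"
    unfolding psi_up_def dissipation_def by blast
  then show ?thesis
    using k1_minus_pos[of V] assms by (simp add: dissipation_antimono pos_divide_le_eq)
qed

lemma adm_neg_lower: "wM P * wm P \<le> y" if "- c\<^sub>3 < V" "V < 0" "adm V y"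
  using that phi_nonpos[of V] dissipation_le_iff[of y 0] by (simp add: adm_def eq_phi_def)

lemma adm_pos_upper: "y \<le> wM P * wm P" if "0 < V" "V \<le> c\<^sub>3" "adm V y"
  using that phi_nonneg[of V] le_dissipation_iff[of 0 y] by (simp add: adm_def eq_phi_def)

text \<open>The bound by \<open>psi_low\<close> is given for \<open>V \<le> 0\<close> and the bound
  by \<open>psi_up\<close> for \<open>V \<ge> 0\<close>, but both are needed for every speed. For
  \<open>V \<noteq> 0\<close> the sign of \<open>phi\<close> compares \<open>y\<close> with
  \<open>wM P * wm P\<close>; combined with the given bound this yields
  \<open>wm P * (k3 P - V\<^sup>2) \<le> wM P * (k1 P - V\<^sup>2)\<close>, and from it the other
  bound.\<close>

lemma adm_bounds:
  assumes "\<bar>V\<bar> < c\<^sub>3" "adm V y"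
  shows "y * (k3 P - V\<^sup>2) \<le> (wM P)\<^sup>2 * (k1 P - V\<^sup>2)"
    and "(wm P)\<^sup>2 * (k3 P - V\<^sup>2) \<le> y * (k1 P - V\<^sup>2)"
proof -
  have *: "0 < k3 P - V\<^sup>2" "0 < k1 P - V\<^sup>2"
    using k3_minus_pos k1_minus_pos assms by auto
  consider "V < 0" | "V = 0" | "0 < V" by linarith
  then have "y * (k3 P - V\<^sup>2) \<le> (wM P)\<^sup>2 * (k1 P - V\<^sup>2) \<and>
             (wm P)\<^sup>2 * (k3 P - V\<^sup>2) \<le> y * (k1 P - V\<^sup>2)"
  proof cases
    case 1
    then have up: "y * (k3 P - V\<^sup>2) \<le> (wM P)\<^sup>2 * (k1 P - V\<^sup>2)"
      using assms psi_low_le_phi[of V] psi_low_le_dissipation[of V y] by (simp add: adm_def eq_phi_def)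
    have low: "wM P * wm P \<le> y"
      using adm_neg_lower[of V y] 1 assms by auto
    have "wM P * wm P * (k3 P - V\<^sup>2) \<le> wM P * (wM P * (k1 P - V\<^sup>2))"
      by (rule order_trans[OF mult_right_mono[OF low less_imp_le[OF *(1)]]])
         (use up in \<open>simp add: power2_eq_square mult.assoc\<close>)
    then have "wm P * (k3 P - V\<^sup>2) \<le> wM P * (k1 P - V\<^sup>2)"
      using wM_pos by (simp add: mult.assoc)
    then have "wm P * (wm P * (k3 P - V\<^sup>2)) \<le> wm P * (wM P * (k1 P - V\<^sup>2))"
      using wm_pos by simp
    also have "\<dots> \<le> y * (k1 P - V\<^sup>2)"
      using mult_right_mono[OF low less_imp_le[OF *(2)]] by (simp only: mult_ac)
    finally show ?thesis
      using up by (simp add: power2_eq_square mult_ac)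
  next
    case 2
    then show ?thesis
      using assms psi_low_le_dissipation[of V y] dissipation_le_psi_up[of V y]
        psi_low_le_phi_0_minus phi_0_plus_le_psi_up by (auto simp: adm_zero)
  next
    case 3
    then have low: "(wm P)\<^sup>2 * (k3 P - V\<^sup>2) \<le> y * (k1 P - V\<^sup>2)"
      using assms phi_le_psi_up[of V] dissipation_le_psi_up[of V y] by (simp add: adm_def eq_phi_def)
    have up: "y \<le> wM P * wm P"
      using adm_pos_upper[of V y] 3 assms by auto
    have "wm P * (wm P * (k3 P - V\<^sup>2)) \<le> wm P * (wM P * (k1 P - V\<^sup>2))"
      by (rule order_trans[OF _ order_trans[OF low
            order_trans[OF mult_right_mono[OF up less_imp_le[OF *(2)]]]]])
         (simp_all add: power2_eq_square mult_ac)
    then have "wm P * (k3 P - V\<^sup>2) \<le> wM P * (k1 P - V\<^sup>2)"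
      using wm_pos by simp
    then have "wM P * (wm P * (k3 P - V\<^sup>2)) \<le> wM P * (wM P * (k1 P - V\<^sup>2))"
      using wM_pos by simp
    moreover have "y * (k3 P - V\<^sup>2) \<le> wM P * (wm P * (k3 P - V\<^sup>2))"
      using mult_right_mono[OF up less_imp_le[OF *(1)]] by (simp only: mult_ac)
    ultimately show ?thesis
      using low by (simp add: power2_eq_square mult_ac)
  qed
  then show "y * (k3 P - V\<^sup>2) \<le> (wM P)\<^sup>2 * (k1 P - V\<^sup>2)"
    and "(wm P)\<^sup>2 * (k3 P - V\<^sup>2) \<le> y * (k1 P - V\<^sup>2)" by auto
qed

lemma adm_pos: "0 < y" if "\<bar>V\<bar> < c\<^sub>3" "adm V y"
proof -
  have "0 < (wm P)\<^sup>2 * (k3 P - V\<^sup>2)"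
    using k3_minus_pos[OF that(1)] wm_pos by simp
  then have "0 < y * (k1 P - V\<^sup>2)" using adm_bounds(2)[OF that] by linarith
  then show ?thesis
    using k1_minus_pos[of V] that(1) by (simp add: zero_less_mult_iff)
qed

text \<open>At \<open>V = 0\<close> the relation admits a whole interval of products. The strict
  inequality between the speeds ensures that at most one of them lies on this vertical part of the
  graph.\<close>

lemma adm_antimono: "y' \<le> y" if "- c\<^sub>3 < V" "V < V'" "V' \<le> c\<^sub>3" "adm V y" "adm V' y'"
proof -
  have "dissipation y \<le> dissipation y'"
    using that phi_mono[of V V'] phi_le_phi_0_minus[of V] phi_0_plus_le_phi[of V']
    unfolding adm_def eq_phi_def by (auto split: if_splits)
  then show ?thesis
    by (simp add: dissipation_antimono)
qed

section \<open>The speed of the phase boundary\<close>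

text \<open>The equation is \<open>w_minus h V * w_plus h V = y\<close> with denominators cleared.
  The product \<open>y\<close> is quantified because the kinetic relation does not determine it at
  \<open>V = 0\<close>.\<close>

definition a1_speed :: "real \<Rightarrow> real \<Rightarrow> bool" where
  "a1_speed h V \<longleftrightarrow> \<bar>V\<bar> < c\<^sub>3 \<and> (\<exists>y. adm V y \<and>
     h\<^sup>2 * ((c\<^sub>3 + V) * (c\<^sub>1 - V)) = y * ((c\<^sub>3 - V) * (c\<^sub>1 + V)))"

text \<open>The fan is sought in the symmetric form \<open>V' = - V\<close>, whose two outer strains
  agree. The jump relations give the middle strain \<open>w = b2_w2 h V\<close>; inserting it into
  \<open>w\<^sup>2 * (k3 P - V\<^sup>2) = y * (k1 P - V\<^sup>2)\<close> and cancelling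
  \<open>c\<^sub>1 + V\<close> produces the equation.\<close>

definition b2_speed :: "real \<Rightarrow> real \<Rightarrow> bool" where
  "b2_speed h V \<longleftrightarrow> 0 < V \<and> V < c\<^sub>3 \<and> (\<exists>y. adm (- V) y \<and>
     h\<^sup>2 * (k1 P * (c\<^sub>1 + V) * (k3 P - V\<^sup>2)) = y * ((c\<^sub>1 - V) * (k3 P + c\<^sub>1 * V)\<^sup>2))"

section \<open>Existence of the speeds\<close>

lemma continuous_on_strain_product:
  "continuous_on ({- c\<^sub>3<..<0} \<union> {0<..c\<^sub>3}) strain_product"
  unfolding strain_product_def using continuous_on_phi k3_less_k1 by (intro continuous_intros) auto

lemma strain_product_c3: "strain_product c\<^sub>3 = 0"
  using k3_less_k1 by (simp add: strain_product_def phi_c3 psi_up_c3)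

lemma strain_product_tendsto_0_minus:
  "(strain_product \<longlongrightarrow> wM P * wm P - 2 * phi_0_minus P / (k1 P - k3 P)) (at_left 0)"
  unfolding strain_product_def using phi_tendsto_0_minus k3_less_k1 by (intro tendsto_intros) auto

lemma strain_product_tendsto_0_plus:
  "(strain_product \<longlongrightarrow> wM P * wm P - 2 * phi_0_plus P / (k1 P - k3 P)) (at_right 0)"
  unfolding strain_product_def using phi_tendsto_0_plus k3_less_k1 by (intro tendsto_intros) auto

text \<open>\<open>F\<close> may jump at \<open>0\<close>, so the intermediate value theorem is
  applied on one side only. At \<open>V = 0\<close> the coefficients of \<open>h\<^sup>2\<close> and
  of the strain product coincide; comparing \<open>h\<^sup>2\<close> with the one-sided limits
  \<open>ym\<close> and \<open>yp\<close> thus gives the sign of \<open>F\<close> beside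
  \<open>0\<close>. Values of \<open>h\<^sup>2\<close> between the two limits are attained at
  \<open>V = 0\<close> itself, inside the jump.\<close>

lemma a1_speed_exists:
  assumes "0 < h"
  shows "\<exists>V. a1_speed h V"
proof -
  define F where "F = (\<lambda>V. h\<^sup>2 * ((c\<^sub>3 + V) * (c\<^sub>1 - V)) - strain_product V * ((c\<^sub>3 - V) * (c\<^sub>1 + V)))"
  define yp where "yp = wM P * wm P - 2 * phi_0_plus P / (k1 P - k3 P)"
  define ym where "ym = wM P * wm P - 2 * phi_0_minus P / (k1 P - k3 P)"
  have cont: "continuous_on T F" if "T \<subseteq> {- c\<^sub>3<..<0} \<union> {0<..c\<^sub>3}" for T
    unfolding F_def using continuous_on_subset[OF continuous_on_strain_product that]
    by (intro continuous_intros)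
  have root: "\<exists>V. a1_speed h V" if "F V = 0" "\<bar>V\<bar> < c\<^sub>3" "V \<noteq> 0" for V
    using that unfolding a1_speed_def F_def by (auto simp: adm_nonzero)
  note cs = c3_pos c3_less_c1 c1_pos
  consider "ym < h\<^sup>2" | "yp \<le> h\<^sup>2" "h\<^sup>2 \<le> ym" | "h\<^sup>2 < yp"
    by linarith
  then show ?thesis
  proof cases
    case 1
    have "(F \<longlongrightarrow> h\<^sup>2 * ((c\<^sub>3 + 0) * (c\<^sub>1 - 0)) - ym * ((c\<^sub>3 - 0) * (c\<^sub>1 + 0))) (at_left 0)"
      unfolding F_def ym_def by (intro tendsto_intros strain_product_tendsto_0_minus)
    moreover have "0 < h\<^sup>2 * ((c\<^sub>3 + 0) * (c\<^sub>1 - 0)) - ym * ((c\<^sub>3 - 0) * (c\<^sub>1 + 0))"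
      using 1 cs by simp
    ultimately have "eventually (\<lambda>V. 0 < F V) (at_left 0)"
      by (simp add: order_tendstoD)
    then obtain b where b: "b < 0" "\<And>V. b < V \<Longrightarrow> V < 0 \<Longrightarrow> 0 < F V"
      unfolding eventually_at_left_field by blast
    define V2 where "V2 = max (b / 2) (- c\<^sub>3 / 2)"
    have V2: "- c\<^sub>3 < V2" "V2 < 0" "0 < F V2"
      using b cs by (auto simp: V2_def)
    \<comment> \<open>\<open>strain_product\<close> is unbounded near \<open>- c\<^sub>3\<close>.
      Replacing it by its lower bound \<open>wM P * wm P\<close> gives a majorant of
      \<open>F\<close> that is continuous up to \<open>- c\<^sub>3\<close> and negative
      there.\<close>
    define G where "G = (\<lambda>V. h\<^sup>2 * ((c\<^sub>3 + V) * (c\<^sub>1 - V)) - wM P * wm P * ((c\<^sub>3 - V) * (c\<^sub>1 + V)))"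
    have "(G \<longlongrightarrow> G (- c\<^sub>3)) (at_right (- c\<^sub>3))"
      unfolding G_def by (intro tendsto_intros)
    moreover have "G (- c\<^sub>3) < 0"
      using cs wM_pos wm_pos by (simp add: G_def)
    ultimately have "eventually (\<lambda>V. G V < 0) (at_right (- c\<^sub>3))"
      by (simp add: order_tendstoD)
    then obtain b' where b': "- c\<^sub>3 < b'" "\<And>V. - c\<^sub>3 < V \<Longrightarrow> V < b' \<Longrightarrow> G V < 0"
      unfolding eventually_at_right_field by blast
    define V1 where "V1 = min ((b' - c\<^sub>3) / 2) V2"
    have V1: "- c\<^sub>3 < V1" "V1 \<le> V2" "V1 < 0"
      using b' V2 by (auto simp: V1_def min_def)
    have "V1 < b'" using b' by (auto simp: V1_def min_def)
    then have "G V1 < 0" using b' V1 by auto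
    moreover have "wM P * wm P * ((c\<^sub>3 - V1) * (c\<^sub>1 + V1)) \<le> strain_product V1 * ((c\<^sub>3 - V1) * (c\<^sub>1 + V1))"
      using adm_neg_lower[of V1 "strain_product V1"] V1 cs by (intro mult_right_mono) (auto simp: adm_nonzero)
    ultimately have "F V1 \<le> 0" by (simp add: F_def G_def)
    then obtain V where "V1 \<le> V" "V \<le> V2" "F V = 0"
      using IVT'[of F V1 0 V2] V1 V2 cont[of "{V1..V2}"] by (force simp: subset_iff)
    then show ?thesis using root V1 V2 by auto
  next
    case 2
    then have "adm 0 (h\<^sup>2)"
      using dissipation_le_iff[of "h\<^sup>2"] le_dissipation_iff[of _ "h\<^sup>2"] by (auto simp: adm_zero yp_def ym_def)
    then have "a1_speed h 0"
      using cs by (auto simp: a1_speed_def)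
    then show ?thesis ..
  next
    case 3
    have "(F \<longlongrightarrow> h\<^sup>2 * ((c\<^sub>3 + 0) * (c\<^sub>1 - 0)) - yp * ((c\<^sub>3 - 0) * (c\<^sub>1 + 0))) (at_right 0)"
      unfolding F_def yp_def by (intro tendsto_intros strain_product_tendsto_0_plus)
    moreover have "h\<^sup>2 * ((c\<^sub>3 + 0) * (c\<^sub>1 - 0)) - yp * ((c\<^sub>3 - 0) * (c\<^sub>1 + 0)) < 0"
      using 3 cs by simp
    ultimately have "eventually (\<lambda>V. F V < 0) (at_right 0)"
      by (simp add: order_tendstoD)
    then obtain b where b: "0 < b" "\<And>V. 0 < V \<Longrightarrow> V < b \<Longrightarrow> F V < 0"
      unfolding eventually_at_right_field by blast
    define V1 where "V1 = min (b / 2) (c\<^sub>3 / 2)"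
    have V1: "0 < V1" "V1 < c\<^sub>3" "F V1 < 0"
      using b cs by (auto simp: V1_def)
    have F3: "0 < F c\<^sub>3"
      using cs assms by (simp add: F_def strain_product_c3)
    then obtain V where V: "V1 \<le> V" "V \<le> c\<^sub>3" "F V = 0"
      using IVT'[of F V1 0 "c\<^sub>3"] V1 cont[of "{V1..c\<^sub>3}"] by (force simp: subset_iff)
    then have "V \<noteq> c\<^sub>3" using F3 by auto
    then show ?thesis using root V V1 by auto
  qed
qed

text \<open>The unknown of \<open>F\<close> is the negated speed, which ranges below
  \<open>0\<close>. Its sign beside \<open>0\<close> comes from the threshold:
  \<open>psi_low P 0 \<le> phi_0_minus P\<close> reads
  \<open>ym * k3 P \<le> (wM P)\<^sup>2 * k1 P\<close>, and \<open>h\<close> exceeds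
  \<open>wM P\<close>. Near \<open>- c\<^sub>3\<close> a majorant \<open>G\<close> is used as in
  \<open>a1_speed_exists\<close>.\<close>

lemma b2_speed_exists:
  assumes "wM P < h"
  shows "\<exists>V. b2_speed h V"
proof -
  define F where "F = (\<lambda>V. h\<^sup>2 * (k1 P * (c\<^sub>1 - V) * (k3 P - V\<^sup>2)) - strain_product V * ((c\<^sub>1 + V) * (k3 P - c\<^sub>1 * V)\<^sup>2))"
  define ym where "ym = wM P * wm P - 2 * phi_0_minus P / (k1 P - k3 P)"
  have cont: "continuous_on T F" if "T \<subseteq> {- c\<^sub>3<..<0} \<union> {0<..c\<^sub>3}" for T
    unfolding F_def using continuous_on_subset[OF continuous_on_strain_product that]
    by (intro continuous_intros)
  note cs = c3_pos c3_less_c1 c1_pos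
  have "dissipation ym = phi_0_minus P"
    by (simp add: dissipation_eq_iff ym_def)
  then have "ym * k3 P \<le> (wM P)\<^sup>2 * k1 P"
    using psi_low_le_phi_0_minus psi_low_le_dissipation[of 0 ym] cs by simp
  also have "\<dots> < h\<^sup>2 * k1 P"
    using assms wM_pos k3_pos k3_less_k1 by (simp add: power_strict_mono)
  finally have *: "ym * k3 P < h\<^sup>2 * k1 P" .
  have "(F \<longlongrightarrow> h\<^sup>2 * (k1 P * (c\<^sub>1 - 0) * (k3 P - 0\<^sup>2)) - ym * ((c\<^sub>1 + 0) * (k3 P - c\<^sub>1 * 0)\<^sup>2)) (at_left 0)"
    unfolding F_def ym_def by (intro tendsto_intros strain_product_tendsto_0_minus)
  moreover have "0 < h\<^sup>2 * (k1 P * (c\<^sub>1 - 0) * (k3 P - 0\<^sup>2)) - ym * ((c\<^sub>1 + 0) * (k3 P - c\<^sub>1 * 0)\<^sup>2)"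
    using mult_strict_right_mono[OF *, of "c\<^sub>1 * k3 P"] cs k3_pos by (simp add: power2_eq_square algebra_simps)
  ultimately have "eventually (\<lambda>V. 0 < F V) (at_left 0)"
    by (simp add: order_tendstoD)
  then obtain b where b: "b < 0" "\<And>V. b < V \<Longrightarrow> V < 0 \<Longrightarrow> 0 < F V"
    unfolding eventually_at_left_field by blast
  define V2 where "V2 = max (b / 2) (- c\<^sub>3 / 2)"
  have V2: "- c\<^sub>3 < V2" "V2 < 0" "0 < F V2"
    using b cs by (auto simp: V2_def)
  define G where "G = (\<lambda>V. h\<^sup>2 * (k1 P * (c\<^sub>1 - V) * (k3 P - V\<^sup>2)) - wM P * wm P * ((c\<^sub>1 + V) * (k3 P - c\<^sub>1 * V)\<^sup>2))"
  have "(G \<longlongrightarrow> G (- c\<^sub>3)) (at_right (- c\<^sub>3))"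
    unfolding G_def by (intro tendsto_intros)
  moreover have "0 < k3 P + c\<^sub>1 * c\<^sub>3"
    using cs k3_pos by (simp add: add_pos_pos)
  then have "G (- c\<^sub>3) < 0"
    using cs wM_pos wm_pos by (simp add: G_def k3_eq)
  ultimately have "eventually (\<lambda>V. G V < 0) (at_right (- c\<^sub>3))"
    by (simp add: order_tendstoD)
  then obtain b' where b': "- c\<^sub>3 < b'" "\<And>V. - c\<^sub>3 < V \<Longrightarrow> V < b' \<Longrightarrow> G V < 0"
    unfolding eventually_at_right_field by blast
  define V1 where "V1 = min ((b' - c\<^sub>3) / 2) V2"
  have V1: "- c\<^sub>3 < V1" "V1 \<le> V2" "V1 < 0"
    using b' V2 by (auto simp: V1_def min_def)
  have "V1 < b'" using b' by (auto simp: V1_def min_def)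
  then have "G V1 < 0" using b' V1 by auto
  moreover have "wM P * wm P * ((c\<^sub>1 + V1) * (k3 P - c\<^sub>1 * V1)\<^sup>2) \<le> strain_product V1 * ((c\<^sub>1 + V1) * (k3 P - c\<^sub>1 * V1)\<^sup>2)"
    using adm_neg_lower[of V1 "strain_product V1"] V1 cs by (intro mult_right_mono) (auto simp: adm_nonzero)
  ultimately have "F V1 \<le> 0" by (simp add: F_def G_def)
  then obtain V where "V1 \<le> V" "V \<le> V2" "F V = 0"
    using IVT'[of F V1 0 V2] V1 V2 cont[of "{V1..V2}"] by (force simp: subset_iff)
  then have "b2_speed h (- V)"
    using V1 V2 unfolding b2_speed_def F_def by (auto simp: adm_nonzero)
  then show ?thesis ..
qed

text \<open>Multiplying the jump relation by \<open>w\<close> and by \<open>w'\<close> expresses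
  each square through \<open>y\<close>. The two inequalities of \<open>adm_bounds\<close> then
  become \<open>w \<le> wM P\<close> and \<open>wm P \<le> w'\<close>: the entropy bounds are what
  keeps both states in their phases.\<close>

lemma strain_pair:
  assumes V: "\<bar>V\<bar> < c\<^sub>3" and y: "adm V y"
    and w: "w * w' = y" "w' * (k3 P - V\<^sup>2) = w * (k1 P - V\<^sup>2)" "0 < w'"
  shows "0 < w" "w \<le> wM P" "wm P \<le> w'"
proof -
  have *: "0 < k3 P - V\<^sup>2" "0 < k1 P - V\<^sup>2"
    using k3_minus_pos k1_minus_pos V by auto
  show "0 < w"
    using adm_pos[OF V y] w(1,3) zero_less_mult_iff[of w w'] by auto
  have "w\<^sup>2 * (k1 P - V\<^sup>2) = w * (w' * (k3 P - V\<^sup>2))"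
    unfolding w(2) by (simp add: power2_eq_square)
  then have "w\<^sup>2 * (k1 P - V\<^sup>2) = y * (k3 P - V\<^sup>2)"
    by (simp add: w(1)[symmetric])
  then have "w\<^sup>2 \<le> (wM P)\<^sup>2"
    using adm_bounds(1)[OF V y] *(2) by (metis mult_le_cancel_right_pos)
  then show "w \<le> wM P"
    by (rule power2_le_imp_le) (use wM_pos in simp)
  have "w'\<^sup>2 * (k3 P - V\<^sup>2) = w' * (w * (k1 P - V\<^sup>2))"
    unfolding w(2)[symmetric] by (simp add: power2_eq_square)
  then have "w'\<^sup>2 * (k3 P - V\<^sup>2) = y * (k1 P - V\<^sup>2)"
    by (simp add: w(1)[symmetric])
  then have "(wm P)\<^sup>2 \<le> w'\<^sup>2"
    using adm_bounds(2)[OF V y] *(1) by (metis mult_le_cancel_right_pos)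
  then show "wm P \<le> w'"
    by (rule power2_le_imp_le) (use w(3) in simp)
qed

section \<open>Monotone dependence of the speed on \<open>h\<close> in case a1\<close>

lemma adm_lower:
  obtains \<rho> where "0 < \<rho>" "\<And>V y. \<bar>V\<bar> < c\<^sub>3 \<Longrightarrow> adm V y \<Longrightarrow> \<rho> * (c\<^sub>3 - V) \<le> y"
proof
  \<comment> \<open>The second entry covers \<open>V < 0\<close>, where
    \<open>wM P * wm P \<le> y\<close> and \<open>c\<^sub>3 - V < 2 * c\<^sub>3\<close>. The first
    covers \<open>V \<ge> 0\<close>, where \<open>k3 P - V\<^sup>2\<close> is at least
    \<open>c\<^sub>3 * (c\<^sub>3 - V)\<close>.\<close>
  define \<rho> where "\<rho> = min ((wm P)\<^sup>2 * c\<^sub>3 / k1 P) (wM P * wm P / (2 * c\<^sub>3))"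
  note cs = c3_pos c3_less_c1 c1_pos wM_pos wm_pos k3_pos k3_less_k1
  show "0 < \<rho>"
    using cs by (simp add: \<rho>_def)
  fix V y
  assume V: "\<bar>V\<bar> < c\<^sub>3" and y: "adm V y"
  show "\<rho> * (c\<^sub>3 - V) \<le> y"
  proof (cases "V < 0")
    case True
    have "\<rho> * (c\<^sub>3 - V) \<le> wM P * wm P / (2 * c\<^sub>3) * (2 * c\<^sub>3)"
      using V cs by (intro mult_mono) (auto simp: \<rho>_def)
    also have "\<dots> = wM P * wm P" using cs by simp
    also have "\<dots> \<le> y" using adm_neg_lower[of V y] V y True by auto
    finally show ?thesis .
  next
    case False
    have "(wm P)\<^sup>2 * (c\<^sub>3 * (c\<^sub>3 - V)) \<le> (wm P)\<^sup>2 * (k3 P - V\<^sup>2)"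
    proof (intro mult_left_mono)
      have "0 \<le> V * (c\<^sub>3 - V)" using False V by simp
      then show "c\<^sub>3 * (c\<^sub>3 - V) \<le> k3 P - V\<^sup>2" by (simp add: k3_eq power2_eq_square algebra_simps)
    qed auto
    also have "\<dots> \<le> y * (k1 P - V\<^sup>2)" using adm_bounds(2)[OF V y] .
    also have "\<dots> \<le> y * k1 P" using adm_pos[OF V y] by (intro mult_left_mono) auto
    finally have "(wm P)\<^sup>2 * c\<^sub>3 / k1 P * (c\<^sub>3 - V) \<le> y"
      using cs by (simp add: pos_divide_le_eq mult_ac)
    moreover have "\<rho> * (c\<^sub>3 - V) \<le> (wm P)\<^sup>2 * c\<^sub>3 / k1 P * (c\<^sub>3 - V)"
      using V by (intro mult_right_mono) (auto simp: \<rho>_def)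
    ultimately show ?thesis by linarith
  qed
qed

text \<open>By \<open>adm_lower\<close> the right-hand side of the speed equation is at least
  quadratic in \<open>c\<^sub>3 - V\<close>, while the left-hand side is at most a multiple of
  \<open>h\<^sup>2\<close>. The linear rate serves twice: it compensates the degeneracy of the
  equation at \<open>h = 0\<close>, and it joins the speeds of cases a1 and a2 there.\<close>

lemma a1_speed_c3:
  obtains K where "0 < K" "\<And>h V. 0 < h \<Longrightarrow> a1_speed h V \<Longrightarrow> c\<^sub>3 - V \<le> K * h"
proof -
  obtain \<rho> where \<rho>: "0 < \<rho>" "\<And>V y. \<bar>V\<bar> < c\<^sub>3 \<Longrightarrow> adm V y \<Longrightarrow> \<rho> * (c\<^sub>3 - V) \<le> y"
    using adm_lower by blast
  note cs = c3_pos c3_less_c1 c1_pos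
  define M where "M = (2 * c\<^sub>3 * (c\<^sub>1 + c\<^sub>3)) / (\<rho> * (c\<^sub>1 - c\<^sub>3))"
  have M: "0 < M" using \<rho> cs by (simp add: M_def)
  show ?thesis
  proof
    show "0 < sqrt M" using M by simp
    fix h V :: real
    assume h: "0 < h" and "a1_speed h V"
    then obtain y where V: "\<bar>V\<bar> < c\<^sub>3" and y: "adm V y"
      and eq: "h\<^sup>2 * ((c\<^sub>3 + V) * (c\<^sub>1 - V)) = y * ((c\<^sub>3 - V) * (c\<^sub>1 + V))"
      unfolding a1_speed_def by auto
    have "\<rho> * (c\<^sub>3 - V) * ((c\<^sub>3 - V) * (c\<^sub>1 - c\<^sub>3)) \<le> y * ((c\<^sub>3 - V) * (c\<^sub>1 + V))"
      using \<rho>(2)[OF V y] V \<rho>(1) cs adm_pos[OF V y] by (intro mult_mono) auto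
    also have "\<dots> \<le> h\<^sup>2 * ((2 * c\<^sub>3) * (c\<^sub>1 + c\<^sub>3))"
      unfolding eq[symmetric] using V cs by (intro mult_mono) auto
    finally have "(c\<^sub>3 - V)\<^sup>2 \<le> M * h\<^sup>2"
      using \<rho>(1) cs by (simp add: M_def pos_le_divide_eq power2_eq_square mult_ac)
    also have "\<dots> = (sqrt M * h)\<^sup>2" using M by (simp add: power_mult_distrib)
    finally show "c\<^sub>3 - V \<le> sqrt M * h"
      by (rule power2_le_imp_le) (use M h in auto)
  qed
qed

text \<open>The equation is \<open>h\<^sup>2 = y * N / D\<close>. Since \<open>y\<close> does not
  increase with the speed, the drop of \<open>h\<^sup>2\<close> is at least the one caused by
  \<open>N / D\<close>, and \<open>\<kappa>\<close> bounds the rate of the latter through the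
  factorisation of \<open>N1 * D2 - N2 * D1\<close>.\<close>

lemma a1_speed_antimono_quant:
  obtains K where "0 < K" "\<And>h1 h2 V1 V2. \<lbrakk>0 < h1; 0 < h2; a1_speed h1 V1; a1_speed h2 V2; V1 < V2\<rbrakk>
    \<Longrightarrow> V2 - V1 \<le> K * (h1 - h2)"
proof -
  obtain K where K: "0 < K" "\<And>h V. 0 < h \<Longrightarrow> a1_speed h V \<Longrightarrow> c\<^sub>3 - V \<le> K * h"
    using a1_speed_c3 by blast
  note cs = c3_pos c3_less_c1 c1_pos
  define \<kappa> where "\<kappa> = 2 * (c\<^sub>1 - c\<^sub>3) * (c\<^sub>3 * (c\<^sub>1 - c\<^sub>3))"
  have \<kappa>: "0 < \<kappa>" using cs by (simp add: \<kappa>_def)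
  define M where "M = 2 * ((2 * c\<^sub>3) * (c\<^sub>1 + c\<^sub>3)) * (K * (c\<^sub>1 + c\<^sub>3))"
  have M: "0 < M" using cs K by (simp add: M_def)
  show ?thesis
  proof
    show "0 < M / \<kappa>" using \<kappa> M by simp
    fix h1 h2 V1 V2
    assume h: "0 < h1" "0 < h2" and a: "a1_speed h1 V1" "a1_speed h2 V2" and less: "V1 < V2"
    define N1 D1 N2 D2 where "N1 = (c\<^sub>3 - V1) * (c\<^sub>1 + V1)" and "D1 = (c\<^sub>3 + V1) * (c\<^sub>1 - V1)"
      and "N2 = (c\<^sub>3 - V2) * (c\<^sub>1 + V2)" and "D2 = (c\<^sub>3 + V2) * (c\<^sub>1 - V2)"
    obtain y1 where V1: "\<bar>V1\<bar> < c\<^sub>3" and y1: "adm V1 y1" and eq1: "h1\<^sup>2 * D1 = y1 * N1"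
      using a(1) unfolding a1_speed_def N1_def D1_def by auto
    obtain y2 where V2: "\<bar>V2\<bar> < c\<^sub>3" and y2: "adm V2 y2" and eq2: "h2\<^sup>2 * D2 = y2 * N2"
      using a(2) unfolding a1_speed_def N2_def D2_def by auto
    have pos: "0 < N1" "0 < D1" "0 < N2" "0 < D2" "0 < y1"
      using V1 V2 cs adm_pos[OF V1 y1] by (auto simp: N1_def D1_def N2_def D2_def)
    have y: "y2 \<le> y1"
      using adm_antimono[of V1 V2] V1 V2 less y1 y2 by auto
    have "- c\<^sub>3 * c\<^sub>3 \<le> V1 * V2"
      using V1 V2 abs_mult[of V1 V2] mult_mono[of "\<bar>V1\<bar>" "c\<^sub>3" "\<bar>V2\<bar>" "c\<^sub>3"] by auto
    then have p: "c\<^sub>3 * (c\<^sub>1 - c\<^sub>3) \<le> c\<^sub>1 * c\<^sub>3 + V1 * V2"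
      by (simp add: algebra_simps)
    have "N1 * D2 - N2 * D1 = 2 * (c\<^sub>1 - c\<^sub>3) * (c\<^sub>1 * c\<^sub>3 + V1 * V2) * (V2 - V1)"
      unfolding N1_def N2_def D1_def D2_def by algebra
    moreover have "\<kappa> * (V2 - V1) \<le> 2 * (c\<^sub>1 - c\<^sub>3) * (c\<^sub>1 * c\<^sub>3 + V1 * V2) * (V2 - V1)"
      unfolding \<kappa>_def using p cs less by (intro mult_right_mono mult_left_mono) auto
    ultimately have ND: "\<kappa> * (V2 - V1) \<le> N1 * D2 - N2 * D1" by simp
    have "h1\<^sup>2 * D1 * (\<kappa> * (V2 - V1)) = y1 * N1 * (\<kappa> * (V2 - V1))" by (simp add: eq1)
    also have "\<dots> \<le> y1 * N1 * (N1 * D2 - N2 * D1)"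
      using ND pos by (intro mult_left_mono) auto
    also have "\<dots> = N1 * (y1 * N1 * D2 - y1 * N2 * D1)" by algebra
    also have "\<dots> \<le> N1 * (y1 * N1 * D2 - y2 * N2 * D1)"
      using y pos by (intro mult_left_mono diff_left_mono mult_right_mono) auto
    also have "\<dots> = D1 * ((h1\<^sup>2 - h2\<^sup>2) * D2 * N1)"
      using eq1 eq2 by algebra
    finally have "D1 * (h1\<^sup>2 * (\<kappa> * (V2 - V1))) \<le> D1 * ((h1\<^sup>2 - h2\<^sup>2) * D2 * N1)" by (simp add: mult_ac)
    then have main: "h1\<^sup>2 * (\<kappa> * (V2 - V1)) \<le> (h1\<^sup>2 - h2\<^sup>2) * D2 * N1"
      using pos by simp
    have "0 < h1\<^sup>2 * (\<kappa> * (V2 - V1))" using h less \<kappa> by simp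
    then have "0 < (h1\<^sup>2 - h2\<^sup>2) * (D2 * N1)" using main by (simp add: mult_ac)
    then have "h2\<^sup>2 < h1\<^sup>2" using mult_pos_pos[OF pos(4,1)] by (auto simp: zero_less_mult_iff)
    then have hh: "h2 < h1" by (rule power2_less_imp_less) (use h in simp)
    \<comment> \<open>The left side of \<open>main\<close> carries \<open>h1\<^sup>2\<close>. One
      factor \<open>h1\<close> on the right comes from here, since \<open>c\<^sub>3 - V1\<close> is
      at most \<open>K * h1\<close>; the other comes from \<open>h1 + h2 \<le> 2 * h1\<close>.
      Cancelling both leaves a constant that stays bounded as \<open>h\<close> tends to
      \<open>0\<close>.\<close>
    have N1: "N1 \<le> K * h1 * (c\<^sub>1 + c\<^sub>3)"
      unfolding N1_def using K(2)[OF h(1) a(1)] V1 cs K(1) h by (intro mult_mono) auto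
    have D2: "D2 \<le> (2 * c\<^sub>3) * (c\<^sub>1 + c\<^sub>3)"
      unfolding D2_def using V2 cs by (intro mult_mono) auto
    have "(h1\<^sup>2 - h2\<^sup>2) * D2 * N1 \<le> ((h1 - h2) * (2 * h1)) * ((2 * c\<^sub>3) * (c\<^sub>1 + c\<^sub>3)) * (K * h1 * (c\<^sub>1 + c\<^sub>3))"
    proof (intro mult_mono N1 D2)
      have "h1\<^sup>2 - h2\<^sup>2 = (h1 - h2) * (h1 + h2)" by algebra
      also have "\<dots> \<le> (h1 - h2) * (2 * h1)" using hh h by (intro mult_left_mono) auto
      finally show "h1\<^sup>2 - h2\<^sup>2 \<le> (h1 - h2) * (2 * h1)" .
    qed (use hh h cs pos K in auto)
    also have "\<dots> = h1\<^sup>2 * (M * (h1 - h2))" unfolding M_def by algebra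
    finally have "h1\<^sup>2 * (\<kappa> * (V2 - V1)) \<le> h1\<^sup>2 * (M * (h1 - h2))" using main by linarith
    then have "\<kappa> * (V2 - V1) \<le> M * (h1 - h2)" using h by simp
    then show "V2 - V1 \<le> M / \<kappa> * (h1 - h2)"
      using \<kappa> by (simp add: field_simps)
  qed
qed

lemma a1_speed_lipschitz:
  obtains K where "0 < K" "\<And>h1 h2 V1 V2. \<lbrakk>0 < h1; 0 < h2; a1_speed h1 V1; a1_speed h2 V2\<rbrakk>
    \<Longrightarrow> \<bar>V1 - V2\<bar> \<le> K * \<bar>h1 - h2\<bar>"
proof -
  obtain K where K: "0 < K" "\<And>h1 h2 V1 V2. \<lbrakk>0 < h1; 0 < h2; a1_speed h1 V1; a1_speed h2 V2; V1 < V2\<rbrakk>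
    \<Longrightarrow> V2 - V1 \<le> K * (h1 - h2)"
    using a1_speed_antimono_quant by blast
  have less: "\<bar>V1 - V2\<bar> \<le> K * \<bar>h1 - h2\<bar>"
    if "0 < h1" "0 < h2" "a1_speed h1 V1" "a1_speed h2 V2" "V1 < V2" for h1 h2 V1 V2
  proof -
    have "\<bar>V1 - V2\<bar> = V2 - V1" using that by simp
    also have "\<dots> \<le> K * (h1 - h2)" using K(2) that by blast
    also have "\<dots> \<le> K * \<bar>h1 - h2\<bar>" using K(1) by (intro mult_left_mono) auto
    finally show ?thesis .
  qed
  show ?thesis
  proof
    fix h1 h2 V1 V2
    assume a: "0 < h1" "0 < h2" "a1_speed h1 V1" "a1_speed h2 V2"
    consider "V1 < V2" | "V1 = V2" | "V2 < V1" by linarith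
    then show "\<bar>V1 - V2\<bar> \<le> K * \<bar>h1 - h2\<bar>"
    proof cases
      case 3
      then show ?thesis using less[OF a(2,1,4,3)] by (simp add: abs_minus_commute)
    qed (use less a K in auto)
  qed (rule K)
qed

lemma a1_speed_unique:
  assumes "0 < h" "a1_speed h V1" "a1_speed h V2"
  shows "V1 = V2"
proof (rule a1_speed_lipschitz)
  fix K :: real
  assume "\<And>h1 h2 V1 V2. \<lbrakk>0 < h1; 0 < h2; a1_speed h1 V1; a1_speed h2 V2\<rbrakk>
    \<Longrightarrow> \<bar>V1 - V2\<bar> \<le> K * \<bar>h1 - h2\<bar>"
  from this[OF assms(1,1,2,3)] show ?thesis by simp
qed

section \<open>Monotone dependence of the speed on \<open>h\<close> in case b2\<close>

definition b2_w2 :: "real \<Rightarrow> real \<Rightarrow> real" where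
  "b2_w2 h V = h * (c\<^sub>1 * (c\<^sub>1 + V)) / (k3 P + c\<^sub>1 * V)"

lemma b2_w2:
  assumes "0 < h" "b2_speed h V"
  obtains y where "adm (- V) y" "(b2_w2 h V)\<^sup>2 * (k3 P - V\<^sup>2) = y * (k1 P - V\<^sup>2)" "wm P \<le> b2_w2 h V"
    "b2_w2 h V * ((k3 P + c\<^sub>1 * V) / (c\<^sub>1 * (c\<^sub>1 + V))) = h"
proof -
  note cs = c3_pos c3_less_c1 c1_pos k3_pos
  obtain y where V: "0 < V" "V < c\<^sub>3" and y: "adm (- V) y"
    and eq: "h\<^sup>2 * (k1 P * (c\<^sub>1 + V) * (k3 P - V\<^sup>2)) = y * ((c\<^sub>1 - V) * (k3 P + c\<^sub>1 * V)\<^sup>2)"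
    using assms unfolding b2_speed_def by auto
  define n where "n = k3 P + c\<^sub>1 * V"
  have pos: "0 < n" "0 < c\<^sub>1 + V"
    using V cs by (auto simp: n_def intro: add_pos_pos)
  have w: "b2_w2 h V * n = h * (c\<^sub>1 * (c\<^sub>1 + V))"
    using pos by (simp add: b2_w2_def n_def)
  have "n\<^sup>2 * ((b2_w2 h V)\<^sup>2 * (k3 P - V\<^sup>2)) = n\<^sup>2 * (y * (k1 P - V\<^sup>2))"
    using w eq unfolding n_def[symmetric] k1_eq by algebra
  then have e: "(b2_w2 h V)\<^sup>2 * (k3 P - V\<^sup>2) = y * (k1 P - V\<^sup>2)"
    using pos by simp
  have wpos: "0 < b2_w2 h V"
    using pos assms(1) cs by (simp add: b2_w2_def n_def)
  have k1V: "0 < k1 P - V\<^sup>2"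
    using k1_minus_pos[of V] V by simp
  have "wm P \<le> b2_w2 h V"
  \<comment> \<open>The third instance is the strain on the phase 1 side of the boundary, later
    called \<open>b2_w1 h V\<close>.\<close>
  proof (rule strain_pair(3)[of "- V" y "b2_w2 h V * (k3 P - V\<^sup>2) / (k1 P - V\<^sup>2)"])
    show "b2_w2 h V * (k3 P - V\<^sup>2) / (k1 P - V\<^sup>2) * b2_w2 h V = y"
      using e k1V by (simp add: power2_eq_square mult_ac nonzero_divide_eq_eq)
  qed (use V y wpos k1V in auto)
  moreover have "b2_w2 h V * ((k3 P + c\<^sub>1 * V) / (c\<^sub>1 * (c\<^sub>1 + V))) = h"
    unfolding n_def[symmetric] using w pos cs by (simp add: nonzero_divide_eq_eq)
  ultimately show ?thesis by (rule that[OF y e])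
qed

text \<open>The reciprocal of \<open>wM P\<close> times the rate in
  \<open>b2_factor_diff\<close>.\<close>

definition b2_const :: real where
  "b2_const = 4 * c\<^sub>1 ^ 3 / (wM P * (c\<^sub>1\<^sup>2 - k3 P))"

lemma b2_const_pos: "0 < b2_const"
  using c1_pos wM_pos k3_less_k1 unfolding k1_eq by (simp add: b2_const_def)

lemma b2_const_bound:
  assumes "wM P \<le> w" "0 \<le> V1" "V1 \<le> V2" "V2 < c\<^sub>1"
    and "w * ((k3 P + c\<^sub>1 * V2) / (c\<^sub>1 * (c\<^sub>1 + V2)) - (k3 P + c\<^sub>1 * V1) / (c\<^sub>1 * (c\<^sub>1 + V1))) \<le> z"
  shows "V2 - V1 \<le> b2_const * z"
proof -
  note cs = c1_pos k3_less_k1[unfolded k1_eq] wM_pos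
  have "wM P * ((c\<^sub>1\<^sup>2 - k3 P) / (4 * c\<^sub>1 ^ 3) * (V2 - V1)) \<le>
    w * ((k3 P + c\<^sub>1 * V2) / (c\<^sub>1 * (c\<^sub>1 + V2)) - (k3 P + c\<^sub>1 * V1) / (c\<^sub>1 * (c\<^sub>1 + V1)))"
    by (rule mult_mono[OF assms(1) b2_factor_diff]) (use assms cs in auto)
  then have "wM P * ((c\<^sub>1\<^sup>2 - k3 P) / (4 * c\<^sub>1 ^ 3) * (V2 - V1)) \<le> z"
    using assms(5) by linarith
  then have "b2_const * (wM P * ((c\<^sub>1\<^sup>2 - k3 P) / (4 * c\<^sub>1 ^ 3) * (V2 - V1))) \<le> b2_const * z"
    using b2_const_pos by (intro mult_left_mono) auto
  then show ?thesis
    using cs by (simp add: b2_const_def)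
qed

text \<open>\<open>h\<close> is the product of the middle strain and the factor \<open>n V\<close>.
  The strain does not decrease with \<open>V\<close>: its square is
  \<open>y * (1 + (k1 P - k3 P) / (k3 P - V\<^sup>2))\<close>, and both factors are monotone. So
  \<open>h\<close> grows at least at the rate of \<open>n\<close> times the smaller strain.\<close>

lemma b2_speed_mono_quant:
  assumes h: "0 < h1" "0 < h2" and b: "b2_speed h1 V1" "b2_speed h2 V2" and less: "V1 < V2"
  shows "V2 - V1 \<le> b2_const * (h2 - h1)"
proof -
  note cs = c3_pos c3_less_c1 c1_pos k3_pos
  define n where "n = (\<lambda>V. (k3 P + c\<^sub>1 * V) / (c\<^sub>1 * (c\<^sub>1 + V)))"
  obtain y1 where y1: "adm (- V1) y1" "(b2_w2 h1 V1)\<^sup>2 * (k3 P - V1\<^sup>2) = y1 * (k1 P - V1\<^sup>2)"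
    "wm P \<le> b2_w2 h1 V1" "b2_w2 h1 V1 * n V1 = h1"
    using b2_w2[OF h(1) b(1)] unfolding n_def by blast
  obtain y2 where y2: "adm (- V2) y2" "(b2_w2 h2 V2)\<^sup>2 * (k3 P - V2\<^sup>2) = y2 * (k1 P - V2\<^sup>2)"
    "wm P \<le> b2_w2 h2 V2" "b2_w2 h2 V2 * n V2 = h2"
    using b2_w2[OF h(2) b(2)] unfolding n_def by blast
  have V: "0 < V1" "V1 < c\<^sub>3" "0 < V2" "V2 < c\<^sub>3"
    using b by (auto simp: b2_speed_def)
  have pos: "0 < k3 P - V1\<^sup>2" "0 < k3 P - V2\<^sup>2" "0 < k1 P - V1\<^sup>2"
    using V k3_minus_pos k1_minus_pos by auto
  have y: "y1 \<le> y2"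
    using adm_antimono[of "- V2" "- V1"] V less y1 y2 by auto
  have "0 < y1" using adm_pos[OF _ y1(1)] V by auto
  have "(b2_w2 h1 V1)\<^sup>2 = y1 * (1 + (k1 P - k3 P) / (k3 P - V1\<^sup>2))"
    using square_ratio[OF y1(2) pos(1)] by simp
  also have "\<dots> \<le> y2 * (1 + (k1 P - k3 P) / (k3 P - V2\<^sup>2))"
    using pos y \<open>0 < y1\<close> k3_less_k1 V less
    by (intro mult_mono add_left_mono divide_left_mono) (auto intro: power_mono)
  also have "\<dots> = (b2_w2 h2 V2)\<^sup>2"
    using square_ratio[OF y2(2) pos(2)] by simp
  finally have w: "b2_w2 h1 V1 \<le> b2_w2 h2 V2"
    by (rule power2_le_imp_le) (use y2(3) wm_pos in auto)
  have "0 \<le> n V2"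
    using V cs by (simp add: n_def)
  then have "b2_w2 h1 V1 * n V2 \<le> h2"
    using mult_right_mono[OF w, of "n V2"] unfolding y2(4) by blast
  then have *: "b2_w2 h1 V1 * (n V2 - n V1) \<le> h2 - h1"
    using y1(4) unfolding right_diff_distrib by linarith
  show ?thesis
  proof (rule b2_const_bound[OF _ _ _ _ *[unfolded n_def]])
    show "wM P \<le> b2_w2 h1 V1" "0 \<le> V1" "V1 \<le> V2" "V2 < c\<^sub>1"
      using y1(3) wM_less_wm V cs less by linarith+
  qed
qed

lemma b2_speed_lipschitz:
  assumes h: "0 < h1" "0 < h2" and b: "b2_speed h1 V1" "b2_speed h2 V2"
  shows "\<bar>V1 - V2\<bar> \<le> b2_const * \<bar>h1 - h2\<bar>"
proof -
  consider "V1 < V2" | "V1 = V2" | "V2 < V1" by linarith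
  then show ?thesis
  proof cases
    case 1
    then have "\<bar>V1 - V2\<bar> \<le> b2_const * (h2 - h1)" using b2_speed_mono_quant[OF h b] by simp
    also have "\<dots> \<le> b2_const * \<bar>h1 - h2\<bar>" using b2_const_pos by (intro mult_left_mono) auto
    finally show ?thesis .
  next
    case 3
    then have "\<bar>V1 - V2\<bar> \<le> b2_const * (h1 - h2)" using b2_speed_mono_quant[OF h(2,1) b(2,1)] by simp
    also have "\<dots> \<le> b2_const * \<bar>h1 - h2\<bar>" using b2_const_pos by (intro mult_left_mono) auto
    finally show ?thesis .
  qed (use b2_const_pos in auto)
qed

lemma b2_speed_unique: "V1 = V2" if "0 < h" "b2_speed h V1" "b2_speed h V2"
  using b2_speed_lipschitz[OF that(1,1,2,3)] by simp

text \<open>\<open>wM P * (k1 P / k3 P)\<close> is the strain that balances \<open>wM P\<close>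
  across a stationary boundary. Equality at the threshold makes it a lower bound for the middle
  strain. Since \<open>n 0\<close> is \<open>k3 P / k1 P\<close>, the part of \<open>h\<close>
  beyond \<open>wM P\<close> dominates the increase of \<open>n\<close> from \<open>0\<close> to
  \<open>V\<close>.\<close>

lemma b2_speed_threshold:
  assumes "phi_0_minus P = psi_low P 0" and h: "0 < h" and b: "b2_speed h V"
  shows "V \<le> b2_const * (h - wM P)"
proof -
  note cs = c3_pos c3_less_c1 c1_pos k3_pos k3_less_k1 wM_pos
  define n where "n = (\<lambda>V. (k3 P + c\<^sub>1 * V) / (c\<^sub>1 * (c\<^sub>1 + V)))"
  obtain y where y: "adm (- V) y" "(b2_w2 h V)\<^sup>2 * (k3 P - V\<^sup>2) = y * (k1 P - V\<^sup>2)"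
    "wm P \<le> b2_w2 h V" "b2_w2 h V * n V = h"
    using b2_w2[OF h b] unfolding n_def by blast
  have V: "0 < V" "V < c\<^sub>3" using b by (auto simp: b2_speed_def)
  have "dissipation y \<le> dissipation ((wM P)\<^sup>2 * (k1 P / k3 P))"
  proof -
    have "dissipation y \<le> psi_low P 0"
      using phi_le_phi_0_minus[of "- V"] V y(1) assms(1) by (simp add: adm_def eq_phi_def)
    also have "\<dots> \<le> dissipation ((wM P)\<^sup>2 * (k1 P / k3 P))"
      using psi_low_le_dissipation[of 0 "(wM P)\<^sup>2 * (k1 P / k3 P)"] cs by simp
    finally show ?thesis .
  qed
  then have "(wM P)\<^sup>2 * (k1 P / k3 P) \<le> y" by (simp add: dissipation_antimono)
  then have "(wM P)\<^sup>2 * (k1 P / k3 P) * (k1 P / k3 P) \<le> y * (k1 P / k3 P)"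
    using cs by (intro mult_right_mono) auto
  also have "\<dots> \<le> y * (1 + (k1 P - k3 P) / (k3 P - V\<^sup>2))"
  proof (intro mult_left_mono)
    have "k1 P / k3 P = 1 + (k1 P - k3 P) / k3 P" using cs by (simp add: field_simps)
    also have "\<dots> \<le> 1 + (k1 P - k3 P) / (k3 P - V\<^sup>2)"
      using cs V k3_minus_pos[of V] by (intro add_left_mono divide_left_mono) auto
    finally show "k1 P / k3 P \<le> 1 + (k1 P - k3 P) / (k3 P - V\<^sup>2)" .
  qed (use adm_pos[OF _ y(1)] V in auto)
  also have "\<dots> = (b2_w2 h V)\<^sup>2"
    using square_ratio[OF y(2) k3_minus_pos[of V]] V by simp
  finally have "(wM P * (k1 P / k3 P))\<^sup>2 \<le> (b2_w2 h V)\<^sup>2"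
    by (simp add: power2_eq_square mult_ac)
  then have w: "wM P * (k1 P / k3 P) \<le> b2_w2 h V"
    by (rule power2_le_imp_le) (use y(3) wm_pos in auto)
  have n0: "n 0 = k3 P / k1 P" by (simp add: n_def k1_eq power2_eq_square)
  have "wM P = wM P * (k1 P / k3 P) * n 0" using cs by (simp add: n0)
  also have "\<dots> \<le> b2_w2 h V * n 0" using w cs by (intro mult_right_mono) (auto simp: n0)
  finally have *: "b2_w2 h V * (n V - n 0) \<le> h - wM P"
    using y(4) unfolding right_diff_distrib by linarith
  have "V - 0 \<le> b2_const * (h - wM P)"
  proof (rule b2_const_bound[OF _ _ _ _ *[unfolded n_def]])
    show "wM P \<le> b2_w2 h V" "0 \<le> V" "V < c\<^sub>1"
      using y(3) wM_less_wm V cs by linarith+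
  qed simp
  then show ?thesis by simp
qed

section \<open>The Riemann fans\<close>

lemma sigma_H1: "sigma P (snd u) = k1 P * snd u" if "u \<in> H1 P"
  using that by (auto simp: sigma_def H1_def)

lemma sigma_H3: "sigma P (snd u) = k3 P * snd u" if "u \<in> H3 P"
  using that wM_less_wm by (auto simp: sigma_def H3_def)

lemma H1_H3_disjoint: "H1 P \<inter> H3 P = {}"
  using wM_less_wm by (auto simp: H1_def H3_def)

lemma mem_H1: "u \<in> H1 P \<longleftrightarrow> -1 < snd u \<and> snd u \<le> wM P"
  by (auto simp: H1_def split: prod.splits)

lemma mem_H3: "u \<in> H3 P \<longleftrightarrow> wm P \<le> snd u"
  by (auto simp: H3_def split: prod.splits)

text \<open>At a characteristic speed of the phase both sides of the strain relation in
  \<open>jump_conditions_iff\<close> vanish, so only the velocity relation remains.\<close>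

lemma contact_H1:
  assumes "ua \<in> H1 P" "ub \<in> H1 P"
  shows "rankine_hugoniot P (- c\<^sub>1) ua ub \<longleftrightarrow> fst ub = fst ua + c\<^sub>1 * (snd ub - snd ua)"
    and "rankine_hugoniot P c\<^sub>1 ua ub \<longleftrightarrow> fst ub = fst ua - c\<^sub>1 * (snd ub - snd ua)"
  unfolding rankine_hugoniot_def sigma_H1[OF assms(1)] sigma_H1[OF assms(2)] k1_eq jump_conditions_iff
  by auto

lemma contact_H3:
  assumes "ua \<in> H3 P" "ub \<in> H3 P"
  shows "rankine_hugoniot P c\<^sub>3 ua ub \<longleftrightarrow> fst ub = fst ua - c\<^sub>3 * (snd ub - snd ua)"
  unfolding rankine_hugoniot_def sigma_H3[OF assms(1)] sigma_H3[OF assms(2)] k3_eq jump_conditions_iff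
  by auto

lemma rankine_hugoniot_H1_H3:
  assumes "ua \<in> H1 P" "ub \<in> H3 P"
  shows "rankine_hugoniot P V ua ub \<longleftrightarrow>
    fst ub = fst ua - V * (snd ub - snd ua) \<and> snd ub * (k3 P - V\<^sup>2) = snd ua * (k1 P - V\<^sup>2)"
  unfolding rankine_hugoniot_def sigma_H1[OF assms(1)] sigma_H3[OF assms(2)] jump_conditions_iff
  by auto

lemma rankine_hugoniot_H3_H1:
  assumes "ua \<in> H3 P" "ub \<in> H1 P"
  shows "rankine_hugoniot P V ua ub \<longleftrightarrow>
    fst ub = fst ua - V * (snd ub - snd ua) \<and> snd ua * (k3 P - V\<^sup>2) = snd ub * (k1 P - V\<^sup>2)"
  unfolding rankine_hugoniot_def sigma_H3[OF assms(1)] sigma_H1[OF assms(2)] jump_conditions_iff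
  by auto

lemma phase_boundary_H1_H3:
  assumes "ua \<in> H1 P" "ub \<in> H3 P"
  shows "phase_boundary P V ua ub \<longleftrightarrow> fst ub = fst ua - V * (snd ub - snd ua) \<and>
    snd ub * (k3 P - V\<^sup>2) = snd ua * (k1 P - V\<^sup>2) \<and> (\<bar>V\<bar> \<le> c\<^sub>3 \<longrightarrow> adm V (snd ua * snd ub))"
  unfolding phase_boundary_def rankine_hugoniot_H1_H3[OF assms] kinetic_relation_def adm_def
    dissipation_def Let_def
  using assms H1_H3_disjoint by auto

lemma phase_boundary_H3_H1:
  assumes "ua \<in> H3 P" "ub \<in> H1 P"
  shows "phase_boundary P V ua ub \<longleftrightarrow> fst ub = fst ua - V * (snd ub - snd ua) \<and>
    snd ua * (k3 P - V\<^sup>2) = snd ub * (k1 P - V\<^sup>2) \<and> (\<bar>V\<bar> \<le> c\<^sub>3 \<longrightarrow> adm (- V) (snd ua * snd ub))"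
  unfolding phase_boundary_def rankine_hugoniot_H3_H1[OF assms] kinetic_relation_def adm_def
    dissipation_def Let_def
  using assms H1_H3_disjoint by auto

section \<open>The fans of case a\<close>

definition w_minus :: "real \<Rightarrow> real \<Rightarrow> real" where
  "w_minus h V = (c\<^sub>3 + V) / (c\<^sub>1 + V) * h"

definition w_plus :: "real \<Rightarrow> real \<Rightarrow> real" where
  "w_plus h V = (c\<^sub>1 - V) / (c\<^sub>3 - V) * h"

lemma w_minus_eq: "(c\<^sub>1 + V) * w_minus h V = (c\<^sub>3 + V) * h" if "- c\<^sub>3 \<le> V"
  using that c3_less_c1 by (simp add: w_minus_def)

lemma w_plus_eq: "(c\<^sub>3 - V) * w_plus h V = (c\<^sub>1 - V) * h" if "V < c\<^sub>3"
  using that by (simp add: w_plus_def)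

lemma a1_strains:
  assumes h: "0 < h" and a: "a1_speed h V"
  shows "adm V (w_minus h V * w_plus h V)" "0 < w_minus h V" "w_minus h V \<le> wM P" "wm P \<le> w_plus h V"
    "w_plus h V * (k3 P - V\<^sup>2) = w_minus h V * (k1 P - V\<^sup>2)"
proof -
  obtain y where V: "\<bar>V\<bar> < c\<^sub>3" and y: "adm V y"
    and eq: "h\<^sup>2 * ((c\<^sub>3 + V) * (c\<^sub>1 - V)) = y * ((c\<^sub>3 - V) * (c\<^sub>1 + V))"
    using a unfolding a1_speed_def by auto
  note cs = c3_pos c3_less_c1 c1_pos
  have e: "(c\<^sub>1 + V) * w_minus h V = (c\<^sub>3 + V) * h" "(c\<^sub>3 - V) * w_plus h V = (c\<^sub>1 - V) * h"
    using w_minus_eq w_plus_eq V by auto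
  have pos: "0 < c\<^sub>1 + V" "0 < c\<^sub>3 - V" "0 < c\<^sub>1 - V" using V cs by auto
  have "((c\<^sub>3 - V) * (c\<^sub>1 + V)) * (w_minus h V * w_plus h V) = ((c\<^sub>3 - V) * (c\<^sub>1 + V)) * y"
    using e eq by algebra
  then have 1: "w_minus h V * w_plus h V = y"
    using pos by simp
  show 2: "w_plus h V * (k3 P - V\<^sup>2) = w_minus h V * (k1 P - V\<^sup>2)"
    unfolding k1_eq k3_eq using e by algebra
  have 3: "0 < w_plus h V" using h pos by (simp add: w_plus_def)
  show "adm V (w_minus h V * w_plus h V)" using 1 y by simp
  show "0 < w_minus h V" "w_minus h V \<le> wM P" "wm P \<le> w_plus h V"
    using strain_pair[OF V y 1 2 3] by auto
qed

lemma is_riemann_fan_a1: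
  assumes d: "((vL, wL), (vR, wR)) \<in> data_a1 P" and h: "h = h_a P ((vL, wL), (vR, wR))"
  shows "is_riemann_fan P ((vL, wL), (vR, wR)) F \<longleftrightarrow> (\<exists>V. a1_speed h V \<and>
    F = Fan_a1 (vL + c\<^sub>1 * (w_minus h V - wL), w_minus h V) (vR + c\<^sub>3 * (wR - w_plus h V), w_plus h V) V)"
    (is "?L \<longleftrightarrow> ?R")
proof
  note cs = c3_pos c3_less_c1 c1_pos
  have hpos: "0 < h" and LR: "(vL, wL) \<in> H1 P" "(vR, wR) \<in> H3 P"
    using d h by (auto simp: data_a1_def)
  have hh: "(c\<^sub>1 + c\<^sub>3) * h = c\<^sub>1 * wL + c\<^sub>3 * wR + vR - vL"
    using cs by (simp add: h h_a_def)
  \<comment> \<open>Each constructor of \<open>fan\<close> carries its own set of data, so this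
    forces the shape of \<open>F\<close>.\<close>
  have no: "((vL, wL), (vR, wR)) \<notin> data_a2 P" "((vL, wL), (vR, wR)) \<notin> data_b1 P" "((vL, wL), (vR, wR)) \<notin> data_b2 P"
    using hpos LR H1_H3_disjoint unfolding h data_a2_def data_b1_def data_b2_def by auto
  {
    assume ?L
    then obtain um up V where F: "F = Fan_a1 um up V"
      using no by (cases F) auto
    obtain vm wm' where um: "um = (vm, wm')" by fastforce
    obtain vp wp where up: "up = (vp, wp)" by fastforce
    from \<open>?L\<close>[unfolded F] have H: "um \<in> H1 P" "up \<in> H3 P" and V: "\<bar>V\<bar> < c\<^sub>3"
      and rh: "rankine_hugoniot P (- c\<^sub>1) (vL, wL) um" "phase_boundary P V um up"
        "rankine_hugoniot P c\<^sub>3 up (vR, wR)"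
      by auto
    have e1: "vm = vL + c\<^sub>1 * (wm' - wL)" and e2: "vR = vp - c\<^sub>3 * (wR - wp)"
      and e3: "vp = vm - V * (wp - wm')" and e4: "wp * (k3 P - V\<^sup>2) = wm' * (k1 P - V\<^sup>2)"
      and adm: "adm V (wm' * wp)"
      using rh V unfolding contact_H1[OF LR(1) H(1)] contact_H3[OF H(2) LR(2)] phase_boundary_H1_H3[OF H]
      by (auto simp: um up)
    have pos: "0 < c\<^sub>1 + V" "0 < c\<^sub>3 - V" "0 < c\<^sub>1 + c\<^sub>3" using V cs by auto
    \<comment> \<open>The velocities cancel when the three velocity relations are added. With
      \<open>s2\<close> this is a linear system for the products
      \<open>(c\<^sub>1 + V) * wm'\<close> and \<open>(c\<^sub>3 - V) * wp\<close>; its solution is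
      \<open>(c\<^sub>3 + V) * h\<close> and \<open>(c\<^sub>1 - V) * h\<close>.\<close>
    have s1: "(c\<^sub>1 + V) * wm' + (c\<^sub>3 - V) * wp = (c\<^sub>1 + c\<^sub>3) * h"
      using e1 e2 e3 hh by algebra
    have s2: "(c\<^sub>3 - V) * wp * (c\<^sub>3 + V) = (c\<^sub>1 + V) * wm' * (c\<^sub>1 - V)"
      using e4 unfolding k1_eq k3_eq by algebra
    have "(c\<^sub>1 + c\<^sub>3) * ((c\<^sub>1 + V) * wm') = (c\<^sub>1 + c\<^sub>3) * ((c\<^sub>3 + V) * h)"
      using s1 s2 by algebra
    then have p: "(c\<^sub>1 + V) * wm' = (c\<^sub>3 + V) * h" using pos by simp
    have q: "(c\<^sub>3 - V) * wp = (c\<^sub>1 - V) * h" using s1 p by algebra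
    have w: "wm' = w_minus h V" "wp = w_plus h V"
      using p q pos by (auto simp: w_minus_def w_plus_def field_simps)
    have "h\<^sup>2 * ((c\<^sub>3 + V) * (c\<^sub>1 - V)) = (wm' * wp) * ((c\<^sub>3 - V) * (c\<^sub>1 + V))"
      using p q by algebra
    then have "a1_speed h V" using V adm unfolding a1_speed_def by blast
    then show ?R
      using e1 e2 by (auto simp: F um up w)
  next
    assume ?R
    then obtain V where a: "a1_speed h V" and
      F: "F = Fan_a1 (vL + c\<^sub>1 * (w_minus h V - wL), w_minus h V) (vR + c\<^sub>3 * (wR - w_plus h V), w_plus h V) V"
      by auto
    have V: "\<bar>V\<bar> < c\<^sub>3" using a by (simp add: a1_speed_def)
    define um where "um = (vL + c\<^sub>1 * (w_minus h V - wL), w_minus h V)"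
    define up where "up = (vR + c\<^sub>3 * (wR - w_plus h V), w_plus h V)"
    note st = a1_strains[OF hpos a]
    have H: "um \<in> H1 P" "up \<in> H3 P"
      using st by (auto simp: um_def up_def mem_H1 mem_H3)
    have e: "(c\<^sub>1 + V) * w_minus h V = (c\<^sub>3 + V) * h" "(c\<^sub>3 - V) * w_plus h V = (c\<^sub>1 - V) * h"
      using w_minus_eq w_plus_eq V by auto
    have "vR + c\<^sub>3 * (wR - w_plus h V) = vL + c\<^sub>1 * (w_minus h V - wL) - V * (w_plus h V - w_minus h V)"
      using e hh by algebra
    then show ?L
      using d H V st unfolding F um_def[symmetric] up_def[symmetric] is_riemann_fan.simps
        contact_H1[OF LR(1) H(1)] contact_H3[OF H(2) LR(2)] phase_boundary_H1_H3[OF H]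
      by (auto simp: um_def up_def)
  }
qed

text \<open>The datum on the right adjoins the phase boundary directly, so the jump relations alone
  determine the speed. After cancellation of \<open>c\<^sub>1 + c\<^sub>3\<close> they are linear in
  it.\<close>

definition a2_speed :: "real \<Rightarrow> real \<Rightarrow> real" where
  "a2_speed h wR = (c\<^sub>3 * wR - c\<^sub>1 * h) / (wR - h)"

lemma a2_speed:
  assumes "h \<le> 0" "0 < wR"
  shows "c\<^sub>3 \<le> a2_speed h wR" "c\<^sub>1 - a2_speed h wR = (c\<^sub>1 - c\<^sub>3) * wR / (wR - h)"
    "a2_speed h wR < c\<^sub>1" "a2_speed h wR - c\<^sub>3 = (c\<^sub>1 - c\<^sub>3) * (- h / (wR - h))"
proof -
  have p: "0 < wR - h" using assms by linarith
  show 1: "c\<^sub>1 - a2_speed h wR = (c\<^sub>1 - c\<^sub>3) * wR / (wR - h)"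
    using p by (simp add: a2_speed_def field_simps)
  have "0 < (c\<^sub>1 - c\<^sub>3) * wR / (wR - h)" using p assms c3_less_c1 by simp
  then show "a2_speed h wR < c\<^sub>1" using 1 by linarith
  show 2: "a2_speed h wR - c\<^sub>3 = (c\<^sub>1 - c\<^sub>3) * (- h / (wR - h))"
    using p by (simp add: a2_speed_def field_simps)
  have "0 \<le> (c\<^sub>1 - c\<^sub>3) * (- h / (wR - h))"
    using p assms c3_less_c1 by (intro mult_nonneg_nonneg divide_nonneg_pos) auto
  then show "c\<^sub>3 \<le> a2_speed h wR" using 2 by linarith
qed

lemma is_riemann_fan_a2:
  assumes d: "((vL, wL), (vR, wR)) \<in> data_a2 P" and h: "h = h_a P ((vL, wL), (vR, wR))"
  shows "is_riemann_fan P ((vL, wL), (vR, wR)) F \<longleftrightarrow>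
    F = Fan_a2 (vL + c\<^sub>1 * (w_minus h (a2_speed h wR) - wL), w_minus h (a2_speed h wR)) (a2_speed h wR)"
    (is "?L \<longleftrightarrow> ?R")
proof
  note cs = c3_pos c3_less_c1 c1_pos
  have hneg: "h \<le> 0" and hinf: "h_infinity P ((vL, wL), (vR, wR)) < h"
    and LR: "(vL, wL) \<in> H1 P" "(vR, wR) \<in> H3 P"
    using d h by (auto simp: data_a2_def)
  have wR: "0 < wR" using LR(2) wm_pos by (simp add: mem_H3)
  then have wRh: "0 < wR - h" using hneg by linarith
  have hh: "(c\<^sub>1 + c\<^sub>3) * h = c\<^sub>1 * wL + c\<^sub>3 * wR + vR - vL"
    using cs by (simp add: h h_a_def)
  have no: "((vL, wL), (vR, wR)) \<notin> data_a1 P" "((vL, wL), (vR, wR)) \<notin> data_b1 P" "((vL, wL), (vR, wR)) \<notin> data_b2 P"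
    using hneg LR H1_H3_disjoint unfolding h data_a1_def data_b1_def data_b2_def by auto
  {
    assume ?L
    then obtain um V where F: "F = Fan_a2 um V"
      using no by (cases F) auto
    obtain vm wm' where um: "um = (vm, wm')" by fastforce
    from \<open>?L\<close>[unfolded F] have H: "um \<in> H1 P" and V: "c\<^sub>3 \<le> V" "V < c\<^sub>1"
      and rh: "rankine_hugoniot P (- c\<^sub>1) (vL, wL) um" "phase_boundary P V um (vR, wR)"
      by auto
    have e1: "vm = vL + c\<^sub>1 * (wm' - wL)"
      and e3: "vR = vm - V * (wR - wm')" and e4: "wR * (k3 P - V\<^sup>2) = wm' * (k1 P - V\<^sup>2)"
      using rh V unfolding contact_H1[OF LR(1) H] phase_boundary_H1_H3[OF H LR(2)]
      by (auto simp: um)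
    have pos: "0 < c\<^sub>1 + V" "0 < c\<^sub>1 - V" "0 < c\<^sub>1 + c\<^sub>3" using V cs by auto
    have s1: "(c\<^sub>1 + V) * wm' = (c\<^sub>1 + c\<^sub>3) * h + (V - c\<^sub>3) * wR"
      using e1 e3 hh by algebra
    have "(c\<^sub>1 - V) * ((c\<^sub>1 + V) * wm') = (c\<^sub>3 - V) * (c\<^sub>3 + V) * wR"
      using e4 unfolding k1_eq k3_eq by algebra
    then have "(c\<^sub>1 + c\<^sub>3) * (V * (wR - h)) = (c\<^sub>1 + c\<^sub>3) * (c\<^sub>3 * wR - c\<^sub>1 * h)"
      unfolding s1 by algebra
    then have V': "V * (wR - h) = c\<^sub>3 * wR - c\<^sub>1 * h" using pos by simp
    then have V_eq: "V = a2_speed h wR"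
      using wRh by (simp add: a2_speed_def nonzero_eq_divide_eq)
    have "(c\<^sub>1 + V) * wm' = (c\<^sub>3 + V) * h"
      using s1 V' by algebra
    then have "wm' = w_minus h V"
      using pos by (simp add: w_minus_def field_simps)
    then show ?R using e1 by (simp add: F um V_eq)
  next
    assume F: ?R
    define V where "V = a2_speed h wR"
    have V: "c\<^sub>3 \<le> V" "V < c\<^sub>1" using a2_speed[OF hneg wR] by (auto simp: V_def)
    have V': "V * (wR - h) = c\<^sub>3 * wR - c\<^sub>1 * h"
      using wRh by (simp add: V_def a2_speed_def)
    have w: "(c\<^sub>1 + V) * w_minus h V = (c\<^sub>3 + V) * h"
      using w_minus_eq V cs by auto
    have pos: "0 < c\<^sub>1 + V" "0 < c\<^sub>3 + V" "0 < c\<^sub>1 + c\<^sub>3" using V cs by auto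
    have wle: "w_minus h V \<le> 0"
      unfolding w_minus_def using hneg pos by (intro mult_nonneg_nonpos) auto
    \<comment> \<open>\<open>h_infinity\<close> is the lower root of a quadratic in \<open>h\<close>
      whose positivity between its roots amounts to \<open>w_minus h V > -1\<close>. The upper root
      exceeds every \<open>h \<le> 0\<close>, so \<open>h\<close> lies strictly between the
      two.\<close>
    have wgt: "-1 < w_minus h V"
    proof -
      define R where "R = (c\<^sub>3)\<^sup>2 * wR\<^sup>2 + ((c\<^sub>1)\<^sup>2 + (c\<^sub>3)\<^sup>2) * wR + (c\<^sub>1)\<^sup>2"
      have "0 < R" unfolding R_def using wR cs by (intro add_nonneg_pos add_nonneg_nonneg) auto
      have "c\<^sub>3 * wR - c\<^sub>1 - sqrt R < (c\<^sub>1 + c\<^sub>3) * h"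
        using hinf pos(3) unfolding h_infinity_def R_def by (simp add: pos_divide_less_eq mult.commute)
      then have l: "c\<^sub>3 * wR - c\<^sub>1 - (c\<^sub>1 + c\<^sub>3) * h < sqrt R" by linarith
      have "(c\<^sub>3 * wR)\<^sup>2 < R"
        unfolding R_def using wR cs by (simp add: power_mult_distrib add_nonneg_pos)
      then have "c\<^sub>3 * wR < sqrt R" using real_less_rsqrt by blast
      moreover have "c\<^sub>1 * h \<le> 0" "c\<^sub>3 * h \<le> 0" using hneg cs by (auto simp: mult_le_0_iff)
      moreover have "- sqrt R < c\<^sub>3 * wR - c\<^sub>1 - (c\<^sub>1 + c\<^sub>3) * h"
      proof -
        have "c\<^sub>1\<^sup>2 < R" unfolding R_def using wR cs by (simp add: add_pos_pos)
        then have "c\<^sub>1 < sqrt R" using real_less_rsqrt by blast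
        moreover have "0 < c\<^sub>3 * wR" using wR cs by simp
        ultimately show ?thesis
          using \<open>c\<^sub>1 * h \<le> 0\<close> \<open>c\<^sub>3 * h \<le> 0\<close> by (simp add: distrib_right)
      qed
      ultimately have "\<bar>c\<^sub>3 * wR - c\<^sub>1 - (c\<^sub>1 + c\<^sub>3) * h\<bar> < sqrt R"
        using l by linarith
      from power_strict_mono[OF this abs_ge_zero, of 2]
      have "(c\<^sub>3 * wR - c\<^sub>1 - (c\<^sub>1 + c\<^sub>3) * h)\<^sup>2 < R"
        using \<open>0 < R\<close> by simp
      then have "0 < (c\<^sub>1 + c\<^sub>3) * (h * (2 * c\<^sub>3 * wR - (c\<^sub>1 + c\<^sub>3) * h) + (c\<^sub>1 + c\<^sub>3) * wR - 2 * c\<^sub>1 * h)"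
        unfolding R_def by (simp add: power2_eq_square algebra_simps)
      then have "0 < h * (2 * c\<^sub>3 * wR - (c\<^sub>1 + c\<^sub>3) * h) + (c\<^sub>1 + c\<^sub>3) * wR - 2 * c\<^sub>1 * h"
        using pos(3) by (simp add: zero_less_mult_iff)
      also have "\<dots> = (wR - h) * ((c\<^sub>3 + V) * h + (c\<^sub>1 + V))"
        using V' by algebra
      finally have "0 < (c\<^sub>3 + V) * h + (c\<^sub>1 + V)"
        using wRh by (simp add: zero_less_mult_iff)
      then have "0 < (c\<^sub>1 + V) * (w_minus h V + 1)" using w by (simp add: distrib_left)
      then show ?thesis using pos(1) by (simp add: zero_less_mult_iff)
    qed
    define um where "um = (vL + c\<^sub>1 * (w_minus h V - wL), w_minus h V)"
    have H: "um \<in> H1 P" using wle wgt wM_pos by (simp add: um_def mem_H1)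
    have "vR = vL + c\<^sub>1 * (w_minus h V - wL) - V * (wR - w_minus h V)"
      using w V' hh by algebra
    moreover have "wR * (k3 P - V\<^sup>2) = w_minus h V * (k1 P - V\<^sup>2)"
      unfolding k1_eq k3_eq using w V' by algebra
    \<comment> \<open>The kinetic relation concerns only the sonic speed
      \<open>V = c\<^sub>3\<close>. This forces \<open>h = 0\<close>, where the product of the
      strains vanishes, just as \<open>strain_product\<close> does at
      \<open>c\<^sub>3\<close>.\<close>
    moreover have "adm V (w_minus h V * wR)" if "\<bar>V\<bar> \<le> c\<^sub>3"
    proof -
      have Vc: "V = c\<^sub>3" using that V by auto
      have "(c\<^sub>1 - c\<^sub>3) * h = 0" using V' unfolding Vc by (simp add: algebra_simps)
      then have "h = 0" using cs by simp
      then show ?thesis using Vc cs by (simp add: w_minus_def adm_nonzero strain_product_c3)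
    qed
    ultimately show ?L
      using d H V unfolding F V_def[symmetric] um_def[symmetric] is_riemann_fan.simps
        contact_H1[OF LR(1) H] phase_boundary_H1_H3[OF H LR(2)]
      by (auto simp: um_def)
  }
qed

section \<open>The fans of case b\<close>

lemma is_riemann_fan_b1:
  assumes d: "((vL, wL), (vR, wR)) \<in> data_b1 P" and h: "h = h_b P ((vL, wL), (vR, wR))"
  shows "is_riemann_fan P ((vL, wL), (vR, wR)) F \<longleftrightarrow> F = Fan_b1 (vL + c\<^sub>1 * (h - wL), h)"
    (is "?L \<longleftrightarrow> ?R")
proof
  note cs = c1_pos
  have hb: "-1 < h" "h \<le> wM P" and LR: "(vL, wL) \<in> H1 P" "(vR, wR) \<in> H1 P"
    using d h by (auto simp: data_b1_def)
  have hh: "2 * c\<^sub>1 * h = c\<^sub>1 * wL + c\<^sub>1 * wR + vR - vL"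
    using cs by (simp add: h h_b_def field_simps)
  have no: "((vL, wL), (vR, wR)) \<notin> data_a1 P" "((vL, wL), (vR, wR)) \<notin> data_a2 P" "((vL, wL), (vR, wR)) \<notin> data_b2 P"
    using hb LR H1_H3_disjoint unfolding h data_a1_def data_a2_def data_b2_def by auto
  {
    assume ?L
    then obtain us where F: "F = Fan_b1 us"
      using no by (cases F) auto
    obtain v w where us: "us = (v, w)" by fastforce
    from \<open>?L\<close>[unfolded F] have H: "us \<in> H1 P"
      and rh: "rankine_hugoniot P (- c\<^sub>1) (vL, wL) us" "rankine_hugoniot P c\<^sub>1 us (vR, wR)"
      by auto
    have e: "v = vL + c\<^sub>1 * (w - wL)" "vR = v - c\<^sub>1 * (wR - w)"
      using rh unfolding contact_H1[OF LR(1) H] contact_H1[OF H LR(2)] by (auto simp: us)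
    have "(2 * c\<^sub>1) * w = (2 * c\<^sub>1) * h" using e hh by algebra
    then have "w = h" using cs by simp
    then show ?R using e by (simp add: F us)
  next
    assume F: ?R
    have H: "(vL + c\<^sub>1 * (h - wL), h) \<in> H1 P" using hb by (simp add: mem_H1)
    have "vR = vL + c\<^sub>1 * (h - wL) - c\<^sub>1 * (wR - h)" using hh by algebra
    then show ?L
      using d H unfolding F is_riemann_fan.simps contact_H1[OF LR(1) H] contact_H1[OF H LR(2)]
      by auto
  }
qed

definition b2_w1 :: "real \<Rightarrow> real \<Rightarrow> real" where
  "b2_w1 h V = b2_w2 h V * (k3 P - V\<^sup>2) / (k1 P - V\<^sup>2)"

lemma b2_strains:
  assumes "0 < h" "b2_speed h V"
  shows "0 < b2_w1 h V" "b2_w1 h V \<le> wM P" "wm P \<le> b2_w2 h V"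
    "b2_w2 h V * (k3 P - V\<^sup>2) = b2_w1 h V * (k1 P - V\<^sup>2)"
    "adm (- V) (b2_w1 h V * b2_w2 h V)"
    "c\<^sub>1 * h = c\<^sub>1 * b2_w1 h V + V * (b2_w2 h V - b2_w1 h V)"
proof -
  note cs = c3_pos c3_less_c1 c1_pos k3_pos
  obtain y where y: "adm (- V) y" "(b2_w2 h V)\<^sup>2 * (k3 P - V\<^sup>2) = y * (k1 P - V\<^sup>2)"
    "wm P \<le> b2_w2 h V" "b2_w2 h V * ((k3 P + c\<^sub>1 * V) / (c\<^sub>1 * (c\<^sub>1 + V))) = h"
    using b2_w2[OF assms] by blast
  have V: "0 < V" "V < c\<^sub>3" using assms by (auto simp: b2_speed_def)
  have k1V: "0 < k1 P - V\<^sup>2" using k1_minus_pos[of V] V by simp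
  show e: "b2_w2 h V * (k3 P - V\<^sup>2) = b2_w1 h V * (k1 P - V\<^sup>2)"
    using k1V by (simp add: b2_w1_def)
  have "(k1 P - V\<^sup>2) * (b2_w1 h V * b2_w2 h V) = (k1 P - V\<^sup>2) * y"
    using e y(2) by algebra
  then have p: "b2_w1 h V * b2_w2 h V = y" using k1V by simp
  then show "adm (- V) (b2_w1 h V * b2_w2 h V)" using y by simp
  show "0 < b2_w1 h V" "b2_w1 h V \<le> wM P" "wm P \<le> b2_w2 h V"
    using strain_pair[OF _ y(1) p] e V y(3) wm_pos by auto
  have "0 < k3 P + c\<^sub>1 * V" using V cs by (intro add_pos_pos) auto
  then have h: "h * (c\<^sub>1 * (c\<^sub>1 + V)) = b2_w2 h V * (k3 P + c\<^sub>1 * V)"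
    by (simp add: b2_w2_def)
  have "(c\<^sub>1 - V) * ((c\<^sub>1 + V) * (c\<^sub>1 * h)) = (c\<^sub>1 - V) * ((c\<^sub>1 + V) * (c\<^sub>1 * b2_w1 h V + V * (b2_w2 h V - b2_w1 h V)))"
    using h e unfolding k1_eq by algebra
  then show "c\<^sub>1 * h = c\<^sub>1 * b2_w1 h V + V * (b2_w2 h V - b2_w1 h V)"
    using V cs by simp
qed

lemma is_riemann_fan_b2:
  assumes d: "((vL, wL), (vR, wR)) \<in> data_b2 P" and h: "h = h_b P ((vL, wL), (vR, wR))"
  shows "is_riemann_fan P ((vL, wL), (vR, wR)) F \<longleftrightarrow> (\<exists>V. b2_speed h V \<and>
    F = Fan_b2 (vL + c\<^sub>1 * (b2_w1 h V - wL), b2_w1 h V)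
      (vL + c\<^sub>1 * (b2_w1 h V - wL) + V * (b2_w2 h V - b2_w1 h V), b2_w2 h V)
      (vR + c\<^sub>1 * (wR - b2_w1 h V), b2_w1 h V) (- V) V)"
    (is "?L \<longleftrightarrow> ?R")
proof
  note cs = c3_pos c3_less_c1 c1_pos k3_pos k3_less_k1
  have hb: "wM P < h" and LR: "(vL, wL) \<in> H1 P" "(vR, wR) \<in> H1 P"
    using d h by (auto simp: data_b2_def)
  have hpos: "0 < h" using hb wM_pos by linarith
  have hh: "2 * c\<^sub>1 * h = c\<^sub>1 * wL + c\<^sub>1 * wR + vR - vL"
    using cs by (simp add: h h_b_def field_simps)
  have no: "((vL, wL), (vR, wR)) \<notin> data_a1 P" "((vL, wL), (vR, wR)) \<notin> data_a2 P" "((vL, wL), (vR, wR)) \<notin> data_b1 P"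
    using hb LR H1_H3_disjoint unfolding h data_a1_def data_a2_def data_b1_def by auto
  {
    assume ?L
    then obtain u1 u2 u3 V' V where F: "F = Fan_b2 u1 u2 u3 V' V"
      using no by (cases F) auto
    obtain v1 w1 where u1: "u1 = (v1, w1)" by fastforce
    obtain v2 w2 where u2: "u2 = (v2, w2)" by fastforce
    obtain v3 w3 where u3: "u3 = (v3, w3)" by fastforce
    from \<open>?L\<close>[unfolded F] have H: "u1 \<in> H1 P" "u2 \<in> H3 P" "u3 \<in> H1 P"
      and V: "- c\<^sub>3 < V'" "V' < 0" "0 < V" "V < c\<^sub>3"
      and rh: "rankine_hugoniot P (- c\<^sub>1) (vL, wL) u1" "phase_boundary P V' u1 u2"
        "phase_boundary P V u2 u3" "rankine_hugoniot P c\<^sub>1 u3 (vR, wR)"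
      by auto
    have e: "v1 = vL + c\<^sub>1 * (w1 - wL)" "v2 = v1 - V' * (w2 - w1)" "v3 = v2 - V * (w3 - w2)"
      "vR = v3 - c\<^sub>1 * (wR - w3)"
      and w: "w2 * (k3 P - V'\<^sup>2) = w1 * (k1 P - V'\<^sup>2)" "w2 * (k3 P - V\<^sup>2) = w3 * (k1 P - V\<^sup>2)"
      and adm: "adm V' (w1 * w2)" "adm (- V) (w2 * w3)"
      using rh V unfolding contact_H1[OF LR(1) H(1)] contact_H1[OF H(3) LR(2)]
        phase_boundary_H1_H3[OF H(1,2)] phase_boundary_H3_H1[OF H(2,3)]
      by (auto simp: u1 u2 u3)
    have w2: "0 < w2" using H wm_pos by (simp add: u2 mem_H3)
    have kpos: "0 < k3 P - V\<^sup>2" "0 < k3 P - V'\<^sup>2" "0 < k1 P - V\<^sup>2" "0 < k1 P - V'\<^sup>2"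
      using V k3_minus_pos k1_minus_pos by auto
    have w13: "w1 = w2 * (1 - (k1 P - k3 P) / (k1 P - V'\<^sup>2))" "w3 = w2 * (1 - (k1 P - k3 P) / (k1 P - V\<^sup>2))"
      using square_ratio[OF w(1)[symmetric] kpos(4)] square_ratio[OF w(2)[symmetric] kpos(3)]
      by (simp_all add: diff_divide_distrib)
    have mono: "w2 * (1 - (k1 P - k3 P) / (k1 P - y\<^sup>2)) < w2 * (1 - (k1 P - k3 P) / (k1 P - x\<^sup>2))"
      if "x\<^sup>2 < y\<^sup>2" "0 < k1 P - y\<^sup>2" for x y :: real
      using that w2 k3_less_k1 by (intro mult_strict_left_mono diff_strict_left_mono divide_strict_left_mono) auto
    \<comment> \<open>Two monotonicities compete. The jump relation makes the outer strain decrease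
      strictly with the square of the adjacent speed, whereas the kinetic relation, with the common
      middle strain \<open>w2\<close>, makes it nondecreasing in the modulus of that speed. Hence
      the moduli agree.\<close>
    have "V' = - V"
    proof (rule ccontr)
      assume "V' \<noteq> - V"
      then consider "V' < - V" | "- V < V'" by linarith
      then show False
      proof cases
        case 1
        then have "w2 * w3 \<le> w1 * w2"
          using adm_antimono[of V' "- V"] V adm by auto
        then have "w3 \<le> w1" using w2 by (simp add: mult.commute)
        moreover have "V\<^sup>2 < V'\<^sup>2" using 1 V abs_le_square_iff[of V' V] by auto
        then have "w1 < w3" unfolding w13 using mono kpos by blast
        ultimately show False by simp
      next
        case 2
        then have "w1 * w2 \<le> w2 * w3"
          using adm_antimono[of "- V" V'] V adm by auto
        then have "w1 \<le> w3" using w2 by (simp add: mult.commute)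
        moreover have "V'\<^sup>2 < V\<^sup>2" using 2 V abs_le_square_iff[of V V'] by auto
        then have "w3 < w1" unfolding w13 using mono kpos by blast
        ultimately show False by simp
      qed
    qed
    then have w3: "w3 = w1" using w13 by simp
    note V' = \<open>V' = - V\<close>
    have "2 * (c\<^sub>1 * h) = 2 * (c\<^sub>1 * w1 + V * (w2 - w1))"
      using e hh unfolding w3 V' by algebra
    then have ch: "c\<^sub>1 * h = c\<^sub>1 * w1 + V * (w2 - w1)" by simp
    have "c\<^sub>1 - V \<noteq> 0" using V cs by simp
    moreover have "(c\<^sub>1 - V) * (w2 * (k3 P + c\<^sub>1 * V)) = (c\<^sub>1 - V) * (h * (c\<^sub>1 * (c\<^sub>1 + V)))"
      using ch w(2) unfolding w3 k1_eq by algebra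
    ultimately have hw: "w2 * (k3 P + c\<^sub>1 * V) = h * (c\<^sub>1 * (c\<^sub>1 + V))" by simp
    have "0 < k3 P + c\<^sub>1 * V" using V cs by (intro add_pos_pos) auto
    then have w2_eq: "w2 = b2_w2 h V"
      using hw by (simp add: b2_w2_def nonzero_eq_divide_eq)
    have w1_eq: "w1 = b2_w1 h V"
      using w(2) kpos by (simp add: b2_w1_def w2_eq[symmetric] w3 nonzero_eq_divide_eq)
    have "(c\<^sub>1 + V) * (h\<^sup>2 * (k1 P * (c\<^sub>1 + V) * (k3 P - V\<^sup>2))) =
      (c\<^sub>1 + V) * ((w2 * w1) * ((c\<^sub>1 - V) * (k3 P + c\<^sub>1 * V)\<^sup>2))"
      using hw w(2) unfolding w3 k1_eq by algebra
    moreover have "c\<^sub>1 + V \<noteq> 0" using V cs by simp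
    ultimately have "h\<^sup>2 * (k1 P * (c\<^sub>1 + V) * (k3 P - V\<^sup>2)) = (w2 * w1) * ((c\<^sub>1 - V) * (k3 P + c\<^sub>1 * V)\<^sup>2)"
      by simp
    then have "b2_speed h V" unfolding b2_speed_def using V adm(2) w3 by blast
    moreover have "F = Fan_b2 (vL + c\<^sub>1 * (w1 - wL), w1) (vL + c\<^sub>1 * (w1 - wL) + V * (w2 - w1), w2)
      (vR + c\<^sub>1 * (wR - w1), w1) (- V) V"
      using e by (simp add: F u1 u2 u3 w3 V')
    ultimately show ?R unfolding w1_eq w2_eq by blast
  next
    assume ?R
    then obtain V where b: "b2_speed h V" and F: "F = Fan_b2 (vL + c\<^sub>1 * (b2_w1 h V - wL), b2_w1 h V)
      (vL + c\<^sub>1 * (b2_w1 h V - wL) + V * (b2_w2 h V - b2_w1 h V), b2_w2 h V)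
      (vR + c\<^sub>1 * (wR - b2_w1 h V), b2_w1 h V) (- V) V"
      by auto
    have V: "0 < V" "V < c\<^sub>3" using b by (auto simp: b2_speed_def)
    note st = b2_strains[OF hpos b]
    define u1 where "u1 = (vL + c\<^sub>1 * (b2_w1 h V - wL), b2_w1 h V)"
    define u2 where "u2 = (vL + c\<^sub>1 * (b2_w1 h V - wL) + V * (b2_w2 h V - b2_w1 h V), b2_w2 h V)"
    define u3 where "u3 = (vR + c\<^sub>1 * (wR - b2_w1 h V), b2_w1 h V)"
    have H: "u1 \<in> H1 P" "u2 \<in> H3 P" "u3 \<in> H1 P"
      using st by (auto simp: u1_def u2_def u3_def mem_H1 mem_H3)
    have "vR + c\<^sub>1 * (wR - b2_w1 h V) = vL + c\<^sub>1 * (b2_w1 h V - wL) + V * (b2_w2 h V - b2_w1 h V) - V * (b2_w1 h V - b2_w2 h V)"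
      using st(6) hh by algebra
    then show ?L
      using d H V st(4,5) unfolding F u1_def[symmetric] u2_def[symmetric] u3_def[symmetric] is_riemann_fan.simps
        contact_H1[OF LR(1) H(1)] contact_H1[OF H(3) LR(2)]
        phase_boundary_H1_H3[OF H(1,2)] phase_boundary_H3_H1[OF H(2,3)]
      by (auto simp: u1_def u2_def u3_def mult.commute)
  }
qed

section \<open>Lipschitz dependence on the data\<close>

text \<open>Since \<open>strain_product\<close> vanishes at \<open>c\<^sub>3\<close>, the numerator
  in the derivative of the quotient is, up to sign, a first-order Taylor remainder. A bound
  \<open>M\<close> for the second derivative makes it at most
  \<open>M * (c\<^sub>3 - V)\<^sup>2\<close>, which cancels the denominator. Starting at
  \<open>c\<^sub>3 / 2\<close> keeps the interval away from the possible jump at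
  \<open>0\<close>.\<close>

lemma strain_quotient_lips: "lips {c\<^sub>3 / 2..<c\<^sub>3} (\<lambda>V. strain_product V / (c\<^sub>3 - V))"
proof -
  define S where "S = {- c\<^sub>3<..<0} \<union> {0<..c\<^sub>3}"
  obtain f1 f2 where f1: "\<And>V. V \<in> S \<Longrightarrow> (phi P has_real_derivative f1 V) (at V within S)"
    and f2: "\<And>V. V \<in> S \<Longrightarrow> (f1 has_real_derivative f2 V) (at V within S)"
    and cont: "continuous_on S f2"
    using phi_derivatives unfolding S_def by blast
  have sub: "{c\<^sub>3 / 2..c\<^sub>3} \<subseteq> S" using c3_pos by (auto simp: S_def)
  define m where "m = - 2 / (k1 P - k3 P)"
  define r1 where "r1 = (\<lambda>V. m * f1 V)"
  have r: "(strain_product has_real_derivative r1 V) (at V within {c\<^sub>3 / 2..c\<^sub>3})" if "V \<in> {c\<^sub>3 / 2..c\<^sub>3}" for V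
  proof -
    have "strain_product = (\<lambda>V. wM P * wm P + m * phi P V)"
      by (auto simp: strain_product_def m_def)
    moreover have "((\<lambda>V. wM P * wm P + m * phi P V) has_real_derivative m * f1 V) (at V within {c\<^sub>3 / 2..c\<^sub>3})"
      using DERIV_subset[OF f1[of V] sub] that sub by (auto intro!: derivative_eq_intros)
    ultimately show ?thesis by (simp add: r1_def)
  qed
  have r1: "(r1 has_real_derivative m * f2 V) (at V within {c\<^sub>3 / 2..c\<^sub>3})" if "V \<in> {c\<^sub>3 / 2..c\<^sub>3}" for V
    unfolding r1_def using DERIV_subset[OF f2[of V] sub] that sub by (auto intro!: derivative_eq_intros)
  have "compact (f2 ` {c\<^sub>3 / 2..c\<^sub>3})"
    by (rule compact_continuous_image[OF continuous_on_subset[OF cont sub]]) simp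
  then obtain B where B: "0 < B" "\<And>V. V \<in> {c\<^sub>3 / 2..c\<^sub>3} \<Longrightarrow> norm (f2 V) \<le> B"
    using compact_imp_bounded bounded_pos by (metis imageI)
  define M where "M = \<bar>m\<bar> * B"
  have M: "0 \<le> M" using B by (simp add: M_def)
  have r1_lip: "\<bar>r1 x - r1 y\<bar> \<le> M * \<bar>x - y\<bar>" if "x \<in> {c\<^sub>3 / 2..c\<^sub>3}" "y \<in> {c\<^sub>3 / 2..c\<^sub>3}" for x y
  proof -
    have "norm (m * f2 V) \<le> M" if "V \<in> {c\<^sub>3 / 2..c\<^sub>3}" for V
      using mult_left_mono[OF B(2)[OF that], of "\<bar>m\<bar>"] by (simp add: M_def abs_mult)
    then show ?thesis
      using field_differentiable_bound[of "{c\<^sub>3 / 2..c\<^sub>3}" r1 "\<lambda>V. m * f2 V" M x y] r1 that by simp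
  qed
  have taylor: "\<bar>strain_product V + r1 V * (c\<^sub>3 - V)\<bar> \<le> M * (c\<^sub>3 - V) * (c\<^sub>3 - V)"
    if V: "V \<in> {c\<^sub>3 / 2..<c\<^sub>3}" for V
  proof -
    have "norm ((strain_product V - r1 V * V) - (strain_product c\<^sub>3 - r1 V * c\<^sub>3)) \<le> M * (c\<^sub>3 - V) * norm (V - c\<^sub>3)"
    proof (rule field_differentiable_bound[of "{V..c\<^sub>3}" "\<lambda>z. strain_product z - r1 V * z" "\<lambda>z. r1 z - r1 V"])
      fix z assume z: "z \<in> {V..c\<^sub>3}"
      have "(strain_product has_real_derivative r1 z) (at z within {V..c\<^sub>3})"
        by (rule DERIV_subset[OF r]) (use z V in auto)
      then show "((\<lambda>z. strain_product z - r1 V * z) has_real_derivative r1 z - r1 V) (at z within {V..c\<^sub>3})"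
        by (auto intro!: derivative_eq_intros)
      have "\<bar>r1 z - r1 V\<bar> \<le> M * \<bar>z - V\<bar>" using r1_lip[of z V] z V by simp
      also have "\<dots> \<le> M * (c\<^sub>3 - V)" using z M by (intro mult_left_mono) auto
      finally show "norm (r1 z - r1 V) \<le> M * (c\<^sub>3 - V)" by simp
    qed (use V in auto)
    moreover have "(strain_product V - r1 V * V) - (strain_product c\<^sub>3 - r1 V * c\<^sub>3) = strain_product V + r1 V * (c\<^sub>3 - V)"
      by (simp add: strain_product_c3 algebra_simps)
    ultimately show ?thesis using V by simp
  qed
  show ?thesis
  proof (rule lipsI[of _ _ M])
    fix x y assume xy: "x \<in> {c\<^sub>3 / 2..<c\<^sub>3}" "y \<in> {c\<^sub>3 / 2..<c\<^sub>3}"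
    have "norm (strain_product x / (c\<^sub>3 - x) - strain_product y / (c\<^sub>3 - y)) \<le> M * norm (x - y)"
    proof (rule field_differentiable_bound[of "{c\<^sub>3 / 2..<c\<^sub>3}" _ "\<lambda>V. (strain_product V + r1 V * (c\<^sub>3 - V)) / ((c\<^sub>3 - V) * (c\<^sub>3 - V))"])
      fix V assume V: "V \<in> {c\<^sub>3 / 2..<c\<^sub>3}"
      have "(strain_product has_real_derivative r1 V) (at V within {c\<^sub>3 / 2..<c\<^sub>3})"
        by (rule DERIV_subset[OF r]) (use V in auto)
      then show "((\<lambda>V. strain_product V / (c\<^sub>3 - V)) has_real_derivative
          (strain_product V + r1 V * (c\<^sub>3 - V)) / ((c\<^sub>3 - V) * (c\<^sub>3 - V))) (at V within {c\<^sub>3 / 2..<c\<^sub>3})"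
        using V by (auto intro!: derivative_eq_intros)
      show "norm ((strain_product V + r1 V * (c\<^sub>3 - V)) / ((c\<^sub>3 - V) * (c\<^sub>3 - V))) \<le> M"
        using taylor[OF V] V by (simp add: abs_mult pos_divide_le_eq mult.assoc)
    qed (use xy in auto)
    then show "dist (strain_product x / (c\<^sub>3 - x)) (strain_product y / (c\<^sub>3 - y)) \<le> M * dist x y"
      by (simp add: dist_real_def)
  qed
qed

section \<open>The speeds as functions of \<open>h\<close>, and the strain
  \<open>w_plus\<close>\<close>

definition a1V :: "real \<Rightarrow> real" where
  "a1V h = (THE V. a1_speed h V)"

definition b2V :: "real \<Rightarrow> real" where
  "b2V h = (THE V. b2_speed h V)"

lemma a1_speed_iff: "0 < h \<Longrightarrow> a1_speed h V \<longleftrightarrow> V = a1V h"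
  unfolding a1V_def by (metis a1_speed_exists a1_speed_unique theI)

lemma a1V: "0 < h \<Longrightarrow> a1_speed h (a1V h)"
  by (simp add: a1_speed_iff)

lemma b2_speed_iff: "wM P < h \<Longrightarrow> b2_speed h V \<longleftrightarrow> V = b2V h"
  unfolding b2V_def using wM_pos by (metis b2_speed_exists b2_speed_unique theI less_trans)

lemma b2V: "wM P < h \<Longrightarrow> b2_speed h (b2V h)"
  by (simp add: b2_speed_iff)

lemma abs_a1V: "0 < h \<Longrightarrow> \<bar>a1V h\<bar> < c\<^sub>3"
  using a1V[of h] by (simp add: a1_speed_def)

lemma a1V_lips: "lips {0<..} a1V"
proof (rule a1_speed_lipschitz)
  fix K :: real
  assume K: "0 < K" "\<And>h1 h2 V1 V2. \<lbrakk>0 < h1; 0 < h2; a1_speed h1 V1; a1_speed h2 V2\<rbrakk>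
    \<Longrightarrow> \<bar>V1 - V2\<bar> \<le> K * \<bar>h1 - h2\<bar>"
  show ?thesis
    by (rule lipsI[of _ _ K]) (use K(2) a1V in \<open>auto simp: dist_real_def\<close>)
qed

lemma b2V_lips: "lips {wM P<..} b2V"
proof (rule lipsI[of _ _ b2_const])
  fix h1 h2 assume h: "h1 \<in> {wM P<..}" "h2 \<in> {wM P<..}"
  then have "0 < h1" "0 < h2" using wM_pos by auto
  then show "dist (b2V h1) (b2V h2) \<le> b2_const * dist h1 h2"
    unfolding dist_real_def using h by (intro b2_speed_lipschitz b2V) auto
qed

text \<open>Multiplying the jump relation by \<open>w_plus h V\<close> isolates the singular
  quotient to which \<open>strain_quotient_lips\<close> applies.\<close>

lemma w_plus_square:
  assumes "0 < h" "a1_speed h V" "V \<noteq> 0"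
  shows "(w_plus h V)\<^sup>2 = strain_product V / (c\<^sub>3 - V) * ((k1 P - V\<^sup>2) / (c\<^sub>3 + V))"
proof -
  have V: "\<bar>V\<bar> < c\<^sub>3" using assms by (simp add: a1_speed_def)
  have y: "w_minus h V * w_plus h V = strain_product V"
    using a1_strains(1)[OF assms(1,2)] assms(3) by (simp add: adm_nonzero)
  have "(w_plus h V)\<^sup>2 * ((c\<^sub>3 - V) * (c\<^sub>3 + V)) = w_plus h V * (w_plus h V * (k3 P - V\<^sup>2))"
    unfolding k3_eq by algebra
  also have "\<dots> = strain_product V * (k1 P - V\<^sup>2)"
    unfolding a1_strains(5)[OF assms(1,2)] y[symmetric] by simp
  finally have *: "(w_plus h V)\<^sup>2 * ((c\<^sub>3 - V) * (c\<^sub>3 + V)) = strain_product V * (k1 P - V\<^sup>2)" .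
  have "c\<^sub>3 - V \<noteq> 0" "c\<^sub>3 + V \<noteq> 0" using V by auto
  then show ?thesis
    using * by (simp add: nonzero_eq_divide_eq)
qed

text \<open>On \<open>A\<close> the defining formula has a denominator of at least
  \<open>c\<^sub>3 / 4\<close>; on \<open>B\<close> the square is Lipschitz and its root is at least
  \<open>wm P\<close>. The two ranges of speeds overlap, so points outside the overlap on opposite
  sides have speeds at least \<open>c\<^sub>3 / 4\<close> apart. As \<open>a1V\<close> is Lipschitz,
  their arguments are separated as well.\<close>

lemma w_plus_lips: "lips {0<..H} (\<lambda>h. w_plus h (a1V h))"
proof -
  define A where "A = {h \<in> {0<..H}. a1V h \<le> 3 / 4 * c\<^sub>3}"
  define B where "B = {h \<in> {0<..H}. c\<^sub>3 / 2 \<le> a1V h}"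
  have AB: "{0<..H} = A \<union> B" using c3_pos by (auto simp: A_def B_def)
  have bdH: "bounded {0<..H}" by simp
  have bd: "bounded A" "bounded B"
    by (rule bounded_subset[OF bdH], force simp: A_def B_def)+
  have V: "lips A a1V" "lips B a1V"
    by (rule lips_subset[OF a1V_lips], force simp: A_def B_def)+
  have "lips A (\<lambda>h. (c\<^sub>1 - a1V h) / (c\<^sub>3 - a1V h) * h)"
    by (intro lips_mult lips_divide[of _ _ _ "c\<^sub>3 / 4"] lips_diff lips_const lips_ident bd V)
       (use c3_pos in \<open>auto simp: A_def\<close>)
  then have lA: "lips A (\<lambda>h. w_plus h (a1V h))"
    by (simp add: w_plus_def)
  have pos: "0 < h" "a1_speed h (a1V h)" "\<bar>a1V h\<bar> < c\<^sub>3" if "h \<in> {0<..H}" for h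
    using that a1V abs_a1V by auto
  have lB: "lips B (\<lambda>h. w_plus h (a1V h))"
  proof (rule lips_of_square[of _ _ "wm P"])
    have "lips B (\<lambda>h. strain_product (a1V h) / (c\<^sub>3 - a1V h))"
      by (rule lips_compose[OF strain_quotient_lips V(2)]) (use pos(3) in \<open>force simp: B_def\<close>)
    moreover have "lips B (\<lambda>h. (k1 P - (a1V h)\<^sup>2) / (c\<^sub>3 + a1V h))"
      by (intro lips_divide[of _ _ _ "c\<^sub>3"] lips_diff lips_add lips_power2 lips_const bd V)
         (use c3_pos in \<open>auto simp: B_def\<close>)
    ultimately have "lips B (\<lambda>h. strain_product (a1V h) / (c\<^sub>3 - a1V h) * ((k1 P - (a1V h)\<^sup>2) / (c\<^sub>3 + a1V h)))"
      by (intro lips_mult bd)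
    then show "lips B (\<lambda>h. (w_plus h (a1V h))\<^sup>2)"
    proof (rule lips_cong)
      fix h assume "h \<in> B"
      then show "(w_plus h (a1V h))\<^sup>2 = strain_product (a1V h) / (c\<^sub>3 - a1V h) * ((k1 P - (a1V h)\<^sup>2) / (c\<^sub>3 + a1V h))"
        using w_plus_square[OF pos(1,2)] c3_pos by (auto simp: B_def)
    qed
  qed (use wm_pos a1_strains(4)[OF pos(1,2)] in \<open>auto simp: B_def\<close>)
  obtain L where L: "0 \<le> L" "\<And>x y. x \<in> {0<..} \<Longrightarrow> y \<in> {0<..} \<Longrightarrow> dist (a1V x) (a1V y) \<le> L * dist x y"
    using lipsE[OF a1V_lips] by blast
  show ?thesis
    unfolding AB
  proof (rule lips_Un_separated[OF lA lB bd, of "c\<^sub>3 / 4 / (L + 1)"])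
    fix x y assume xy: "x \<in> A" "y \<in> B" "x \<notin> B" "y \<notin> A"
    then have "c\<^sub>3 / 4 \<le> dist (a1V x) (a1V y)"
      by (auto simp: A_def B_def dist_real_def)
    also have "\<dots> \<le> L * dist x y" using xy L(2) by (auto simp: A_def B_def)
    also have "\<dots> \<le> dist x y * (L + 1)" by (simp add: algebra_simps)
    finally show "c\<^sub>3 / 4 / (L + 1) \<le> dist x y"
      by (rule pos_divide_le_eq[THEN iffD2, rotated]) (use L(1) in linarith)
  qed (use c3_pos L in auto)
qed

section \<open>Speeds, strains and states as functions of the data\<close>

definition aV :: "riemann_data \<Rightarrow> real" where
  "aV d = (if 0 < h_a P d then a1V (h_a P d) else a2_speed (h_a P d) (snd (snd d)))"

text \<open>
  With the value \<open>0\<close> in case b1, the formulas of case b2 for the states \<open>u_1\<close> and \<open>u_3\<close> cover case b1.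
\<close>

definition bV :: "riemann_data \<Rightarrow> real" where
  "bV d = (if wM P < h_b P d then b2V (h_b P d) else 0)"

definition aW_minus :: "riemann_data \<Rightarrow> real" where
  "aW_minus d = w_minus (h_a P d) (aV d)"

definition aW_plus :: "riemann_data \<Rightarrow> real" where
  "aW_plus d = w_plus (h_a P d) (a1V (h_a P d))"

definition bW1 :: "riemann_data \<Rightarrow> real" where
  "bW1 d = b2_w1 (h_b P d) (bV d)"

definition bW2 :: "riemann_data \<Rightarrow> real" where
  "bW2 d = b2_w2 (h_b P d) (bV d)"

text \<open>The state of strain \<open>w\<close> that a contact of speed \<open>- c\<^sub>1\<close>
  joins to the left datum.\<close>

definition left_state :: "riemann_data \<Rightarrow> real \<Rightarrow> state" where
  "left_state d w = (fst (fst d) + c\<^sub>1 * (w - snd (fst d)), w)"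

text \<open>The state of strain \<open>w\<close> that a contact of speed \<open>c\<close> joins to
  the right datum; \<open>c\<close> is \<open>c\<^sub>3\<close> in case a1 and
  \<open>c\<^sub>1\<close> in case b.\<close>

definition right_state :: "real \<Rightarrow> riemann_data \<Rightarrow> real \<Rightarrow> state" where
  "right_state c d w = (fst (snd d) + c * (snd (snd d) - w), w)"

definition bU2 :: "riemann_data \<Rightarrow> state" where
  "bU2 d = (fst (left_state d (bW1 d)) + bV d * (bW2 d - bW1 d), bW2 d)"

lemma riemann_fan_eqI: "(\<And>F. is_riemann_fan P d F \<longleftrightarrow> F = G) \<Longrightarrow> riemann_fan P d = G"
  by (simp add: riemann_fan_def)

lemma is_riemann_fan_iff_a1:
  assumes "d \<in> data_a1 P"
  shows "is_riemann_fan P d F \<longleftrightarrow>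
    F = Fan_a1 (left_state d (aW_minus d)) (right_state c\<^sub>3 d (aW_plus d)) (aV d)"
proof -
  obtain vL wL vR wR where d: "d = ((vL, wL), (vR, wR))" by (metis surj_pair)
  have "0 < h_a P d" using assms by (auto simp: data_a1_def)
  then show ?thesis
    using is_riemann_fan_a1[OF assms[unfolded d] refl, of F]
    by (simp add: a1_speed_iff d left_state_def right_state_def aW_minus_def aW_plus_def aV_def)
qed

lemma is_riemann_fan_iff_a2:
  assumes "d \<in> data_a2 P"
  shows "is_riemann_fan P d F \<longleftrightarrow> F = Fan_a2 (left_state d (aW_minus d)) (aV d)"
proof -
  obtain vL wL vR wR where d: "d = ((vL, wL), (vR, wR))" by (metis surj_pair)
  have "\<not> 0 < h_a P d" using assms by (auto simp: data_a2_def)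
  then show ?thesis
    using is_riemann_fan_a2[OF assms[unfolded d] refl, of F]
    by (simp add: d left_state_def aW_minus_def aV_def)
qed

lemma b2_w1_0: "b2_w1 h 0 = h"
  using k3_pos k3_less_k1 c1_pos by (simp add: b2_w1_def b2_w2_def k1_eq power2_eq_square)

lemma bW1_b1: "bW1 d = h_b P d" "bV d = 0" if "d \<in> data_b1 P"
  using that by (auto simp: data_b1_def bW1_def bV_def b2_w1_0)

lemma is_riemann_fan_iff_b1:
  assumes "d \<in> data_b1 P"
  shows "is_riemann_fan P d F \<longleftrightarrow> F = Fan_b1 (left_state d (bW1 d))"
proof -
  obtain vL wL vR wR where d: "d = ((vL, wL), (vR, wR))" by (metis surj_pair)
  show ?thesis
    using is_riemann_fan_b1[OF assms[unfolded d] refl, of F] bW1_b1[OF assms]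
    by (simp add: d left_state_def)
qed

text \<open>\<open>h_b P d\<close> is the strain at which the contact lines through the two data
  cross, so reaching the middle state from either side gives the same velocity.\<close>

lemma right_state_b1:
  assumes "d \<in> data_b1 P"
  shows "right_state c\<^sub>1 d (bW1 d) = left_state d (bW1 d)"
proof -
  obtain vL wL vR wR where d: "d = ((vL, wL), (vR, wR))" by (metis surj_pair)
  have "c\<^sub>1 * h_b P d * 2 = c\<^sub>1 * wL + c\<^sub>1 * wR + vR - vL"
    using c1_pos by (simp add: d h_b_def field_simps)
  then show ?thesis
    unfolding bW1_b1[OF assms] by (simp add: d left_state_def right_state_def algebra_simps)
qed

lemma is_riemann_fan_iff_b2:
  assumes "d \<in> data_b2 P"
  shows "is_riemann_fan P d F \<longleftrightarrow>
    F = Fan_b2 (left_state d (bW1 d)) (bU2 d) (right_state c\<^sub>1 d (bW1 d)) (- bV d) (bV d)"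
proof -
  obtain vL wL vR wR where d: "d = ((vL, wL), (vR, wR))" by (metis surj_pair)
  have "wM P < h_b P d" using assms by (auto simp: data_b2_def)
  then show ?thesis
    using is_riemann_fan_b2[OF assms[unfolded d] refl, of F]
    by (simp add: b2_speed_iff d left_state_def right_state_def bW1_def bW2_def bU2_def bV_def)
qed

lemma riemann_fan_a1: "d \<in> data_a1 P \<Longrightarrow>
    riemann_fan P d = Fan_a1 (left_state d (aW_minus d)) (right_state c\<^sub>3 d (aW_plus d)) (aV d)"
  and riemann_fan_a2: "d \<in> data_a2 P \<Longrightarrow>
    riemann_fan P d = Fan_a2 (left_state d (aW_minus d)) (aV d)"
  and riemann_fan_b1: "d \<in> data_b1 P \<Longrightarrow>
    riemann_fan P d = Fan_b1 (left_state d (bW1 d))"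
  and riemann_fan_b2: "d \<in> data_b2 P \<Longrightarrow>
    riemann_fan P d = Fan_b2 (left_state d (bW1 d)) (bU2 d) (right_state c\<^sub>1 d (bW1 d)) (- bV d) (bV d)"
  by (intro riemann_fan_eqI is_riemann_fan_iff_a1 is_riemann_fan_iff_a2 is_riemann_fan_iff_b1 is_riemann_fan_iff_b2; assumption)+

lemma riemann_fan_ex1: "\<exists>!F. is_riemann_fan P d F" if "d \<in> data_a P \<union> data_b P"
  using that unfolding data_a_def data_b_def
  by (auto simp: is_riemann_fan_iff_a1 is_riemann_fan_iff_a2 is_riemann_fan_iff_b1 is_riemann_fan_iff_b2)

lemma h_a_eq: "h_a P d = (c\<^sub>1 * snd (fst d) + c\<^sub>3 * snd (snd d) + fst (snd d) - fst (fst d)) / (c\<^sub>1 + c\<^sub>3)"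
  by (simp add: h_a_def case_prod_beta)

lemma h_b_eq: "h_b P d = (snd (fst d) + snd (snd d)) / 2 + (fst (snd d) - fst (fst d)) / (2 * c\<^sub>1)"
  by (simp add: h_b_def case_prod_beta)

lemmas lips_data = lips_fst[OF lips_fst[OF lips_ident]] lips_snd[OF lips_fst[OF lips_ident]]
  lips_fst[OF lips_snd[OF lips_ident]] lips_snd[OF lips_snd[OF lips_ident]]

section \<open>Lipschitz estimates within cases a and b\<close>

lemma h_a_lips: "bounded X \<Longrightarrow> lips X (h_a P)"
  unfolding h_a_eq[abs_def]
  by (intro lips_divide[of _ _ _ "c\<^sub>1 + c\<^sub>3"] lips_add lips_diff lips_mult lips_const lips_data)
     (use c1_pos c3_pos in auto)

lemma h_b_lips: "bounded X \<Longrightarrow> lips X (h_b P)"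
  unfolding h_b_eq[abs_def]
  by (intro lips_add lips_divide[of _ _ _ "2"] lips_divide[of _ _ _ "2 * c\<^sub>1"] lips_diff lips_const lips_data)
     (use c1_pos in auto)

lemma left_state_lips: "bounded X \<Longrightarrow> lips X w \<Longrightarrow> lips X (\<lambda>d. left_state d (w d))"
  unfolding left_state_def by (intro lips_Pair lips_add lips_diff lips_mult lips_const lips_data)

lemma right_state_lips: "bounded X \<Longrightarrow> lips X w \<Longrightarrow> lips X (\<lambda>d. right_state c d (w d))"
  unfolding right_state_def by (intro lips_Pair lips_add lips_diff lips_mult lips_const lips_data)

lemma data_a_wR: "wm P \<le> snd (snd d)" if "d \<in> data_a P"
  using that by (auto simp: data_a_def data_a1_def data_a2_def H3_def)

text \<open>Across the interface \<open>h = 0\<close> both speeds are compared with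
  \<open>c\<^sub>3\<close>. For \<open>h > 0\<close> the deficit is at most \<open>K * h\<close> by
  \<open>a1_speed_c3\<close>; for \<open>h \<le> 0\<close> the excess is at most
  \<open>(c\<^sub>1 - c\<^sub>3) / wm P * (- h)\<close>. As the values of \<open>h\<close> have
  opposite signs, the two bounds add up to a multiple of their distance.\<close>

lemma aV_lips:
  assumes "bounded X" "X \<subseteq> data_a P"
  shows "lips X aV"
proof -
  define A where "A = X \<inter> data_a1 P"
  define B where "B = X \<inter> data_a2 P"
  have X: "X = A \<union> B" using assms(2) by (auto simp: A_def B_def data_a_def)
  have bd: "bounded A" "bounded B"
    by (rule bounded_subset[OF assms(1)], force simp: X)+
  have A: "0 < h_a P d" if "d \<in> A" for d using that by (auto simp: A_def data_a1_def)
  have B: "h_a P d \<le> 0" "wm P \<le> snd (snd d)" "0 < snd (snd d)" if "d \<in> B" for d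
    using that data_a_wR[of d] wm_pos by (auto simp: B_def data_a2_def data_a_def)
  have aVA: "aV d = a1V (h_a P d)" if "d \<in> A" for d using A[OF that] by (simp add: aV_def)
  have aVB: "aV d = c\<^sub>3 + (c\<^sub>1 - c\<^sub>3) * (- h_a P d / (snd (snd d) - h_a P d))" if "d \<in> B" for d
    using B[OF that] a2_speed(4)[of "h_a P d" "snd (snd d)"] by (simp add: aV_def algebra_simps)
  have "lips A (\<lambda>d. a1V (h_a P d))"
    by (rule lips_compose[OF a1V_lips h_a_lips[OF bd(1)]]) (use A in auto)
  then have lA: "lips A aV" by (rule lips_cong) (simp add: aVA)
  have "lips B (\<lambda>d. c\<^sub>3 + (c\<^sub>1 - c\<^sub>3) * (- h_a P d / (snd (snd d) - h_a P d)))"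
  proof (intro lips_add lips_mult lips_divide[of _ _ _ "wm P"] lips_uminus lips_diff lips_const lips_data bd h_a_lips wm_pos)
    fix d assume "d \<in> B"
    then show "wm P \<le> snd (snd d) - h_a P d" using B[of d] by linarith
  qed
  then have lB: "lips B aV" by (rule lips_cong) (simp add: aVB)
  obtain K where K: "0 < K" "\<And>h V. 0 < h \<Longrightarrow> a1_speed h V \<Longrightarrow> c\<^sub>3 - V \<le> K * h"
    using a1_speed_c3 by blast
  obtain L where L: "0 \<le> L" "\<And>x y. x \<in> X \<Longrightarrow> y \<in> X \<Longrightarrow> dist (h_a P x) (h_a P y) \<le> L * dist x y"
    using lipsE[OF h_a_lips[OF assms(1)]] by blast
  define M where "M = max K ((c\<^sub>1 - c\<^sub>3) / wm P)"
  have M: "K \<le> M" "(c\<^sub>1 - c\<^sub>3) / wm P \<le> M" "0 \<le> M" using K by (auto simp: M_def)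
  show ?thesis
    unfolding X
  proof (rule lips_Un[OF lA lB, of "M * L"])
    fix x y assume xy: "x \<in> A" "y \<in> B"
    note h = A[OF xy(1)] B[OF xy(2)]
    have 1: "aV x < c\<^sub>3" "c\<^sub>3 - aV x \<le> K * h_a P x"
      using abs_a1V[OF h(1)] K(2)[OF h(1) a1V[OF h(1)]] aVA[OF xy(1)] by auto
    have "- h_a P y / (snd (snd y) - h_a P y) \<le> - h_a P y / wm P"
      using h wm_pos by (intro divide_left_mono) auto
    then have "(c\<^sub>1 - c\<^sub>3) * (- h_a P y / (snd (snd y) - h_a P y)) \<le> (c\<^sub>1 - c\<^sub>3) * (- h_a P y / wm P)"
      using c3_less_c1 by (intro mult_left_mono) auto
    then have 2: "aV y - c\<^sub>3 \<le> (c\<^sub>1 - c\<^sub>3) / wm P * (- h_a P y)"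
      using aVB[OF xy(2)] by simp
    have 3: "c\<^sub>3 \<le> aV y"
      using a2_speed(1)[OF h(2) h(4)] h by (simp add: aV_def)
    have "K * h_a P x \<le> M * h_a P x" using M h by (intro mult_right_mono) auto
    moreover have "(c\<^sub>1 - c\<^sub>3) / wm P * (- h_a P y) \<le> M * (- h_a P y)" using M h by (intro mult_right_mono) auto
    ultimately have "dist (aV x) (aV y) \<le> M * h_a P x + M * (- h_a P y)"
      using 1 2 3 by (simp add: dist_real_def)
    also have "\<dots> = M * dist (h_a P x) (h_a P y)"
      using h by (simp add: dist_real_def algebra_simps)
    also have "\<dots> \<le> M * (L * dist x y)"
      by (intro mult_left_mono L M) (use xy in \<open>auto simp: X\<close>)
    finally show "dist (aV x) (aV y) \<le> M * L * dist x y" by (simp add: mult.assoc)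
  qed
qed

lemma aV_lower: "- c\<^sub>3 \<le> aV d" if "d \<in> data_a P"
proof (cases "0 < h_a P d")
  case True
  then show ?thesis using abs_a1V[of "h_a P d"] by (simp add: aV_def)
next
  case False
  then show ?thesis
    using a2_speed(1)[of "h_a P d" "snd (snd d)"] data_a_wR[OF that] wm_pos c3_pos by (simp add: aV_def)
qed

lemma aW_minus_lips:
  assumes "bounded X" "X \<subseteq> data_a P"
  shows "lips X aW_minus"
  unfolding aW_minus_def[abs_def] w_minus_def
proof (intro lips_mult lips_divide[of _ _ _ "c\<^sub>1 - c\<^sub>3"] lips_add lips_const assms aV_lips h_a_lips)
  fix d assume "d \<in> X"
  then show "c\<^sub>1 - c\<^sub>3 \<le> c\<^sub>1 + aV d" using aV_lower[of d] assms(2) by auto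
qed (use c3_less_c1 in auto)

lemma aW_plus_lips:
  assumes "bounded X" "X \<subseteq> data_a1 P"
  shows "lips X aW_plus"
proof -
  obtain H where H: "0 < H" "\<And>d. d \<in> X \<Longrightarrow> norm (h_a P d) \<le> H"
    using lips_bounded_norm[OF h_a_lips[OF assms(1)] assms(1)] by blast
  have "0 < h_a P d \<and> h_a P d \<le> H" if "d \<in> X" for d
    using H(2)[OF that] that assms(2) by (auto simp: data_a1_def)
  then show ?thesis
    unfolding aW_plus_def[abs_def]
    by (intro lips_compose[OF w_plus_lips[of H] h_a_lips[OF assms(1)]]) auto
qed

lemma bV_bounds: "0 \<le> bV d" "bV d < c\<^sub>3"
  using b2V[of "h_b P d"] c3_pos by (auto simp: bV_def b2_speed_def)

text \<open>Without a jump at initiation, the speed in case b2 is at most a multiple of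
  \<open>h - wM P\<close> and so matches the value \<open>0\<close> of case b1. Otherwise
  compatibility makes the closures of the two pieces disjoint; as one of them is compact, they have
  a positive distance.\<close>

lemma bV_lips:
  assumes "bounded X" "X \<subseteq> data_b P" "initiation_compatible P X"
  shows "lips X bV"
proof -
  define A where "A = X \<inter> data_b1 P"
  define B where "B = X \<inter> data_b2 P"
  have X: "X = A \<union> B" using assms(2) by (auto simp: A_def B_def data_b_def)
  have bd: "bounded A" "bounded B"
    by (rule bounded_subset[OF assms(1)], force simp: X)+
  have A: "h_b P d \<le> wM P" "bV d = 0" if "d \<in> A" for d using that by (auto simp: A_def data_b1_def bV_def)
  have B: "wM P < h_b P d" "bV d = b2V (h_b P d)" if "d \<in> B" for d
    using that by (auto simp: B_def data_b2_def bV_def)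
  have lA: "lips A bV"
    by (rule lips_cong[OF lips_const[of _ 0]]) (simp add: A)
  have "lips B (\<lambda>d. b2V (h_b P d))"
    by (rule lips_compose[OF b2V_lips h_b_lips[OF bd(2)]]) (use B in auto)
  then have lB: "lips B bV" by (rule lips_cong) (simp add: B)
  show ?thesis
  proof (cases "phi_0_minus P = psi_low P 0")
    case True
    obtain L where L: "0 \<le> L" "\<And>x y. x \<in> X \<Longrightarrow> y \<in> X \<Longrightarrow> dist (h_b P x) (h_b P y) \<le> L * dist x y"
      using lipsE[OF h_b_lips[OF assms(1)]] by blast
    show ?thesis
      unfolding X
    proof (rule lips_Un[OF lA lB, of "b2_const * L"])
      fix x y assume xy: "x \<in> A" "y \<in> B"
      have "dist (bV x) (bV y) = b2V (h_b P y)"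
        using A[OF xy(1)] B[OF xy(2)] bV_bounds(1)[of y] by (simp add: dist_real_def)
      also have "\<dots> \<le> b2_const * (h_b P y - wM P)"
        using B[OF xy(2)] wM_pos by (intro b2_speed_threshold[OF True] b2V) auto
      also have "\<dots> \<le> b2_const * dist (h_b P x) (h_b P y)"
        using A[OF xy(1)] b2_const_pos by (intro mult_left_mono) (auto simp: dist_real_def)
      also have "\<dots> \<le> b2_const * (L * dist x y)"
        by (intro mult_left_mono L) (use xy b2_const_pos in \<open>auto simp: X\<close>)
      finally show "dist (bV x) (bV y) \<le> b2_const * L * dist x y" by (simp add: mult.assoc)
    qed
  next
    case False
    then have disj: "closure A \<inter> closure B = {}"
      using assms(3) by (auto simp: initiation_compatible_def A_def B_def)
    have "compact (closure A)" using bd(1) by (simp add: compact_closure)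
    then obtain \<delta> where \<delta>: "0 < \<delta>" "\<And>x y. x \<in> closure A \<Longrightarrow> y \<in> closure B \<Longrightarrow> \<delta> \<le> dist x y"
      using separate_compact_closed[OF _ closed_closure disj] by blast
    show ?thesis
      unfolding X
      by (rule lips_Un_separated[OF lA lB bd \<delta>(1)]) (use \<delta>(2) closure_subset in blast)
  qed
qed

lemma bW_lips:
  assumes "bounded X" "X \<subseteq> data_b P" "initiation_compatible P X"
  shows "lips X bW2" "lips X bW1" "lips X bU2"
proof -
  note V = bV_lips[OF assms]
  show 2: "lips X bW2"
    unfolding bW2_def[abs_def] b2_w2_def
  proof (intro lips_mult lips_divide[of _ _ _ "k3 P"] lips_add lips_const assms V h_b_lips k3_pos)
    fix d assume "d \<in> X"
    show "k3 P \<le> k3 P + c\<^sub>1 * bV d" using bV_bounds(1)[of d] c1_pos by simp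
  qed
  have "lips X (\<lambda>d. bW2 d * (k3 P - (bV d)\<^sup>2) / (k1 P - (bV d)\<^sup>2))"
  proof (intro lips_mult lips_divide[of _ _ _ "k1 P - k3 P"] lips_power2 lips_diff lips_const assms V 2)
    fix d assume "d \<in> X"
    have "(bV d)\<^sup>2 \<le> c\<^sub>3\<^sup>2" using bV_bounds[of d] by (intro power_mono) auto
    then show "k1 P - k3 P \<le> k1 P - (bV d)\<^sup>2" by (simp add: k3_eq)
  qed (use k3_less_k1 in auto)
  then show 1: "lips X bW1"
    unfolding bW1_def[abs_def] b2_w1_def bW2_def .
  show "lips X bU2"
    unfolding bU2_def[abs_def]
    by (intro lips_Pair lips_add lips_mult lips_diff lips_fst left_state_lips assms(1) V 1 2)
qed

section \<open>Comparison of two Riemann solutions\<close>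

text \<open>
  In case a2, where \<open>V \<ge> c\<^sub>3\<close>, the third state of \<open>profile_a\<close> is never taken; in case b1, the same holds
  for \<open>bU2\<close> in \<open>profile_b\<close>, because \<open>bV\<close> is \<open>0\<close>.
\<close>

definition profile_a :: "riemann_data \<Rightarrow> real \<Rightarrow> state" where
  "profile_a d = step_profile (fst d) [(- c\<^sub>1, left_state d (aW_minus d)),
     (aV d, right_state c\<^sub>3 d (aW_plus d)), (c\<^sub>3, snd d)]"

definition profile_b :: "riemann_data \<Rightarrow> real \<Rightarrow> state" where
  "profile_b d = step_profile (fst d) [(- c\<^sub>1, left_state d (bW1 d)), (- bV d, bU2 d),
     (bV d, right_state c\<^sub>1 d (bW1 d)), (c\<^sub>1, snd d)]"

definition profile :: "riemann_data \<Rightarrow> real \<Rightarrow> state" where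
  "profile d = (if d \<in> data_a P then profile_a d else profile_b d)"

lemma aV_a2: "c\<^sub>3 \<le> aV d" if "d \<in> data_a2 P"
proof -
  have "d \<in> data_a P" using that by (simp add: data_a_def)
  from data_a_wR[OF this] show ?thesis
    using that wm_pos a2_speed(1)[of "h_a P d" "snd (snd d)"] by (auto simp: aV_def data_a2_def)
qed

lemma aV_less_c1: "aV d < c\<^sub>1" if "d \<in> data_a P"
proof (cases "0 < h_a P d")
  case True
  then show ?thesis using abs_a1V[of "h_a P d"] c3_less_c1 by (simp add: aV_def)
next
  case False
  then show ?thesis
    using a2_speed(3)[of "h_a P d" "snd (snd d)"] data_a_wR[OF that] wm_pos by (simp add: aV_def)
qed

lemma data_a_b_disjoint: "data_a P \<inter> data_b P = {}"
  using H1_H3_disjoint unfolding data_a_def data_a1_def data_a2_def data_b_def data_b1_def data_b2_def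
  by auto

text \<open>All fans of case a, and all those of case b, thereby get wave lists of one shape, so
  that solutions from a1 and a2, or from b1 and b2, can be compared wave by wave.\<close>

lemma riemann_sol_eq_profile:
  assumes "d \<in> data_a P \<union> data_b P" "t > 0"
  shows "riemann_sol P d t x = profile d (x / t)"
proof -
  have rs: "riemann_sol P d t x = step_profile (fst d) (waves P (snd d) (riemann_fan P d)) (x / t)"
    using assms(2) by (cases d) simp
  consider "d \<in> data_a1 P" | "d \<in> data_a2 P" | "d \<in> data_b1 P" | "d \<in> data_b2 P"
    using assms by (auto simp: data_a_def data_b_def)
  then show ?thesis
  proof cases
    case 1
    then have "d \<in> data_a P" by (simp add: data_a_def)
    then show ?thesis unfolding rs riemann_fan_a1[OF 1] profile_def profile_a_def by simp
  next
    case 2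
    then have "d \<in> data_a P" by (simp add: data_a_def)
    then show ?thesis unfolding rs riemann_fan_a2[OF 2] profile_def profile_a_def using aV_a2[OF 2] by simp
  next
    case 3
    then have "d \<notin> data_a P" using data_a_b_disjoint by (auto simp: data_b_def)
    then show ?thesis
      unfolding rs riemann_fan_b1[OF 3] profile_def profile_b_def right_state_b1[OF 3] bW1_b1(2)[OF 3]
      using c1_pos by simp
  next
    case 4
    then have "d \<notin> data_a P" using data_a_b_disjoint by (auto simp: data_b_def)
    then show ?thesis unfolding rs riemann_fan_b2[OF 4] profile_def profile_b_def by simp
  qed
qed

lemma profile_outer:
  assumes "d \<in> data_a P \<union> data_b P"
  shows "\<xi> < - c\<^sub>1 \<Longrightarrow> profile d \<xi> = fst d" "c\<^sub>1 \<le> \<xi> \<Longrightarrow> profile d \<xi> = snd d"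
  using aV_less_c1[of d] bV_bounds[of d] c3_less_c1 c1_pos
  by (auto simp: profile_def profile_a_def profile_b_def)

section \<open>Uniform bounds and the comparison of two profiles\<close>

lemma norm_fst_snd_bound:
  assumes "bounded (X :: riemann_data set)"
  obtains B where "0 < B" "\<And>d. d \<in> X \<Longrightarrow> norm (fst d) \<le> B" "\<And>d. d \<in> X \<Longrightarrow> norm (snd d) \<le> B"
proof -
  obtain B where B: "0 < B" "\<And>d. d \<in> X \<Longrightarrow> norm d \<le> B"
    using assms bounded_pos by blast
  have "norm (fst d) \<le> B" "norm (snd d) \<le> B" if "d \<in> X" for d
    using B(2)[OF that] norm_fst_le[of "fst d" "snd d"] norm_snd_le[of "snd d" "fst d"] by auto
  then show ?thesis using that B by blast
qed

text \<open>The state built from \<open>aW_plus\<close> is controlled only for data of case a1; its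
  bound is therefore used only when the profile actually takes this value.\<close>

lemma profile_a_bounded:
  assumes X: "bounded X" "X \<subseteq> data_a P"
  obtains B where "0 < B" "\<And>d \<xi>. d \<in> X \<Longrightarrow> norm (profile_a d \<xi>) \<le> B"
proof -
  have bd: "bounded (X \<inter> data_a1 P)" using X(1) by (rule bounded_subset) auto
  obtain B0 where B0: "0 < B0" "\<And>d. d \<in> X \<Longrightarrow> norm (fst d) \<le> B0" "\<And>d. d \<in> X \<Longrightarrow> norm (snd d) \<le> B0"
    using norm_fst_snd_bound[OF X(1)] by blast
  obtain B1 where B1: "0 < B1" "\<And>d. d \<in> X \<Longrightarrow> norm (left_state d (aW_minus d)) \<le> B1"
    using lips_bounded_norm[OF left_state_lips[OF X(1) aW_minus_lips[OF X]] X(1)] by blast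
  obtain B2 where B2: "0 < B2" "\<And>d. d \<in> X \<inter> data_a1 P \<Longrightarrow> norm (right_state c\<^sub>3 d (aW_plus d)) \<le> B2"
    using lips_bounded_norm[OF right_state_lips[OF bd aW_plus_lips[OF bd]] bd] by blast
  show ?thesis
  proof
    fix d \<xi> assume d: "d \<in> X"
    have "profile_a d \<xi> \<in> {fst d, snd d, left_state d (aW_minus d)} \<or>
      d \<in> data_a1 P \<and> profile_a d \<xi> = right_state c\<^sub>3 d (aW_plus d)"
      using d X(2) aV_a2[of d] by (auto simp: profile_a_def data_a_def)
    then show "norm (profile_a d \<xi>) \<le> B0 + B1 + B2"
      using B0(2)[OF d] B0(3)[OF d] B1(2)[OF d] B2(2)[of d] B0(1) B1(1) B2(1) d by fastforce
  qed (use B0 B1 B2 in auto)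
qed

lemma profile_b_bounded:
  assumes X: "bounded X" "X \<subseteq> data_b P" "initiation_compatible P X"
  obtains B where "0 < B" "\<And>d \<xi>. d \<in> X \<Longrightarrow> norm (profile_b d \<xi>) \<le> B"
proof -
  obtain B0 where B0: "0 < B0" "\<And>d. d \<in> X \<Longrightarrow> norm (fst d) \<le> B0" "\<And>d. d \<in> X \<Longrightarrow> norm (snd d) \<le> B0"
    using norm_fst_snd_bound[OF X(1)] by blast
  obtain B1 where B1: "0 < B1" "\<And>d. d \<in> X \<Longrightarrow> norm (left_state d (bW1 d)) \<le> B1"
    using lips_bounded_norm[OF left_state_lips[OF X(1) bW_lips(2)[OF X]] X(1)] by blast
  obtain B2 where B2: "0 < B2" "\<And>d. d \<in> X \<Longrightarrow> norm (right_state c\<^sub>1 d (bW1 d)) \<le> B2"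
    using lips_bounded_norm[OF right_state_lips[OF X(1) bW_lips(2)[OF X]] X(1)] by blast
  obtain B3 where B3: "0 < B3" "\<And>d. d \<in> X \<Longrightarrow> norm (bU2 d) \<le> B3"
    using lips_bounded_norm[OF bW_lips(3)[OF X] X(1)] by blast
  show ?thesis
  proof
    fix d \<xi> assume d: "d \<in> X"
    have "profile_b d \<xi> \<in> {fst d, snd d, left_state d (bW1 d), right_state c\<^sub>1 d (bW1 d), bU2 d}"
      by (auto simp: profile_b_def)
    then show "norm (profile_b d \<xi>) \<le> B0 + B1 + B2 + B3"
      using B0(2)[OF d] B0(3)[OF d] B1(2)[OF d] B2(2)[OF d] B3(2)[OF d] B0(1) B1(1) B2(1) B3(1) by auto
  qed (use B0 B1 B2 B3 in auto)
qed

text \<open>In case a2 the distance of the speed to \<open>c\<^sub>1\<close> is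
  \<open>(c\<^sub>1 - c\<^sub>3) * wR / (wR - h)\<close>, with \<open>wR\<close> at least
  \<open>wm P\<close> and \<open>wR - h\<close> bounded on \<open>X\<close>. This provides the gap
  \<open>c - b\<close> of \<open>profile_close_L1\<close>.\<close>

lemma aV_uniform_bound:
  assumes X: "bounded X" "X \<subseteq> data_a P"
  obtains b where "c\<^sub>3 \<le> b" "b < c\<^sub>1" "\<And>d. d \<in> X \<Longrightarrow> aV d \<le> b"
proof -
  obtain B where B: "0 < B" "\<And>d. d \<in> X \<Longrightarrow> norm (snd (snd d) - h_a P d) \<le> B"
    using lips_bounded_norm[OF lips_diff[OF lips_data(4) h_a_lips[OF X(1)]] X(1)] by blast
  define b where "b = max c\<^sub>3 (c\<^sub>1 - (c\<^sub>1 - c\<^sub>3) * wm P / B)"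
  have "0 < (c\<^sub>1 - c\<^sub>3) * wm P / B" using c3_less_c1 wm_pos B(1) by simp
  then have b: "c\<^sub>3 \<le> b" "b < c\<^sub>1" using c3_less_c1 by (auto simp: b_def)
  have "aV d \<le> b" if d: "d \<in> X" for d
  proof (cases "0 < h_a P d")
    case True
    then show ?thesis using abs_a1V[of "h_a P d"] by (simp add: aV_def b_def)
  next
    case False
    have w: "wm P \<le> snd (snd d)" using data_a_wR d X(2) by blast
    have "(c\<^sub>1 - c\<^sub>3) * wm P / B \<le> (c\<^sub>1 - c\<^sub>3) * snd (snd d) / (snd (snd d) - h_a P d)"
      using w False B(2)[OF d] wm_pos c3_less_c1 by (intro frac_le mult_left_mono) auto
    also have "\<dots> = c\<^sub>1 - aV d"
      using a2_speed(2)[of "h_a P d" "snd (snd d)"] w wm_pos False by (simp add: aV_def)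
    finally show ?thesis by (simp add: b_def)
  qed
  then show ?thesis using that b by blast
qed

lemma norm_diff_le_double: "norm (x - y) \<le> 2 * B" if "norm x \<le> B" "norm y \<le> B"
  for x y :: "'a::real_normed_vector"
  using norm_triangle_ineq4[of x y] that by linarith

lemma profile_a_close:
  assumes X: "bounded X" "X \<subseteq> data_a P"
  obtains C b where "0 \<le> C" "0 \<le> b" "b < c\<^sub>1"
    "\<And>d1 d2. d1 \<in> X \<Longrightarrow> d2 \<in> X \<Longrightarrow> profile_close c\<^sub>1 b C (data_dist d1 d2) (profile_a d1) (profile_a d2)"
proof -
  have bd: "bounded (X \<inter> data_a1 P)" using X(1) by (rule bounded_subset) auto
  obtain b where b: "c\<^sub>3 \<le> b" "b < c\<^sub>1" "\<And>d. d \<in> X \<Longrightarrow> aV d \<le> b"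
    using aV_uniform_bound[OF X] by blast
  obtain B where B: "0 < B" "\<And>d \<xi>. d \<in> X \<Longrightarrow> norm (profile_a d \<xi>) \<le> B"
    using profile_a_bounded[OF X] by blast
  obtain L1 where L1: "0 \<le> L1" "\<And>x y. x \<in> X \<Longrightarrow> y \<in> X \<Longrightarrow>
      norm (left_state y (aW_minus y) - left_state x (aW_minus x)) \<le> L1 * data_dist x y"
    using lips_data_dist[OF left_state_lips[OF X(1) aW_minus_lips[OF X]]] by blast
  obtain L2 where L2: "0 \<le> L2" "\<And>x y. x \<in> X \<inter> data_a1 P \<Longrightarrow> y \<in> X \<inter> data_a1 P \<Longrightarrow>
      norm (right_state c\<^sub>3 y (aW_plus y) - right_state c\<^sub>3 x (aW_plus x)) \<le> L2 * data_dist x y"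
    using lips_data_dist[OF right_state_lips[OF bd aW_plus_lips[OF bd]]] by blast
  obtain L3 where L3: "0 \<le> L3" "\<And>x y. x \<in> X \<Longrightarrow> y \<in> X \<Longrightarrow> norm (aV y - aV x) \<le> L3 * data_dist x y"
    using lips_data_dist[OF aV_lips[OF X]] by blast
  \<comment> \<open>The summand \<open>1\<close> pays for the difference of the right data, visible
    beyond the speed \<open>c\<^sub>3\<close>; \<open>2 * B\<close> pays for the window between the
    two phase boundaries.\<close>
  define C where "C = L1 + L2 + L3 + 1 + 2 * B"
  have C: "0 \<le> C" "2 * B \<le> C" using L1 L2 L3 B by (auto simp: C_def)
  show ?thesis
  proof (rule that[of C b])
    fix d1 d2 assume d: "d1 \<in> X" "d2 \<in> X"
    let ?e = "data_dist d1 d2"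
    have Ce: "0 \<le> C * ?e" "L1 * ?e \<le> C * ?e" "L2 * ?e \<le> C * ?e" "L3 * ?e \<le> C * ?e"
      using C L1(1) L2(1) L3(1) B(1) data_dist_nonneg[of d1 d2]
      by (auto simp: C_def intro!: mult_right_mono)
    have "1 \<le> C" using L1(1) L2(1) L3(1) B(1) by (simp add: C_def)
    then have e_le: "?e \<le> C * ?e" using mult_right_mono[of 1 C ?e] data_dist_nonneg by simp
    have low: "- c\<^sub>3 \<le> aV d1" "- c\<^sub>3 \<le> aV d2" using aV_lower[of d1] aV_lower[of d2] d X(2) by auto
    show "profile_close c\<^sub>1 b C ?e (profile_a d1) (profile_a d2)"
      unfolding profile_close_def
    \<comment> \<open>There is only one phase boundary, so the second window degenerates to the
      point \<open>0\<close>.\<close>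
    proof (rule exI[of _ "min (aV d1) (aV d2)"], rule exI[of _ "max (aV d1) (aV d2)"],
        rule exI[of _ 0], rule exI[of _ 0], intro conjI allI impI)
      show "{min (aV d1) (aV d2), max (aV d1) (aV d2), 0, 0} \<subseteq> {- b..b}"
        using low b(1) b(3)[OF d(1)] b(3)[OF d(2)] c3_pos by auto
      show "max (aV d1) (aV d2) - min (aV d1) (aV d2) \<le> C * ?e"
        using L3(2)[OF d] Ce by (auto simp: max_def min_def)
      show "0 - 0 \<le> C * ?e" using Ce by simp
      fix \<xi> assume \<xi>: "- c\<^sub>1 \<le> \<xi> \<and> \<xi> < c\<^sub>1"
      have nn: "0 \<le> (if \<xi> \<in> {0..0} then C else 0)"
        "0 \<le> (if \<xi> \<in> {min (aV d1) (aV d2)..max (aV d1) (aV d2)} then C else 0)" using C by auto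
      consider "\<xi> < min (aV d1) (aV d2)" | "\<xi> \<in> {min (aV d1) (aV d2)..max (aV d1) (aV d2)}"
        | "max (aV d1) (aV d2) < \<xi>" by (metis atLeastAtMost_iff not_le)
      then have "norm (profile_a d2 \<xi> - profile_a d1 \<xi>) \<le> C * ?e +
          (if \<xi> \<in> {min (aV d1) (aV d2)..max (aV d1) (aV d2)} then C else 0)"
      proof cases
        case 1
        then have "profile_a d2 \<xi> - profile_a d1 \<xi> = left_state d2 (aW_minus d2) - left_state d1 (aW_minus d1)"
          using \<xi> by (simp add: profile_a_def)
        then have "norm (profile_a d2 \<xi> - profile_a d1 \<xi>) \<le> C * ?e" using L1(2)[OF d] Ce by simp
        then show ?thesis using nn(2) by linarith
      next
        case 2
        have "norm (profile_a d2 \<xi> - profile_a d1 \<xi>) \<le> 2 * B"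
          by (intro norm_diff_le_double B d)
        then show ?thesis using 2 C Ce by simp
      next
        case 3
        show ?thesis
        proof (cases "\<xi> < c\<^sub>3")
          case True
          \<comment> \<open>Both speeds lie below \<open>\<xi>\<close>, hence below
            \<open>c\<^sub>3\<close>, whereas the speeds of case a2 are at least
            \<open>c\<^sub>3\<close>.\<close>
          then have "d1 \<in> X \<inter> data_a1 P" "d2 \<in> X \<inter> data_a1 P"
            using 3 d X(2) aV_a2[of d1] aV_a2[of d2] by (auto simp: data_a_def)
          moreover have "profile_a d2 \<xi> - profile_a d1 \<xi> = right_state c\<^sub>3 d2 (aW_plus d2) - right_state c\<^sub>3 d1 (aW_plus d1)"
            using 3 \<xi> True by (simp add: profile_a_def)
          ultimately have "norm (profile_a d2 \<xi> - profile_a d1 \<xi>) \<le> C * ?e" using L2(2)[of d1 d2] Ce by simp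
          then show ?thesis using nn(2) by linarith
        next
          case False
          then have "profile_a d2 \<xi> - profile_a d1 \<xi> = snd d2 - snd d1"
            using 3 \<xi> by (simp add: profile_a_def)
          moreover have "norm (snd d2 - snd d1) \<le> ?e" by (simp add: data_dist_def)
          ultimately have "norm (profile_a d2 \<xi> - profile_a d1 \<xi>) \<le> C * ?e" using e_le by simp
          then show ?thesis using nn(2) by linarith
        qed
      qed
      then show "norm (profile_a d2 \<xi> - profile_a d1 \<xi>) \<le> C * ?e +
          (if \<xi> \<in> {min (aV d1) (aV d2)..max (aV d1) (aV d2)} then C else 0) + (if \<xi> \<in> {0..0} then C else 0)"
        using nn(1) by linarith
    qed
  qed (use C b c3_pos in auto)
qed

text \<open>The fans are symmetric, so the two windows are mirror images of the interval between the
  two speeds. If one datum belongs to case b1 then \<open>p = 0\<close>, and the region between the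
  windows, where \<open>bU2\<close> would be compared, is empty.\<close>

lemma profile_b_close:
  assumes X: "bounded X" "X \<subseteq> data_b P" "initiation_compatible P X"
  obtains C where "0 \<le> C"
    "\<And>d1 d2. d1 \<in> X \<Longrightarrow> d2 \<in> X \<Longrightarrow> profile_close c\<^sub>1 c\<^sub>3 C (data_dist d1 d2) (profile_b d1) (profile_b d2)"
proof -
  obtain B where B: "0 < B" "\<And>d \<xi>. d \<in> X \<Longrightarrow> norm (profile_b d \<xi>) \<le> B"
    using profile_b_bounded[OF X] by blast
  obtain L1 where L1: "0 \<le> L1" "\<And>x y. x \<in> X \<Longrightarrow> y \<in> X \<Longrightarrow>
      norm (left_state y (bW1 y) - left_state x (bW1 x)) \<le> L1 * data_dist x y"
    using lips_data_dist[OF left_state_lips[OF X(1) bW_lips(2)[OF X]]] by blast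
  obtain L2 where L2: "0 \<le> L2" "\<And>x y. x \<in> X \<Longrightarrow> y \<in> X \<Longrightarrow>
      norm (right_state c\<^sub>1 y (bW1 y) - right_state c\<^sub>1 x (bW1 x)) \<le> L2 * data_dist x y"
    using lips_data_dist[OF right_state_lips[OF X(1) bW_lips(2)[OF X]]] by blast
  obtain L3 where L3: "0 \<le> L3" "\<And>x y. x \<in> X \<Longrightarrow> y \<in> X \<Longrightarrow> norm (bU2 y - bU2 x) \<le> L3 * data_dist x y"
    using lips_data_dist[OF bW_lips(3)[OF X]] by blast
  obtain L4 where L4: "0 \<le> L4" "\<And>x y. x \<in> X \<Longrightarrow> y \<in> X \<Longrightarrow> norm (bV y - bV x) \<le> L4 * data_dist x y"
    using lips_data_dist[OF bV_lips[OF X]] by blast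
  define C where "C = L1 + L2 + L3 + L4 + 2 * B"
  have C: "0 \<le> C" "2 * B \<le> C" using L1 L2 L3 L4 B by (auto simp: C_def)
  show ?thesis
  proof (rule that[of C])
    fix d1 d2 assume d: "d1 \<in> X" "d2 \<in> X"
    let ?e = "data_dist d1 d2"
    have Ce: "0 \<le> C * ?e" "L1 * ?e \<le> C * ?e" "L2 * ?e \<le> C * ?e" "L3 * ?e \<le> C * ?e" "L4 * ?e \<le> C * ?e"
      using C L1(1) L2(1) L3(1) L4(1) B(1) data_dist_nonneg[of d1 d2]
      by (auto simp: C_def intro!: mult_right_mono)
    define p q where "p = min (bV d1) (bV d2)" and "q = max (bV d1) (bV d2)"
    have pq: "0 \<le> p" "p \<le> q" "q < c\<^sub>3" "p \<le> bV d1" "p \<le> bV d2" "bV d1 \<le> q" "bV d2 \<le> q"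
      using bV_bounds[of d1] bV_bounds[of d2] by (auto simp: p_def q_def)
    have len: "q - p \<le> C * ?e"
      using L4(2)[OF d] Ce by (auto simp: p_def q_def max_def min_def)
    show "profile_close c\<^sub>1 c\<^sub>3 C ?e (profile_b d1) (profile_b d2)"
      unfolding profile_close_def
    proof (rule exI[of _ "- q"], rule exI[of _ "- p"], rule exI[of _ p], rule exI[of _ q], intro conjI allI impI)
      show "{- q, - p, p, q} \<subseteq> {- c\<^sub>3..c\<^sub>3}" using pq by auto
      show "- p - - q \<le> C * ?e" "q - p \<le> C * ?e" using len by auto
      fix \<xi> assume \<xi>: "- c\<^sub>1 \<le> \<xi> \<and> \<xi> < c\<^sub>1"
      have nn: "0 \<le> (if \<xi> \<in> {- q..- p} then C else 0)" "0 \<le> (if \<xi> \<in> {p..q} then C else 0)" using C by auto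
      consider "\<xi> \<in> {- q..- p} \<or> \<xi> \<in> {p..q}" | "\<xi> < - q" | "- p < \<xi>" "\<xi> < p" | "q < \<xi>"
        by (metis atLeastAtMost_iff not_le)
      then show "norm (profile_b d2 \<xi> - profile_b d1 \<xi>) \<le> C * ?e +
          (if \<xi> \<in> {- q..- p} then C else 0) + (if \<xi> \<in> {p..q} then C else 0)"
      proof cases
        case 1
        then have "C \<le> (if \<xi> \<in> {- q..- p} then C else 0) + (if \<xi> \<in> {p..q} then C else 0)"
          using nn by auto
        moreover have "norm (profile_b d2 \<xi> - profile_b d1 \<xi>) \<le> 2 * B"
          by (intro norm_diff_le_double B d)
        ultimately show ?thesis using C Ce by linarith
      next
        case 2
        then have "profile_b d2 \<xi> - profile_b d1 \<xi> = left_state d2 (bW1 d2) - left_state d1 (bW1 d1)"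
          using \<xi> pq by (simp add: profile_b_def)
        then have "norm (profile_b d2 \<xi> - profile_b d1 \<xi>) \<le> C * ?e"
          using L1(2)[OF d] Ce by simp
        then show ?thesis using nn by linarith
      next
        case 3
        then have "profile_b d2 \<xi> - profile_b d1 \<xi> = bU2 d2 - bU2 d1"
          using \<xi> pq by (simp add: profile_b_def)
        then have "norm (profile_b d2 \<xi> - profile_b d1 \<xi>) \<le> C * ?e"
          using L3(2)[OF d] Ce by simp
        then show ?thesis using nn by linarith
      next
        case 4
        then have "profile_b d2 \<xi> - profile_b d1 \<xi> = right_state c\<^sub>1 d2 (bW1 d2) - right_state c\<^sub>1 d1 (bW1 d1)"
          using \<xi> pq by (simp add: profile_b_def)
        then have "norm (profile_b d2 \<xi> - profile_b d1 \<xi>) \<le> C * ?e"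
          using L2(2)[OF d] Ce by simp
        then show ?thesis using nn by linarith
      qed
    qed
  qed (use C in auto)
qed

text \<open>The right data lie in different phases. Pairs from cases a and b therefore need no
  comparison of waves: bounded profiles over a distance bounded below suffice.\<close>

lemma data_dist_a_b:
  assumes "d1 \<in> data_a P" "d2 \<in> data_b P"
  shows "wm P - wM P \<le> data_dist d1 d2" "wm P - wM P \<le> data_dist d2 d1"
proof -
  have "wm P \<le> snd (snd d1)" "snd (snd d2) \<le> wM P"
    using data_a_wR[OF assms(1)] assms(2) by (auto simp: data_b_def data_b1_def data_b2_def H1_def)
  moreover have "dist (snd (snd d1)) (snd (snd d2)) \<le> dist d1 d2"
    by (rule order_trans[OF dist_snd_le dist_snd_le])
  ultimately have "wm P - wM P \<le> dist d1 d2" by (simp add: dist_real_def)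
  then show "wm P - wM P \<le> data_dist d1 d2" "wm P - wM P \<le> data_dist d2 d1"
    using dist_le_data_dist[of d1 d2] dist_le_data_dist[of d2 d1] by (simp_all add: dist_commute)
qed

lemma initiation_compatible_Int: "initiation_compatible P (X \<inter> data_b P) \<longleftrightarrow> initiation_compatible P X"
proof -
  have "X \<inter> data_b P \<inter> data_b1 P = X \<inter> data_b1 P" "X \<inter> data_b P \<inter> data_b2 P = X \<inter> data_b2 P"
    by (auto simp: data_b_def)
  then show ?thesis by (simp add: initiation_compatible_def)
qed

lemma profile_close_on:
  assumes S: "bounded S" "S \<subseteq> data_a P \<union> data_b P" "initiation_compatible P S"
  obtains C b where "0 \<le> C" "0 \<le> b" "b < c\<^sub>1"
    "\<And>d1 d2. d1 \<in> S \<Longrightarrow> d2 \<in> S \<Longrightarrow> profile_close c\<^sub>1 b C (data_dist d1 d2) (profile d1) (profile d2)"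
proof -
  define Xa where "Xa = S \<inter> data_a P"
  define Xb where "Xb = S \<inter> data_b P"
  have a: "bounded Xa" "Xa \<subseteq> data_a P" and b: "bounded Xb" "Xb \<subseteq> data_b P" "initiation_compatible P Xb"
    using S by (auto simp: Xa_def Xb_def initiation_compatible_Int intro: bounded_subset)
  have pa: "profile d = profile_a d" if "d \<in> Xa" for d using that by (auto simp: profile_def Xa_def)
  have pb: "profile d = profile_b d" if "d \<in> Xb" for d
    using that data_a_b_disjoint by (auto simp: profile_def Xb_def)
  obtain Ca ba where A: "0 \<le> Ca" "0 \<le> ba" "ba < c\<^sub>1"
    "\<And>d1 d2. d1 \<in> Xa \<Longrightarrow> d2 \<in> Xa \<Longrightarrow> profile_close c\<^sub>1 ba Ca (data_dist d1 d2) (profile_a d1) (profile_a d2)"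
    using profile_a_close[OF a] by blast
  obtain Cb where B: "0 \<le> Cb"
    "\<And>d1 d2. d1 \<in> Xb \<Longrightarrow> d2 \<in> Xb \<Longrightarrow> profile_close c\<^sub>1 c\<^sub>3 Cb (data_dist d1 d2) (profile_b d1) (profile_b d2)"
    using profile_b_close[OF b] by blast
  obtain Ma where Ma: "0 < Ma" "\<And>d \<xi>. d \<in> Xa \<Longrightarrow> norm (profile_a d \<xi>) \<le> Ma"
    using profile_a_bounded[OF a] by blast
  obtain Mb where Mb: "0 < Mb" "\<And>d \<xi>. d \<in> Xb \<Longrightarrow> norm (profile_b d \<xi>) \<le> Mb"
    using profile_b_bounded[OF b] by blast
  define \<delta> where "\<delta> = wm P - wM P"
  have \<delta>: "0 < \<delta>" using wM_less_wm by (simp add: \<delta>_def)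
  define Cm where "Cm = 2 * (Ma + Mb) / \<delta>"
  have Cm: "0 \<le> Cm" using Ma Mb \<delta> by (simp add: Cm_def)
  define C where "C = max Ca (max Cb Cm)"
  define bb where "bb = max ba c\<^sub>3"
  have C: "Ca \<le> C" "Cb \<le> C" "Cm \<le> C" "0 \<le> C" using A B Cm by (auto simp: C_def)
  have bb: "ba \<le> bb" "c\<^sub>3 \<le> bb" "0 \<le> bb" "bb < c\<^sub>1" using A c3_less_c1 c3_pos by (auto simp: bb_def)
  have widen: "profile_close c\<^sub>1 bb C' e f g" if "profile_close c\<^sub>1 b' C' e f g" "b' \<le> bb"
    for b' C' e and f g :: "real \<Rightarrow> state"
  proof -
    have "{- b'..b'} \<subseteq> {- bb..bb}" using that(2) by auto
    then show ?thesis using that(1) unfolding profile_close_def by (meson subset_trans)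
  qed
  have mixed: "profile_close c\<^sub>1 bb Cm (data_dist d1 d2) (profile d1) (profile d2)"
    if d: "d1 \<in> Xa \<and> d2 \<in> Xb \<or> d1 \<in> Xb \<and> d2 \<in> Xa" for d1 d2
    unfolding profile_close_def
  proof (rule exI[of _ 0], rule exI[of _ 0], rule exI[of _ 0], rule exI[of _ 0], intro conjI allI impI)
    have e: "\<delta> \<le> data_dist d1 d2"
      using d data_dist_a_b a b unfolding \<delta>_def by blast
    have "2 * (Ma + Mb) = Cm * \<delta>" using \<delta> by (simp add: Cm_def)
    also have "\<dots> \<le> Cm * data_dist d1 d2" using e Cm by (rule mult_left_mono)
    finally have Cme: "2 * (Ma + Mb) \<le> Cm * data_dist d1 d2" .
    show "{0, 0, 0, 0} \<subseteq> {- bb..bb}" using bb by simp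
    show "0 - 0 \<le> Cm * data_dist d1 d2" "0 - 0 \<le> Cm * data_dist d1 d2"
      using Cme Ma Mb by auto
    fix \<xi>
    have bnd: "norm (profile d \<xi>) \<le> Ma + Mb" if "d \<in> Xa \<or> d \<in> Xb" for d
      using that Ma(2)[of d \<xi>] Mb(2)[of d \<xi>] Ma(1) Mb(1) pa[of d] pb[of d] by auto
    have "norm (profile d2 \<xi> - profile d1 \<xi>) \<le> 2 * (Ma + Mb)"
      using d by (intro norm_diff_le_double bnd) auto
    moreover have "0 \<le> (if \<xi> \<in> {0..0} then Cm else 0)" using Cm by simp
    ultimately show "norm (profile d2 \<xi> - profile d1 \<xi>) \<le> Cm * data_dist d1 d2
        + (if \<xi> \<in> {0..0} then Cm else 0) + (if \<xi> \<in> {0..0} then Cm else 0)"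
      using Cme by linarith
  qed
  show ?thesis
  proof (rule that[of C bb])
    fix d1 d2 assume "d1 \<in> S" "d2 \<in> S"
    then consider "d1 \<in> Xa" "d2 \<in> Xa" | "d1 \<in> Xb" "d2 \<in> Xb" | "d1 \<in> Xa \<and> d2 \<in> Xb \<or> d1 \<in> Xb \<and> d2 \<in> Xa"
      using S(2) by (auto simp: Xa_def Xb_def)
    then show "profile_close c\<^sub>1 bb C (data_dist d1 d2) (profile d1) (profile d2)"
    proof cases
      case 1
      then show ?thesis unfolding pa[OF 1(1)] pa[OF 1(2)]
        by (intro profile_close_mono[OF widen[OF A(4)]] C bb data_dist_nonneg)
    next
      case 2
      then show ?thesis unfolding pb[OF 2(1)] pb[OF 2(2)]
        by (intro profile_close_mono[OF widen[OF B(2)]] C bb data_dist_nonneg)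
    next
      case 3
      then show ?thesis by (intro profile_close_mono[OF mixed] C data_dist_nonneg)
    qed
  qed (rule C bb)+
qed

section \<open>The integral estimate and the Lipschitz estimates for the fans\<close>

lemma riemann_sol_L1:
  assumes S: "bounded S" "S \<subseteq> data_a P \<union> data_b P" "initiation_compatible P S"
  shows "\<exists>C. \<forall>d1\<in>S. \<forall>d2\<in>S. \<forall>A B t. A < B \<and> 0 \<le> t \<longrightarrow>
    integral {A..B} (\<lambda>x. norm (riemann_sol P d2 t x - riemann_sol P d1 t x))
    \<le> C * integral {A - c\<^sub>1 * t..B + c\<^sub>1 * t} (\<lambda>x. norm (riemann_sol P d2 0 x - riemann_sol P d1 0 x))"
proof -
  obtain C b where C: "0 \<le> C" "0 \<le> b" "b < c\<^sub>1"
    "\<And>d1 d2. d1 \<in> S \<Longrightarrow> d2 \<in> S \<Longrightarrow> profile_close c\<^sub>1 b C (data_dist d1 d2) (profile d1) (profile d2)"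
    using profile_close_on[OF S] by blast
  define K where "K = 1 + C + 2 * C\<^sup>2 / (c\<^sub>1 - b)"
  have K: "1 \<le> K" using C by (simp add: K_def)
  have "integral {A..B} (\<lambda>x. norm (riemann_sol P d2 t x - riemann_sol P d1 t x))
    \<le> K * integral {A - c\<^sub>1 * t..B + c\<^sub>1 * t} (\<lambda>x. norm (riemann_sol P d2 0 x - riemann_sol P d1 0 x))"
    if d: "d1 \<in> S" "d2 \<in> S" and AB: "A < B" and t: "0 \<le> t" for d1 d2 A B t
  proof (cases "t = 0")
    case True
    let ?I = "integral {A..B} (\<lambda>x. norm (riemann_sol P d2 0 x - riemann_sol P d1 0 x))"
    have "0 \<le> ?I"
      by (cases "(\<lambda>x. norm (riemann_sol P d2 0 x - riemann_sol P d1 0 x)) integrable_on {A..B}")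
         (auto intro: integral_nonneg simp: not_integrable_integral)
    then have "1 * ?I \<le> K * ?I" using K by (intro mult_right_mono) auto
    then show ?thesis using True by simp
  next
    case False
    then have tpos: "0 < t" using t by simp
    have dd: "d1 \<in> data_a P \<union> data_b P" "d2 \<in> data_a P \<union> data_b P" using d S(2) by auto
    have init: "(\<lambda>x. norm (riemann_sol P d2 0 x - riemann_sol P d1 0 x)) =
      (\<lambda>x. if x < 0 then norm (fst d2 - fst d1) else norm (snd d2 - snd d1))"
      by (cases d1; cases d2) auto
    show ?thesis
      unfolding init riemann_sol_eq_profile[OF dd(1) tpos] riemann_sol_eq_profile[OF dd(2) tpos] K_def
    proof (rule profile_close_L1[OF C(2,3,1) norm_ge_zero norm_ge_zero _ _ _ tpos AB])
      show "profile_close c\<^sub>1 b C (norm (fst d2 - fst d1) + norm (snd d2 - snd d1)) (profile d1) (profile d2)"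
        using C(4)[OF d] by (simp add: data_dist_def)
    qed (use profile_outer[OF dd(1)] profile_outer[OF dd(2)] in auto)
  qed
  then show ?thesis by blast
qed

lemma component_lips:
  assumes S: "bounded S" "initiation_compatible P S"
  shows "lips (S \<inter> data_a P) (\<lambda>d. u_minus (riemann_fan P d))"
    "lips (S \<inter> data_a P) (\<lambda>d. speed_V (riemann_fan P d))"
    "lips (S \<inter> data_a1 P) (\<lambda>d. u_plus (riemann_fan P d))"
    "lips (S \<inter> data_b P) (\<lambda>d. u_1 (riemann_fan P d))"
    "lips (S \<inter> data_b P) (\<lambda>d. u_3 (riemann_fan P d))"
    "lips (S \<inter> data_b2 P) (\<lambda>d. u_2 (riemann_fan P d))"
    "lips (S \<inter> data_b2 P) (\<lambda>d. speed_V' (riemann_fan P d))"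
    "lips (S \<inter> data_b2 P) (\<lambda>d. speed_V (riemann_fan P d))"
proof -
  have a: "bounded (S \<inter> data_a P)" "S \<inter> data_a P \<subseteq> data_a P"
    and a1: "bounded (S \<inter> data_a1 P)" "S \<inter> data_a1 P \<subseteq> data_a1 P"
    and b: "bounded (S \<inter> data_b P)" "S \<inter> data_b P \<subseteq> data_b P" "initiation_compatible P (S \<inter> data_b P)"
    using S by (auto simp: initiation_compatible_Int intro: bounded_subset)
  have b2: "S \<inter> data_b2 P \<subseteq> S \<inter> data_b P" by (auto simp: data_b_def)
  show "lips (S \<inter> data_a P) (\<lambda>d. u_minus (riemann_fan P d))"
    by (rule lips_cong[OF left_state_lips[OF a(1) aW_minus_lips[OF a]]])
       (auto simp: data_a_def riemann_fan_a1 riemann_fan_a2)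
  show "lips (S \<inter> data_a P) (\<lambda>d. speed_V (riemann_fan P d))"
    by (rule lips_cong[OF aV_lips[OF a]]) (auto simp: data_a_def riemann_fan_a1 riemann_fan_a2)
  show "lips (S \<inter> data_a1 P) (\<lambda>d. u_plus (riemann_fan P d))"
    by (rule lips_cong[OF right_state_lips[OF a1(1) aW_plus_lips[OF a1]]]) (auto simp: riemann_fan_a1)
  show "lips (S \<inter> data_b P) (\<lambda>d. u_1 (riemann_fan P d))"
    by (rule lips_cong[OF left_state_lips[OF b(1) bW_lips(2)[OF b]]])
       (auto simp: data_b_def riemann_fan_b1 riemann_fan_b2)
  show "lips (S \<inter> data_b P) (\<lambda>d. u_3 (riemann_fan P d))"
    by (rule lips_cong[OF right_state_lips[OF b(1) bW_lips(2)[OF b]]])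
       (auto simp: data_b_def riemann_fan_b1 riemann_fan_b2 right_state_b1)
  show "lips (S \<inter> data_b2 P) (\<lambda>d. u_2 (riemann_fan P d))"
    by (rule lips_cong[OF lips_subset[OF bW_lips(3)[OF b] b2]]) (auto simp: riemann_fan_b2)
  show "lips (S \<inter> data_b2 P) (\<lambda>d. speed_V' (riemann_fan P d))"
    by (rule lips_cong[OF lips_uminus[OF lips_subset[OF bV_lips[OF b] b2]]]) (auto simp: riemann_fan_b2)
  show "lips (S \<inter> data_b2 P) (\<lambda>d. speed_V (riemann_fan P d))"
    by (rule lips_cong[OF lips_subset[OF bV_lips[OF b] b2]]) (auto simp: riemann_fan_b2)
qed

end

theorem theorem2p1:
  fixes P :: material
  assumes "0 < k3 P" and "k3 P < k1 P"
    and "0 < wM P" and "wM P < wm P"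
    and "kinetic_function P"
  shows "(\<forall>d \<in> data_a P \<union> data_b P. \<exists>!F. is_riemann_fan P d F) \<and>
    (\<forall>K S. compact K \<and> K \<subseteq> H1 P \<times> (H1 P \<union> H3 P) \<and>
           S \<subseteq> K \<inter> (data_a P \<union> data_b P) \<and> initiation_compatible P S \<longrightarrow>
      (\<exists>L. L-lipschitz_on (S \<inter> data_a P) (\<lambda>d. u_minus (riemann_fan P d)) \<and>
           L-lipschitz_on (S \<inter> data_a P) (\<lambda>d. speed_V (riemann_fan P d)) \<and>
           L-lipschitz_on (S \<inter> data_a1 P) (\<lambda>d. u_plus (riemann_fan P d)) \<and>
           L-lipschitz_on (S \<inter> data_b P) (\<lambda>d. u_1 (riemann_fan P d)) \<and>
           L-lipschitz_on (S \<inter> data_b P) (\<lambda>d. u_3 (riemann_fan P d)) \<and>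
           L-lipschitz_on (S \<inter> data_b2 P) (\<lambda>d. u_2 (riemann_fan P d)) \<and>
           L-lipschitz_on (S \<inter> data_b2 P) (\<lambda>d. speed_V' (riemann_fan P d)) \<and>
           L-lipschitz_on (S \<inter> data_b2 P) (\<lambda>d. speed_V (riemann_fan P d))) \<and>
      (\<exists>C. \<forall>d1\<in>S. \<forall>d2\<in>S. \<forall>A B t. A < B \<and> 0 \<le> t \<longrightarrow>
           integral {A..B} (\<lambda>x. norm (riemann_sol P d2 t x - riemann_sol P d1 t x))
           \<le> C * integral {A - c1 P * t..B + c1 P * t}
                   (\<lambda>x. norm (riemann_sol P d2 0 x - riemann_sol P d1 0 x))))"
proof -
  interpret phase_material P by unfold_locales (fact assms)+
  show ?thesis
  proof (intro conjI allI impI ballI riemann_fan_ex1)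
    fix K S
    assume "compact K \<and> K \<subseteq> H1 P \<times> (H1 P \<union> H3 P) \<and>
      S \<subseteq> K \<inter> (data_a P \<union> data_b P) \<and> initiation_compatible P S"
    then have S: "bounded S" "S \<subseteq> data_a P \<union> data_b P" "initiation_compatible P S"
      using compact_imp_bounded bounded_subset by blast+
    show "\<exists>C. \<forall>d1\<in>S. \<forall>d2\<in>S. \<forall>A B t. A < B \<and> 0 \<le> t \<longrightarrow>
           integral {A..B} (\<lambda>x. norm (riemann_sol P d2 t x - riemann_sol P d1 t x))
           \<le> C * integral {A - c1 P * t..B + c1 P * t}
                   (\<lambda>x. norm (riemann_sol P d2 0 x - riemann_sol P d1 0 x))"
      by (rule riemann_sol_L1[OF S])
    show "\<exists>L. L-lipschitz_on (S \<inter> data_a P) (\<lambda>d. u_minus (riemann_fan P d)) \<and>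
           L-lipschitz_on (S \<inter> data_a P) (\<lambda>d. speed_V (riemann_fan P d)) \<and>
           L-lipschitz_on (S \<inter> data_a1 P) (\<lambda>d. u_plus (riemann_fan P d)) \<and>
           L-lipschitz_on (S \<inter> data_b P) (\<lambda>d. u_1 (riemann_fan P d)) \<and>
           L-lipschitz_on (S \<inter> data_b P) (\<lambda>d. u_3 (riemann_fan P d)) \<and>
           L-lipschitz_on (S \<inter> data_b2 P) (\<lambda>d. u_2 (riemann_fan P d)) \<and>
           L-lipschitz_on (S \<inter> data_b2 P) (\<lambda>d. speed_V' (riemann_fan P d)) \<and>
           L-lipschitz_on (S \<inter> data_b2 P) (\<lambda>d. speed_V (riemann_fan P d))"
      by (rule eventually_happens'[OF trivial_limit_at_top_linorder])
         (intro eventually_conj lips_eventually component_lips[OF S(1,3)])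
  qed
qed

end
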